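(* The fundamental group of a compact Hessian manifold is infinite.
   Context: All smooth manifolds are connected and without boundary. An affine manifold $(M,\nabla)$ is a smooth manifold $M$ with a flat and torsion-free connection $\nabla$ on its tangent bundle. A Hessian metric on $(M,\nabla)$ is a Riemannian metric $h$ on $M$ such that every point has an open neighbourhood $U$ and a function $f\in C^\infty(U)$ with $h|_U=\nabla(df)$; then $((M,\nabla),h)$ is called a Hessian manifold.
   Formalization: The manifold is taken to have dimension at least 1; in dimension 0 the claim fails, since a single point is a compact Hessian manifold with trivial fundamental group. *)

theory Defs
  imports "HOL-Analysis.Analysis" "HOL-Algebra.Group"
begin

section \<open>Smooth functions between normed spaces\<close>

text \<open>The class \<open>C\<^sup>k\<close> on an open set, in terms of iterated directional derivatives;
  only used for open subsets of finite-dimensional spaces.\<close>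

primrec Ck_on :: "nat \<Rightarrow> 'a::real_normed_vector set \<Rightarrow> ('a \<Rightarrow> 'b::real_normed_vector) \<Rightarrow> bool" where
  "Ck_on 0 S f \<longleftrightarrow> continuous_on S f"
| "Ck_on (Suc k) S f \<longleftrightarrow>
     (\<forall>x\<in>S. f differentiable (at x)) \<and>
     (\<forall>v. Ck_on k S (\<lambda>x. frechet_derivative f (at x) v))"

definition smooth_on :: "'a::real_normed_vector set \<Rightarrow> ('a \<Rightarrow> 'b::real_normed_vector) \<Rightarrow> bool" where
  "smooth_on S f \<longleftrightarrow> (\<forall>k. Ck_on k S f)"


section \<open>Smooth manifolds\<close>

text \<open>A tangent vector acts on real functions, a vector field assigns a tangent vector to each point.\<close>

type_synonym 'a tvec = "('a \<Rightarrow> real) \<Rightarrow> real"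
type_synonym 'a vfield = "'a \<Rightarrow> 'a tvec"

text \<open>The manifold is a set \<open>M\<close> with the subspace topology; a chart is a pair of its domain and
  a coordinate map, whose values outside the domain are irrelevant. The atlas need not be maximal.
  The dimension is \<open>CARD('n)\<close>, hence at least 1.\<close>

locale smooth_manifold =
  fixes M :: "'a::topological_space set"
    and charts :: "('a set \<times> ('a \<Rightarrow> real ^ 'n)) set"
  assumes connected: "connected M"
    and Hausdorff: "Hausdorff_space (top_of_set M)"
    and second_countable: "second_countable (top_of_set M)"
    and chart_domain_open: "\<And>V \<phi>. (V, \<phi>) \<in> charts \<Longrightarrow> openin (top_of_set M) V"
    and chart_image_open: "\<And>V \<phi>. (V, \<phi>) \<in> charts \<Longrightarrow> open (\<phi> ` V)"
    and chart_homeomorphism: "\<And>V \<phi>. (V, \<phi>) \<in> charts \<Longrightarrow> \<exists>\<psi>. homeomorphism V (\<phi> ` V) \<phi> \<psi>"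
    and charts_cover: "(\<Union>(V, \<phi>)\<in>charts. V) = M"
    and charts_compatible: "\<And>V \<phi> W \<theta>. (V, \<phi>) \<in> charts \<Longrightarrow> (W, \<theta>) \<in> charts \<Longrightarrow>
           smooth_on (\<phi> ` (V \<inter> W)) (\<theta> \<circ> inv_into V \<phi>)"
begin

text \<open>\<open>smooth_fun U f\<close>: the restriction of \<open>f\<close> to the open set \<open>U\<close> belongs to \<open>C\<^sup>\<infinity>(U)\<close>.\<close>

definition smooth_fun :: "'a set \<Rightarrow> ('a \<Rightarrow> real) \<Rightarrow> bool" where
  "smooth_fun U f \<longleftrightarrow> openin (top_of_set M) U \<and>
     (\<forall>(V, \<phi>)\<in>charts. smooth_on (\<phi> ` (U \<inter> V)) (f \<circ> inv_into V \<phi>))"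

definition smooth_near :: "'a \<Rightarrow> ('a \<Rightarrow> real) \<Rightarrow> bool" where
  "smooth_near p f \<longleftrightarrow> (\<exists>U. p \<in> U \<and> smooth_fun U f)"

text \<open>The tangent space at \<open>p\<close> consists of the derivations of the algebra of germs at \<open>p\<close> of smooth
  functions. A derivation is represented as a function on all \<open>f\<close>, depending only on the germ of
  \<open>f\<close> at \<open>p\<close>, and with value 0 if \<open>f\<close> is not smooth near \<open>p\<close>.\<close>

definition tangent_space :: "'a \<Rightarrow> 'a tvec set" where
  "tangent_space p = {v.
     (\<forall>f g U. p \<in> U \<and> smooth_fun U f \<and> (\<forall>q\<in>U. f q = g q) \<longrightarrow> v f = v g) \<and>
     (\<forall>f g a b. smooth_near p f \<and> smooth_near p g \<longrightarrow>
        v (\<lambda>q. a * f q + b * g q) = a * v f + b * v g) \<and>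
     (\<forall>f g. smooth_near p f \<and> smooth_near p g \<longrightarrow>
        v (\<lambda>q. f q * g q) = v f * g p + f p * v g) \<and>
     (\<forall>f. \<not> smooth_near p f \<longrightarrow> v f = 0)}"

text \<open>Smooth vector fields on \<open>M\<close>, extended by 0 outside \<open>M\<close>.\<close>

definition vector_fields :: "'a vfield set" where
  "vector_fields = {X.
     (\<forall>p\<in>M. X p \<in> tangent_space p) \<and> (\<forall>p. p \<notin> M \<longrightarrow> X p = (\<lambda>f. 0)) \<and>
     (\<forall>U f. smooth_fun U f \<longrightarrow> smooth_fun U (\<lambda>p. X p f))}"

definition lie_bracket :: "'a vfield \<Rightarrow> 'a vfield \<Rightarrow> 'a vfield" where
  "lie_bracket X Y = (\<lambda>p f. if smooth_near p f
     then X p (\<lambda>q. Y q f) - Y p (\<lambda>q. X q f) else 0)"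

text \<open>Connections on the tangent bundle, as covariant derivatives \<open>\<nabla>\<^sub>X Y\<close>.\<close>

definition connection :: "('a vfield \<Rightarrow> 'a vfield \<Rightarrow> 'a vfield) \<Rightarrow> bool" where
  "connection nabla \<longleftrightarrow>
     (\<forall>X\<in>vector_fields. \<forall>Y\<in>vector_fields. nabla X Y \<in> vector_fields) \<and>
     (\<forall>X\<in>vector_fields. \<forall>X'\<in>vector_fields. \<forall>Y\<in>vector_fields. \<forall>f g.
        smooth_fun M f \<and> smooth_fun M g \<longrightarrow>
        nabla (\<lambda>p u. f p * X p u + g p * X' p u) Y
          = (\<lambda>p u. f p * nabla X Y p u + g p * nabla X' Y p u)) \<and>
     (\<forall>X\<in>vector_fields. \<forall>Y\<in>vector_fields. \<forall>Y'\<in>vector_fields. \<forall>a b :: real.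
        nabla X (\<lambda>p u. a * Y p u + b * Y' p u)
          = (\<lambda>p u. a * nabla X Y p u + b * nabla X Y' p u)) \<and>
     (\<forall>X\<in>vector_fields. \<forall>Y\<in>vector_fields. \<forall>f. smooth_fun M f \<longrightarrow>
        nabla X (\<lambda>p u. f p * Y p u)
          = (\<lambda>p u. X p f * Y p u + f p * nabla X Y p u))"

definition torsion :: "('a vfield \<Rightarrow> 'a vfield \<Rightarrow> 'a vfield) \<Rightarrow> 'a vfield \<Rightarrow> 'a vfield \<Rightarrow> 'a vfield" where
  "torsion nabla X Y = (\<lambda>p u. nabla X Y p u - nabla Y X p u - lie_bracket X Y p u)"

definition curvature ::
  "('a vfield \<Rightarrow> 'a vfield \<Rightarrow> 'a vfield) \<Rightarrow> 'a vfield \<Rightarrow> 'a vfield \<Rightarrow> 'a vfield \<Rightarrow> 'a vfield" where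
  "curvature nabla X Y Z = (\<lambda>p u.
     nabla X (nabla Y Z) p u - nabla Y (nabla X Z) p u - nabla (lie_bracket X Y) Z p u)"

definition torsion_free :: "('a vfield \<Rightarrow> 'a vfield \<Rightarrow> 'a vfield) \<Rightarrow> bool" where
  "torsion_free nabla \<longleftrightarrow>
     (\<forall>X\<in>vector_fields. \<forall>Y\<in>vector_fields. torsion nabla X Y = (\<lambda>p u. 0))"

definition flat :: "('a vfield \<Rightarrow> 'a vfield \<Rightarrow> 'a vfield) \<Rightarrow> bool" where
  "flat nabla \<longleftrightarrow>
     (\<forall>X\<in>vector_fields. \<forall>Y\<in>vector_fields. \<forall>Z\<in>vector_fields. curvature nabla X Y Z = (\<lambda>p u. 0))"

text \<open>The covariant derivative of the 1-form \<open>df\<close>: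
  \<open>(\<nabla>df)(X, Y) = X(df(Y)) - df(\<nabla>\<^sub>X Y)\<close>, where \<open>df(Y) = Y f\<close>. It makes sense at \<open>p\<close> as
  soon as \<open>f\<close> is smooth near \<open>p\<close>.\<close>

definition nabla_d ::
  "('a vfield \<Rightarrow> 'a vfield \<Rightarrow> 'a vfield) \<Rightarrow> ('a \<Rightarrow> real) \<Rightarrow> 'a vfield \<Rightarrow> 'a vfield \<Rightarrow> 'a \<Rightarrow> real" where
  "nabla_d nabla f X Y p = X p (\<lambda>q. Y q f) - nabla X Y p f"

definition riemannian_metric :: "('a \<Rightarrow> 'a tvec \<Rightarrow> 'a tvec \<Rightarrow> real) \<Rightarrow> bool" where
  "riemannian_metric h \<longleftrightarrow>
     (\<forall>p\<in>M. \<forall>v\<in>tangent_space p. \<forall>w\<in>tangent_space p. h p v w = h p w v) \<and>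
     (\<forall>p\<in>M. \<forall>v\<in>tangent_space p. \<forall>v'\<in>tangent_space p. \<forall>w\<in>tangent_space p. \<forall>a b.
        h p (\<lambda>u. a * v u + b * v' u) w = a * h p v w + b * h p v' w) \<and>
     (\<forall>p\<in>M. \<forall>v\<in>tangent_space p. v \<noteq> (\<lambda>u. 0) \<longrightarrow> h p v v > 0) \<and>
     (\<forall>X\<in>vector_fields. \<forall>Y\<in>vector_fields. smooth_fun M (\<lambda>p. h p (X p) (Y p)))"

end


section \<open>Affine and Hessian manifolds\<close>

locale affine_manifold = smooth_manifold M charts
  for M :: "'a::topological_space set" and charts :: "('a set \<times> ('a \<Rightarrow> real ^ 'n)) set" +
  fixes nabla :: "'a vfield \<Rightarrow> 'a vfield \<Rightarrow> 'a vfield"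
  assumes connection: "connection nabla"
    and flat: "flat nabla"
    and torsion_free: "torsion_free nabla"
begin

text \<open>Since every tangent vector extends to a global vector field, the identity of tensors
  \<open>h = \<nabla>(df)\<close> on \<open>U\<close> can be expressed by evaluating both sides on global vector fields at
  the points of \<open>U\<close>.\<close>

definition hessian_metric :: "('a \<Rightarrow> 'a tvec \<Rightarrow> 'a tvec \<Rightarrow> real) \<Rightarrow> bool" where
  "hessian_metric h \<longleftrightarrow> riemannian_metric h \<and>
     (\<forall>p\<in>M. \<exists>U f. p \<in> U \<and> smooth_fun U f \<and>
        (\<forall>q\<in>U. \<forall>X\<in>vector_fields. \<forall>Y\<in>vector_fields.
           h q (X q) (Y q) = nabla_d nabla f X Y q))"

end

locale hessian_manifold = affine_manifold M charts nabla
  for M :: "'a::topological_space set" and charts :: "('a set \<times> ('a \<Rightarrow> real ^ 'n)) set"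
    and nabla :: "'a vfield \<Rightarrow> 'a vfield \<Rightarrow> 'a vfield" +
  fixes h :: "'a \<Rightarrow> 'a tvec \<Rightarrow> 'a tvec \<Rightarrow> real"
  assumes hessian_metric: "hessian_metric h"


section \<open>The fundamental group\<close>

definition loops :: "'a::topological_space set \<Rightarrow> 'a \<Rightarrow> (real \<Rightarrow> 'a) set" where
  "loops S x = {p. path p \<and> path_image p \<subseteq> S \<and> pathstart p = x \<and> pathfinish p = x}"

definition loop_homotopy :: "'a::topological_space set \<Rightarrow> 'a \<Rightarrow> ((real \<Rightarrow> 'a) \<times> (real \<Rightarrow> 'a)) set" where
  "loop_homotopy S x = {(p, q). p \<in> loops S x \<and> q \<in> loops S x \<and> homotopic_paths S p q}"

definition fundamental_group :: "'a::topological_space set \<Rightarrow> 'a \<Rightarrow> (real \<Rightarrow> 'a) set monoid" where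
  "fundamental_group S x =
     \<lparr>carrier = loops S x // loop_homotopy S x,
      mult = (\<lambda>C D. \<Union>p\<in>C. \<Union>q\<in>D. loop_homotopy S x `` {p +++ q}),
      one = loop_homotopy S x `` {\<lambda>t. x}\<rparr>"

lemma loops_join: "p \<in> loops S x \<Longrightarrow> q \<in> loops S x \<Longrightarrow> p +++ q \<in> loops S x"
  by (auto simp: loops_def subset_path_image_join)

lemma loops_reversepath: "p \<in> loops S x \<Longrightarrow> reversepath p \<in> loops S x"
  by (auto simp: loops_def)

lemma loops_const: "x \<in> S \<Longrightarrow> (\<lambda>t. x) \<in> loops S x"
  by (auto simp: loops_def path_def path_image_def pathstart_def pathfinish_def)

lemma equiv_loop_homotopy: "equiv (loops S x) (loop_homotopy S x)"
proof (rule equivI)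
  show "loop_homotopy S x \<subseteq> loops S x \<times> loops S x"
    by (auto simp: loop_homotopy_def)
  show "refl_on (loops S x) (loop_homotopy S x)"
    by (auto simp: loop_homotopy_def refl_on_def loops_def)
  show "sym (loop_homotopy S x)"
    by (rule symI) (simp add: loop_homotopy_def homotopic_paths_sym)
  show "trans (loop_homotopy S x)"
    by (rule transI) (simp add: loop_homotopy_def, meson homotopic_paths_trans)
qed

lemma fundamental_group_mult_class:
  assumes "p \<in> loops S x" "q \<in> loops S x"
  shows "loop_homotopy S x `` {p} \<otimes>\<^bsub>fundamental_group S x\<^esub> loop_homotopy S x `` {q}
    = loop_homotopy S x `` {p +++ q}"
proof -
  have "loop_homotopy S x `` {p' +++ q'} = loop_homotopy S x `` {p +++ q}"
    if "(p, p') \<in> loop_homotopy S x" "(q, q') \<in> loop_homotopy S x" for p' q'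
  proof -
    have "(p +++ q, p' +++ q') \<in> loop_homotopy S x"
      using that loops_join[of _ S x]
      by (auto simp: loop_homotopy_def loops_def intro!: homotopic_paths_join)
    then show ?thesis
      using equiv_class_eq[OF equiv_loop_homotopy] by metis
  qed
  then have "(\<Union>p'\<in>loop_homotopy S x `` {p}. \<Union>q'\<in>loop_homotopy S x `` {q}.
        loop_homotopy S x `` {p' +++ q'})
      = (\<Union>p'\<in>loop_homotopy S x `` {p}. \<Union>q'\<in>loop_homotopy S x `` {q}.
        loop_homotopy S x `` {p +++ q})"
    by (intro SUP_cong refl) simp
  moreover have "loop_homotopy S x `` {p} \<noteq> {}" "loop_homotopy S x `` {q} \<noteq> {}"
    using equiv_class_self[OF equiv_loop_homotopy] assms by blast+
  ultimately show ?thesis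
    by (simp add: fundamental_group_def)
qed

lemma loop_unit_interval_image:
  assumes p: "p \<in> loops S x" and h: "homotopic_paths {0..1::real} a b"
  shows "homotopic_paths S (p \<circ> a) (p \<circ> b)"
  using p by (intro homotopic_paths_continuous_image[OF h])
    (auto simp: loops_def path_def path_image_def)

lemma loop_left_unit:
  assumes p: "p \<in> loops S x"
  shows "homotopic_paths S ((\<lambda>t. x) +++ p) p"
proof -
  have "homotopic_paths {0..1::real} (linepath 0 0 +++ linepath 0 1) (linepath 0 1)"
    by (rule homotopic_paths_lid') (auto simp: path_image_linepath closed_segment_eq_real_ivl)
  from loop_unit_interval_image[OF p this]
  have "homotopic_paths S (p \<circ> (linepath 0 0 +++ linepath 0 1)) (p \<circ> linepath 0 1)" .
  moreover have "p \<circ> (linepath 0 0 +++ linepath 0 1) = (\<lambda>t. x) +++ p"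
    using p by (auto simp: fun_eq_iff joinpaths_def linepath_def loops_def pathstart_def)
  moreover have "p \<circ> linepath 0 1 = p"
    by (auto simp: fun_eq_iff linepath_def)
  ultimately show ?thesis by simp
qed

lemma loop_left_inverse:
  assumes p: "p \<in> loops S x"
  shows "homotopic_paths S (reversepath p +++ p) (\<lambda>t. x)"
proof -
  have "homotopic_paths {0..1::real} (linepath 1 0 +++ reversepath (linepath 1 0))
      (linepath (pathstart (linepath 1 0)) (pathstart (linepath 1 0)))"
    by (rule homotopic_paths_rinv) (auto simp: path_image_linepath closed_segment_eq_real_ivl)
  then have "homotopic_paths {0..1::real} (linepath 1 0 +++ linepath 0 1) (linepath 1 1)"
    by simp
  from loop_unit_interval_image[OF p this]
  have "homotopic_paths S (p \<circ> (linepath 1 0 +++ linepath 0 1)) (p \<circ> linepath 1 1)" .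
  moreover have "p \<circ> (linepath 1 0 +++ linepath 0 1) = reversepath p +++ p"
    by (auto simp: fun_eq_iff joinpaths_def linepath_def reversepath_def)
  moreover have "p \<circ> linepath 1 1 = (\<lambda>t. x)"
    using p by (auto simp: fun_eq_iff linepath_def loops_def pathfinish_def algebra_simps)
  ultimately show ?thesis by simp
qed

lemma fundamental_group_is_group:
  assumes x: "x \<in> S"
  shows "group (fundamental_group S x)"
proof -
  let ?G = "fundamental_group S x"
  let ?c = "\<lambda>p. loop_homotopy S x `` {p}"
  have carrier: "carrier ?G = ?c ` loops S x" and one: "\<one>\<^bsub>?G\<^esub> = ?c (\<lambda>t. x)"
    by (auto simp: fundamental_group_def quotient_def)
  have class_eq: "?c p = ?c q"
    if "p \<in> loops S x" "q \<in> loops S x" "homotopic_paths S p q" for p q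
    using that by (intro equiv_class_eq[OF equiv_loop_homotopy]) (auto simp: loop_homotopy_def)
  note mult = fundamental_group_mult_class
  show ?thesis
  proof (rule groupI)
    fix C D assume "C \<in> carrier ?G" "D \<in> carrier ?G"
    then show "C \<otimes>\<^bsub>?G\<^esub> D \<in> carrier ?G"
      unfolding carrier by (auto simp: mult intro!: imageI loops_join)
  next
    show "\<one>\<^bsub>?G\<^esub> \<in> carrier ?G"
      unfolding carrier one using loops_const[OF x] by blast
  next
    fix C D E assume "C \<in> carrier ?G" "D \<in> carrier ?G" "E \<in> carrier ?G"
    then obtain p q r where pqr: "p \<in> loops S x" "q \<in> loops S x" "r \<in> loops S x"
      and "C = ?c p" "D = ?c q" "E = ?c r"
      unfolding carrier by auto
    moreover have "?c (p +++ (q +++ r)) = ?c ((p +++ q) +++ r)"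
      using pqr by (intro class_eq loops_join homotopic_paths_assoc) (auto simp: loops_def)
    ultimately show "C \<otimes>\<^bsub>?G\<^esub> D \<otimes>\<^bsub>?G\<^esub> E = C \<otimes>\<^bsub>?G\<^esub> (D \<otimes>\<^bsub>?G\<^esub> E)"
      by (simp add: mult loops_join)
  next
    fix C assume "C \<in> carrier ?G"
    then obtain p where p: "p \<in> loops S x" "C = ?c p"
      unfolding carrier by auto
    have "?c ((\<lambda>t. x) +++ p) = ?c p"
      using p x by (intro class_eq loops_join loops_const loop_left_unit) auto
    then show "\<one>\<^bsub>?G\<^esub> \<otimes>\<^bsub>?G\<^esub> C = C"
      using p x by (simp add: one mult loops_const)
    have "?c (reversepath p +++ p) = ?c (\<lambda>t. x)"
      using p x by (intro class_eq loops_join loops_const loops_reversepath loop_left_inverse) auto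
    then have "?c (reversepath p) \<otimes>\<^bsub>?G\<^esub> C = \<one>\<^bsub>?G\<^esub>"
      using p by (simp add: one mult loops_reversepath)
    moreover have "?c (reversepath p) \<in> carrier ?G"
      unfolding carrier using p loops_reversepath by blast
    ultimately show "\<exists>D\<in>carrier ?G. D \<otimes>\<^bsub>?G\<^esub> C = \<one>\<^bsub>?G\<^esub>" by blast
  qed
qed

end

theory Submission
  imports Defs
begin

text \<open>
  Near every point the functions \<open>f\<close> with \<open>\<nabla>(df) = h\<close> form an affine space of dimension \<open>n + 1\<close>:
  since \<open>\<nabla>\<close> is flat and torsion-free, \<open>df = \<alpha>\<close>, \<open>\<nabla>\<alpha> = 0\<close> is an integrable linear system, so that a
  solution is determined by its 1-jet at one point, and every 1-jet extends to a whole neighbourhood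
  whose size does not depend on it. Hence such potentials can be continued along all paths, and the
  result depends on the homotopy class only. If the fundamental group is finite, then only finitely
  many values arise at each point from a given germ. Their maximum is a continuous function, which
  attains its supremum on the compact manifold; at such a point some potential \<open>f\<close> has a local
  maximum, which contradicts the positivity of its Hessian \<open>h\<close>.
\<close>

section \<open>Calculus of \<open>C\<^sup>k\<close> functions\<close>

text \<open>The familiar route lifts everything to the universal cover, which would be compact and
  carry a global potential. No cover is built here: the branches stay on \<open>M\<close>, and their
  pointwise maximum takes the place of the potential upstairs. What remains of covering theory is
  unique lifting and homotopy invariance of continuation, proved for a sheaf known only through
  \<open>nice_neighbourhood\<close>.

  That one neighbourhood serves all jets comes from linearity: the only smallness condition is
  \<open>C * D \<le> 1/2\<close>, a bound on the coefficients times the diameter of the domain.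
  Affine coordinates are not constructed; the system is solved in an arbitrary chart, where flatness
  and torsion-freeness appear as the compatibility of mixed derivatives.

  A second obstacle is that connections and the Hessian identity are formulated for globally defined
  fields. Coordinate fields are therefore cut off by a bump function, and local formulas are derived
  at points near which the cutoff is constantly 1. Hausdorffness makes the extension by zero
  smooth.\<close>

lemma linear_basis_sum:
  fixes L :: "'b::euclidean_space \<Rightarrow> 'c::real_vector"
  assumes "linear L"
  shows "L v = (\<Sum>b\<in>Basis. (v \<bullet> b) *\<^sub>R L b)"
proof -
  have "L (\<Sum>b\<in>Basis. (v \<bullet> b) *\<^sub>R b) = (\<Sum>b\<in>Basis. (v \<bullet> b) *\<^sub>R L b)"
    using assms by (subst linear_sum) (auto simp: linear_scale)
  then show ?thesis by (subst (asm) euclidean_representation)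
qed

lemma has_derivative_imp_continuous_on:
  "(\<And>x. x \<in> S \<Longrightarrow> (f has_derivative f' x) (at x)) \<Longrightarrow> continuous_on S f"
  by (meson continuous_at_imp_continuous_on has_derivative_continuous)

lemma Ck_on_cong:
  assumes "open S" "\<And>x. x \<in> S \<Longrightarrow> f x = g x"
  shows "Ck_on k S f \<longleftrightarrow> Ck_on k S g"
  using assms
proof (induction k arbitrary: f g)
  case 0
  then show ?case using continuous_on_cong[of S S f g] by auto
next
  case (Suc k)
  have D: "(f has_derivative F) (at x) \<longleftrightarrow> (g has_derivative F) (at x)" if "x \<in> S" for x F
    using Suc.prems that has_derivative_transform_within_open[of f F x UNIV S g]
      has_derivative_transform_within_open[of g F x UNIV S f] by auto
  then have "f differentiable (at x) \<longleftrightarrow> g differentiable (at x)" if "x \<in> S" for x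
    using that by (simp add: differentiable_def)
  moreover have "frechet_derivative f (at x) = frechet_derivative g (at x)" if "x \<in> S" for x
    using D[OF that] by (simp add: frechet_derivative_def)
  ultimately show ?case
    using Suc.IH[OF Suc.prems(1), of "\<lambda>x. frechet_derivative f (at x) v" "\<lambda>x. frechet_derivative g (at x) v" for v]
    by simp
qed

text \<open>\<open>Ck_on\<close> is phrased with \<open>frechet_derivative\<close>; by uniqueness of
  derivatives any explicit formula may stand in for it. The inductions below then only have to
  recognise the formula of the product, quotient or chain rule as built from functions of class
  C^k.\<close>

lemma Ck_on_SucI:
  assumes "open S" "\<And>x. x \<in> S \<Longrightarrow> (f has_derivative f' x) (at x)"
    and "\<And>v. Ck_on k S (\<lambda>x. f' x v)"
  shows "Ck_on (Suc k) S f"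
proof -
  have "frechet_derivative f (at x) = f' x" if "x \<in> S" for x
    using assms(2)[OF that] by (rule frechet_derivative_at[symmetric])
  then show ?thesis
    using assms Ck_on_cong[of S "\<lambda>x. frechet_derivative f (at x) v" "\<lambda>x. f' x v" k for v]
    by (auto simp: differentiable_def)
qed

lemma Ck_on_SucD:
  assumes "Ck_on (Suc k) S f"
  shows "\<And>x. x \<in> S \<Longrightarrow> (f has_derivative frechet_derivative f (at x)) (at x)"
    "\<And>v. Ck_on k S (\<lambda>x. frechet_derivative f (at x) v)"
  using assms by (auto simp: frechet_derivative_works)

lemma Ck_on_subset: "Ck_on k S f \<Longrightarrow> T \<subseteq> S \<Longrightarrow> Ck_on k T f"
  by (induction k arbitrary: f) (auto intro: continuous_on_subset)

lemma Ck_on_imp_continuous_on: "Ck_on k S f \<Longrightarrow> continuous_on S f"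
  by (cases k) (auto intro!: continuous_at_imp_continuous_on differentiable_imp_continuous_within)

lemma Ck_on_Suc_imp: "Ck_on (Suc k) S f \<Longrightarrow> Ck_on k S f"
proof (induction k arbitrary: f)
  case 0
  then show ?case by (metis Ck_on.simps(1) Ck_on_imp_continuous_on)
next
  case (Suc k)
  then show ?case by (metis Ck_on.simps(2))
qed

lemma Ck_on_const: "Ck_on k S (\<lambda>x. c)"
  by (induction k arbitrary: c) (auto simp: frechet_derivative_const)

lemma Ck_on_linear:
  assumes "open S" "bounded_linear L"
  shows "Ck_on k S L"
proof (cases k)
  case 0
  then show ?thesis using assms by (simp add: linear_continuous_on)
next
  case (Suc m)
  show ?thesis unfolding Suc
    by (rule Ck_on_SucI[OF assms(1)])
      (use assms in \<open>auto intro: bounded_linear_imp_has_derivative Ck_on_const\<close>)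
qed

lemma Ck_on_bounded_linear:
  assumes "open S" "bounded_linear L" "Ck_on k S f"
  shows "Ck_on k S (\<lambda>x. L (f x))"
  using assms(3)
proof (induction k arbitrary: f)
  case 0
  then show ?case using assms bounded_linear.continuous_on by auto
next
  case (Suc k)
  show ?case
    by (rule Ck_on_SucI[OF assms(1) bounded_linear.has_derivative[OF assms(2) Ck_on_SucD(1)[OF Suc.prems]]])
      (use Suc.IH[OF Ck_on_SucD(2)[OF Suc.prems]] in auto)
qed

lemma Ck_on_add:
  assumes "open S" "Ck_on k S f" "Ck_on k S g"
  shows "Ck_on k S (\<lambda>x. f x + g x)"
  using assms(2,3)
proof (induction k arbitrary: f g)
  case 0
  then show ?case by (auto intro: continuous_on_add)
next
  case (Suc k)
  show ?case
    by (rule Ck_on_SucI[OF assms(1) has_derivative_add[OF Ck_on_SucD(1)[OF Suc.prems(1)] Ck_on_SucD(1)[OF Suc.prems(2)]]])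
      (use Suc.IH[OF Ck_on_SucD(2)[OF Suc.prems(1)] Ck_on_SucD(2)[OF Suc.prems(2)]] in auto)
qed

lemma Ck_on_scaleR:
  fixes a :: "'a::real_normed_vector \<Rightarrow> real"
  assumes "open S" "Ck_on k S a" "Ck_on k S f"
  shows "Ck_on k S (\<lambda>x. a x *\<^sub>R f x)"
  using assms(2,3)
proof (induction k arbitrary: a f)
  case 0
  then show ?case by (auto intro: continuous_on_scaleR)
next
  case (Suc k)
  \<comment> \<open>In each term of the product rule one factor stays undifferentiated; it enters at
    order \<open>k\<close> only, hence \<open>Ck_on_Suc_imp\<close>.\<close>
  show ?case
    by (rule Ck_on_SucI[OF assms(1) has_derivative_scaleR[OF Ck_on_SucD(1)[OF Suc.prems(1)] Ck_on_SucD(1)[OF Suc.prems(2)]]])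
      (use Suc.IH[OF Ck_on_Suc_imp[OF Suc.prems(1)] Ck_on_SucD(2)[OF Suc.prems(2)]]
        Suc.IH[OF Ck_on_SucD(2)[OF Suc.prems(1)] Ck_on_Suc_imp[OF Suc.prems(2)]] assms(1) in \<open>auto intro: Ck_on_add\<close>)
qed

lemma Ck_on_mult:
  fixes f g :: "'a::real_normed_vector \<Rightarrow> real"
  assumes "open S" "Ck_on k S f" "Ck_on k S g"
  shows "Ck_on k S (\<lambda>x. f x * g x)"
  using Ck_on_scaleR[OF assms] by simp

lemma Ck_on_diff:
  assumes "open S" "Ck_on k S f" "Ck_on k S g"
  shows "Ck_on k S (\<lambda>x. f x - g x)"
  using Ck_on_add[OF assms(1,2) Ck_on_scaleR[OF assms(1) Ck_on_const assms(3)], of "-1"] by simp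

lemma Ck_on_sum:
  assumes "open S" "\<And>i. i \<in> I \<Longrightarrow> Ck_on k S (f i)"
  shows "Ck_on k S (\<lambda>x. \<Sum>i\<in>I. f i x)"
  using assms(2) by (induction I rule: infinite_finite_induct) (auto intro: Ck_on_const Ck_on_add[OF assms(1)])

lemma Ck_on_compose:
  fixes g :: "'a::real_normed_vector \<Rightarrow> 'b::euclidean_space" and f :: "'b \<Rightarrow> 'c::real_normed_vector"
  assumes "open S" "open T" "g ` S \<subseteq> T" "Ck_on k T f" "Ck_on k S g"
  shows "Ck_on k S (\<lambda>x. f (g x))"
  using assms(4,5)
proof (induction k arbitrary: f)
  case 0
  then show ?case using assms(3) by (auto intro: continuous_on_compose2)
next
  case (Suc k)
  let ?f' = "\<lambda>x. frechet_derivative f (at x)" and ?g' = "\<lambda>x. frechet_derivative g (at x)"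
  \<comment> \<open>\<open>Ck_on\<close> speaks of derivatives in a fixed direction, whereas the
    chain rule evaluates the derivative of \<open>f\<close> in the moving direction
    \<open>?g' x v\<close>. Expanding that direction in the basis leaves only fixed directions, with
    coefficients of class C^k.\<close>
  have *: "((\<lambda>x. f (g x)) has_derivative (\<lambda>v. \<Sum>b\<in>Basis. (?g' x v \<bullet> b) *\<^sub>R ?f' (g x) b)) (at x)" if "x \<in> S" for x
  proof -
    have d: "(f has_derivative ?f' (g x)) (at (g x))"
      using Ck_on_SucD(1)[OF Suc.prems(1)] that assms(3) by auto
    have "?f' (g x) w = (\<Sum>b\<in>Basis. (w \<bullet> b) *\<^sub>R ?f' (g x) b)" for w
      by (rule linear_basis_sum[OF has_derivative_linear[OF d]])
    then have "(\<lambda>v. ?f' (g x) (?g' x v)) = (\<lambda>v. \<Sum>b\<in>Basis. (?g' x v \<bullet> b) *\<^sub>R ?f' (g x) b)"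
      by (intro ext) 
    with has_derivative_compose[OF Ck_on_SucD(1)[OF Suc.prems(2) that] d] show ?thesis by (rule has_derivative_eq_rhs)
  qed
  show ?case
  proof (rule Ck_on_SucI[OF assms(1) *])
    fix v
    have "Ck_on k S (\<lambda>x. ?f' (g x) b)" for b
      by (rule Suc.IH[OF Ck_on_SucD(2)[OF Suc.prems(1)] Ck_on_Suc_imp[OF Suc.prems(2)]])
    moreover have "Ck_on k S (\<lambda>x. ?g' x v \<bullet> b)" for b
      by (rule Ck_on_bounded_linear[OF assms(1) bounded_linear_inner_left Ck_on_SucD(2)[OF Suc.prems(2)]])
    ultimately show "Ck_on k S (\<lambda>x. \<Sum>b\<in>Basis. (?g' x v \<bullet> b) *\<^sub>R ?f' (g x) b)"
      by (intro Ck_on_sum Ck_on_scaleR assms(1))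
  qed
qed

lemma Ck_on_inverse:
  fixes f :: "'a::real_normed_vector \<Rightarrow> real"
  assumes "open S" "Ck_on k S f" "\<And>x. x \<in> S \<Longrightarrow> f x \<noteq> 0"
  shows "Ck_on k S (\<lambda>x. inverse (f x))"
  using assms(2)
proof (induction k)
  case 0
  then show ?case using assms(3) by (auto intro: continuous_on_inverse)
next
  case (Suc k)
  show ?case
  proof (rule Ck_on_SucI[OF assms(1) Deriv.has_derivative_inverse[OF assms(3) Ck_on_SucD(1)[OF Suc.prems]]])
    fix v
    have i: "Ck_on k S (\<lambda>x. inverse (f x))"
      by (rule Suc.IH[OF Ck_on_Suc_imp[OF Suc.prems]])
    have "Ck_on k S (\<lambda>x. inverse (f x) * frechet_derivative f (at x) v * inverse (f x))"
      by (intro Ck_on_mult assms(1) i Ck_on_SucD(2)[OF Suc.prems])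
    then show "Ck_on k S (\<lambda>x. - (inverse (f x) * frechet_derivative f (at x) v * inverse (f x)))"
      by (rule Ck_on_bounded_linear[OF assms(1) bounded_linear_minus[OF bounded_linear_ident]])
  qed
qed

lemma Ck_on_local:
  assumes "\<And>x. x \<in> S \<Longrightarrow> \<exists>T. open T \<and> x \<in> T \<and> Ck_on k T f"
  shows "Ck_on k S f"
  using assms
proof (induction k arbitrary: f)
  case 0
  then show ?case
    by (metis Ck_on.simps(1) continuous_at_imp_continuous_on continuous_on_eq_continuous_at)
next
  case (Suc k)
  then have "\<exists>T. open T \<and> x \<in> T \<and> Ck_on k T (\<lambda>x. frechet_derivative f (at x) v)" if "x \<in> S" for x v
    using that by (metis Ck_on.simps(2))
  moreover have "f differentiable (at x)" if "x \<in> S" for x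
    using Suc.prems[OF that] by auto
  ultimately show ?case using Suc.IH by simp
qed

section \<open>Smooth functions\<close>

lemma smooth_on_frechet_derivative:
  "smooth_on S f \<Longrightarrow> smooth_on S (\<lambda>x. frechet_derivative f (at x) v)"
  unfolding smooth_on_def using Ck_on_SucD(2) by blast

lemma smooth_on_has_derivative:
  "smooth_on S f \<Longrightarrow> x \<in> S \<Longrightarrow> (f has_derivative frechet_derivative f (at x)) (at x)"
  unfolding smooth_on_def using Ck_on_SucD(1) by blast

lemma smooth_on_imp_continuous_on: "smooth_on S f \<Longrightarrow> continuous_on S f"
  unfolding smooth_on_def using Ck_on_imp_continuous_on by blast

lemma smooth_on_subset: "smooth_on S f \<Longrightarrow> T \<subseteq> S \<Longrightarrow> smooth_on T f"
  unfolding smooth_on_def using Ck_on_subset by blast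

lemma smooth_on_const: "smooth_on S (\<lambda>x. c)"
  unfolding smooth_on_def using Ck_on_const by blast

lemma smooth_on_cong: "open S \<Longrightarrow> (\<And>x. x \<in> S \<Longrightarrow> f x = g x) \<Longrightarrow> smooth_on S f \<longleftrightarrow> smooth_on S g"
  by (simp add: smooth_on_def Ck_on_cong[of S f g])

lemma smooth_on_local:
  "(\<And>x. x \<in> S \<Longrightarrow> \<exists>T. open T \<and> x \<in> T \<and> smooth_on T f) \<Longrightarrow> smooth_on S f"
  unfolding smooth_on_def by (intro allI Ck_on_local) metis

lemma smooth_on_compose:
  fixes g :: "'a::real_normed_vector \<Rightarrow> 'b::euclidean_space" and f :: "'b \<Rightarrow> 'c::real_normed_vector"
  shows "open S \<Longrightarrow> open T \<Longrightarrow> g ` S \<subseteq> T \<Longrightarrow> smooth_on T f \<Longrightarrow> smooth_on S g \<Longrightarrow> smooth_on S (\<lambda>x. f (g x))"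
  unfolding smooth_on_def by (blast intro: Ck_on_compose)

lemma smooth_on_add: "open S \<Longrightarrow> smooth_on S f \<Longrightarrow> smooth_on S g \<Longrightarrow> smooth_on S (\<lambda>x. f x + g x)"
  by (simp add: smooth_on_def Ck_on_add)

lemma smooth_on_sum:
  "open S \<Longrightarrow> (\<And>i. i \<in> I \<Longrightarrow> smooth_on S (f i)) \<Longrightarrow> smooth_on S (\<lambda>x. \<Sum>i\<in>I. f i x)"
  by (simp add: smooth_on_def Ck_on_sum)

lemma smooth_on_mult:
  fixes f g :: "'a::real_normed_vector \<Rightarrow> real"
  shows "open S \<Longrightarrow> smooth_on S f \<Longrightarrow> smooth_on S g \<Longrightarrow> smooth_on S (\<lambda>x. f x * g x)"
  by (simp add: smooth_on_def Ck_on_mult)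

lemma smooth_on_linear: "open S \<Longrightarrow> bounded_linear L \<Longrightarrow> smooth_on S L"
  by (simp add: smooth_on_def Ck_on_linear)

lemma smooth_on_diff: "open S \<Longrightarrow> smooth_on S f \<Longrightarrow> smooth_on S g \<Longrightarrow> smooth_on S (\<lambda>x. f x - g x)"
  by (simp add: smooth_on_def Ck_on_diff)

lemma smooth_on_inverse:
  fixes f :: "'a::real_normed_vector \<Rightarrow> real"
  shows "open S \<Longrightarrow> smooth_on S f \<Longrightarrow> (\<And>x. x \<in> S \<Longrightarrow> f x \<noteq> 0) \<Longrightarrow> smooth_on S (\<lambda>x. inverse (f x))"
  by (simp add: smooth_on_def Ck_on_inverse)

lemma smooth_on_inner:
  fixes f g :: "'a::real_normed_vector \<Rightarrow> 'b::euclidean_space"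
  assumes "open S" "smooth_on S f" "smooth_on S g"
  shows "smooth_on S (\<lambda>x. f x \<bullet> g x)"
proof -
  have i: "smooth_on S (\<lambda>x. u x \<bullet> b)" if "smooth_on S u" for u :: "'a \<Rightarrow> 'b" and b
    using that Ck_on_bounded_linear[OF assms(1) bounded_linear_inner_left] unfolding smooth_on_def by blast
  have "f x \<bullet> g x = (\<Sum>b\<in>Basis. (f x \<bullet> b) * (g x \<bullet> b))" for x
    by (rule euclidean_inner)
  then show ?thesis
    using assms i by (simp add: smooth_on_sum smooth_on_mult)
qed

section \<open>Bump functions and integrals along rays\<close>

text \<open>The classical function that is flat at 0. The powers of \<open>1/t\<close> are included
  so that the family is closed under differentiation up to linear combinations, which lets
  smoothness be proved by one induction over all \<open>m\<close>.\<close>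

definition flat_exp :: "nat \<Rightarrow> real \<Rightarrow> real" where
  "flat_exp m t = (if t > 0 then (1/t) ^ m * exp (- (1/t)) else 0)"

text \<open>The substitution \<open>s = 1/t\<close> turns this into the decay of
  \<open>s^m / exp s\<close> at infinity.\<close>

lemma flat_exp_tendsto: "((\<lambda>t::real. (1/t)^m * exp (-(1/t))) \<longlongrightarrow> 0) (at_right 0)"
proof -
  have "((\<lambda>t::real. t^m / exp t) \<longlongrightarrow> 0) at_top"
    by (rule tendsto_power_div_exp_0)
  then have "((\<lambda>t::real. (inverse t)^m / exp (inverse t)) \<longlongrightarrow> 0) (at_right 0)"
    by (rule filterlim_compose) (rule filterlim_inverse_at_top_right)
  then show ?thesis by (simp add: exp_minus field_simps)
qed

lemma flat_exp_has_derivative: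
  "(flat_exp m has_real_derivative (flat_exp (m+2) t - real m * flat_exp (m+1) t)) (at t)"
proof -
  consider "t > 0" | "t < 0" | "t = 0" by linarith
  then show ?thesis
  proof cases
    case 1
    have "((\<lambda>t. (1/t) ^ m * exp (- (1/t))) has_real_derivative
       (real m * (1/t)^(m-1) * (-1/t^2) * exp (-(1/t)) + (1/t)^m * (exp (-(1/t)) * (1/t^2)))) (at t)"
      using 1 by (auto intro!: derivative_eq_intros simp: power2_eq_square)
    moreover have "real m * (1/t)^(m-1) * (-1/t^2) * exp (-(1/t)) + (1/t)^m * (exp (-(1/t)) * (1/t^2))
        = flat_exp (m+2) t - real m * flat_exp (m+1) t"
      using 1 by (cases m) (auto simp: flat_exp_def field_simps power2_eq_square)
    ultimately have "((\<lambda>t. (1/t) ^ m * exp (- (1/t))) has_real_derivative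
        flat_exp (m+2) t - real m * flat_exp (m+1) t) (at t)" by simp
    then show ?thesis
      by (rule has_field_derivative_transform_within_open[where S="{0<..}"]) (use 1 in \<open>auto simp: flat_exp_def\<close>)
  next
    case 2
    have "((\<lambda>t. 0) has_real_derivative flat_exp (m+2) t - real m * flat_exp (m+1) t) (at t)"
      using 2 by (auto simp: flat_exp_def)
    then show ?thesis
      by (rule has_field_derivative_transform_within_open[where S="{..<0}"]) (use 2 in \<open>auto simp: flat_exp_def\<close>)
  next
    case 3
    \<comment> \<open>At 0 the difference quotient is \<open>flat_exp (Suc m)\<close> from the right
      and identically 0 from the left.\<close>
    have r: "((\<lambda>h. flat_exp m h / h) \<longlongrightarrow> 0) (at_right 0)"
      using flat_exp_tendsto[of "Suc m"]
      by (rule Lim_transform_eventually) (auto simp: flat_exp_def eventually_at_right_less intro!: eventually_at_rightI[of 0 1])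
    have l: "((\<lambda>h. flat_exp m h / h) \<longlongrightarrow> 0) (at_left 0)"
      by (rule Lim_transform_eventually[OF tendsto_const]) (auto simp: flat_exp_def intro!: eventually_at_leftI[of "-1" 0])
    have "((\<lambda>h. flat_exp m h / h) \<longlongrightarrow> 0) (at 0)"
      using l r by (simp add: filterlim_at_split)
    then have "((\<lambda>h. (flat_exp m (0 + h) - flat_exp m 0) / h) \<longlongrightarrow> 0) (at 0)"
      by (simp add: flat_exp_def)
    then show ?thesis using 3 unfolding DERIV_def by (simp add: flat_exp_def)
  qed
qed

lemma smooth_on_flat_exp: "smooth_on UNIV (flat_exp m)"
proof -
  have "Ck_on k UNIV (flat_exp m)" for k
  proof (induction k arbitrary: m)
    case 0
    have "continuous_on UNIV (flat_exp m)"
      by (meson DERIV_isCont continuous_at_imp_continuous_on flat_exp_has_derivative)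
    then show ?case by simp
  next
    case (Suc k)
    have "Ck_on k UNIV (\<lambda>t. (flat_exp (m+2) t - real m * flat_exp (m+1) t) * v)" for v
      by (intro Ck_on_mult Ck_on_diff Suc.IH Ck_on_const open_UNIV)
    then show ?case
      by (intro Ck_on_SucI[OF open_UNIV flat_exp_has_derivative[unfolded has_field_derivative_def]])
  qed
  then show ?thesis by (simp add: smooth_on_def)
qed

text \<open>The quotient \<open>u / (u + w)\<close>, where \<open>u\<close> is positive exactly at
  distance less than \<open>2 * r\<close> from \<open>c\<close> and \<open>w\<close> exactly at
  distance greater than \<open>r\<close>. The squared distance is used because it is smooth at
  \<open>c\<close> too.\<close>

lemma smooth_bump_exists:
  fixes c :: "'a::euclidean_space"
  assumes "r > 0"
  obtains b :: "'a \<Rightarrow> real" where "smooth_on UNIV b" "\<And>x. x \<in> ball c r \<Longrightarrow> b x = 1"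
    "\<And>x. x \<notin> cball c (2*r) \<Longrightarrow> b x = 0"
proof -
  define s where "s x = (x - c) \<bullet> (x - c)" for x :: 'a
  define u where "u x = flat_exp 0 (4*r^2 - s x)" for x
  define w where "w x = flat_exp 0 (s x - r^2)" for x
  have sub: "smooth_on UNIV (\<lambda>x::'a. x - c)"
    by (intro smooth_on_diff smooth_on_const open_UNIV smooth_on_linear bounded_linear_ident)
  have s: "smooth_on UNIV s"
    unfolding s_def by (intro smooth_on_inner sub open_UNIV)
  have u: "smooth_on UNIV u" and w: "smooth_on UNIV w"
    unfolding u_def w_def
    by (auto intro!: smooth_on_compose[OF _ open_UNIV _ smooth_on_flat_exp] smooth_on_diff smooth_on_const s)
  have nz: "u x + w x \<noteq> 0" for x
  proof -
    \<comment> \<open>The two arguments add up to \<open>3 * r^2\<close>, so one of them is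
      positive.\<close>
    have "4*r^2 - s x > 0 \<or> s x - r^2 > 0" using assms by (smt (verit) zero_less_power)
    moreover have "flat_exp 0 t \<ge> 0" "t > 0 \<Longrightarrow> flat_exp 0 t > 0" for t by (auto simp: flat_exp_def)
    ultimately show ?thesis unfolding u_def w_def by (metis add_nonneg_eq_0_iff less_irrefl)
  qed
  define b where "b x = u x * inverse (u x + w x)" for x
  show thesis
  proof
    show "smooth_on UNIV b"
      unfolding b_def by (intro smooth_on_mult smooth_on_inverse smooth_on_add u w open_UNIV nz)
    have ns: "s x = (dist c x)^2" for x
      by (simp add: s_def dist_norm norm_minus_commute[of c x] power2_norm_eq_inner)
    show "b x = 1" if "x \<in> ball c r" for x
    proof -
      have "s x < r^2" unfolding ns using that by (simp add: power_strict_mono)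
      then have "w x = 0" by (simp add: w_def flat_exp_def)
      then show ?thesis using nz[of x] by (simp add: b_def)
    qed
    show "b x = 0" if "x \<notin> cball c (2*r)" for x
    proof -
      have "(2*r)^2 < s x" unfolding ns using that assms by (intro power_strict_mono) auto
      then show ?thesis by (simp add: b_def u_def flat_exp_def power_mult_distrib)
    qed
  qed
qed

section \<open>Integrals along rays and Hadamard's lemma\<close>

lemma segment_in_convex:
  assumes "convex S" "q \<in> S" "x \<in> S" "t \<in> {0..1::real}"
  shows "q + t *\<^sub>R (x - q) \<in> S"
proof -
  have "(1 - t) *\<^sub>R q + t *\<^sub>R x \<in> S" using assms by (intro convexD_alt) auto
  then show ?thesis by (simp add: algebra_simps)
qed

text \<open>Differentiating \<open>g (q + t *\<^sub>R (x - q))\<close> in \<open>x\<close> produces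
  a factor \<open>t\<close>. With the weight \<open>t^m\<close> built in, the derivative is again an
  integral of the same kind, with \<open>Suc m\<close> and a directional derivative of
  \<open>g\<close>, so that smoothness follows by induction.\<close>

lemma has_derivative_ray_integral:
  fixes g :: "'a::euclidean_space \<Rightarrow> 'b::euclidean_space"
  assumes S: "convex S" "open S" "q \<in> S"
    and g: "\<And>x. x \<in> S \<Longrightarrow> (g has_derivative g' x) (at x)"
    and g': "\<And>w. continuous_on S (\<lambda>x. g' x w)"
    and x: "x \<in> S"
  shows "((\<lambda>x. integral {0..1} (\<lambda>t. t^m *\<^sub>R g (q + t *\<^sub>R (x - q)))) has_derivative
     (\<lambda>w. integral {0..1} (\<lambda>t. t^Suc m *\<^sub>R g' (q + t *\<^sub>R (x - q)) w))) (at x)"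
proof -
  let ?y = "\<lambda>x t. q + t *\<^sub>R (x - q)"
  have y: "?y x t \<in> S" if "x \<in> S" "t \<in> {0..1}" for x t
    using segment_in_convex[OF S(1,3)] that by blast
  \<comment> \<open>The Leibniz rule wants the derivative as a bounded operator that is continuous
    in the operator norm; in finite dimension this follows from continuity in each
    direction.\<close>
  define G where "G x = Blinfun (g' x)" for x
  have G: "blinfun_apply (G x) = g' x" if "x \<in> S" for x
    unfolding G_def by (rule bounded_linear_Blinfun_apply) (rule has_derivative_bounded_linear[OF g[OF that]])
  have "continuous_on S (\<lambda>x. G x w)" for w
    using g'[of w] by (rule continuous_on_eq) (simp add: G)
  then have cG: "continuous_on S G" by (rule continuous_on_blinfun_componentwise)
  have cg: "continuous_on S g"
    using g by (rule has_derivative_imp_continuous_on)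
  have cy: "continuous_on (S \<times> cbox 0 1) (\<lambda>z. ?y (fst z) (snd z))"
    by (intro continuous_intros)
  have cyS: "(\<lambda>z. ?y (fst z) (snd z)) ` (S \<times> cbox 0 1) \<subseteq> S"
    using y by auto
  have *: "((\<lambda>x. integral (cbox 0 1) (\<lambda>t. t^m *\<^sub>R g (?y x t))) has_derivative
      integral (cbox 0 1) (\<lambda>t. t^Suc m *\<^sub>R G (?y x t))) (at x within S)"
  proof (rule leibniz_rule[OF _ _ _ x S(1)])
    fix z t assume zt: "z \<in> S" "t \<in> cbox (0::real) 1"
    have "(g has_derivative g' (?y z t)) (at (?y z t))" using g y zt by auto
    moreover have "((\<lambda>x. ?y x t) has_derivative (\<lambda>w. t *\<^sub>R w)) (at z within S)"
      by (auto intro!: derivative_eq_intros)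
    ultimately have "((\<lambda>x. g (?y x t)) has_derivative (\<lambda>w. g' (?y z t) (t *\<^sub>R w))) (at z within S)"
      by (rule has_derivative_compose[rotated])
    moreover have "linear (g' (?y z t))" using g y zt by (metis box_real(2) has_derivative_linear)
    ultimately have "((\<lambda>x. g (?y x t)) has_derivative (\<lambda>w. t *\<^sub>R g' (?y z t) w)) (at z within S)"
      by (simp add: linear_scale)
    from has_derivative_scaleR_right[OF this, of "t^m"]
    show "((\<lambda>x. t^m *\<^sub>R g (?y x t)) has_derivative blinfun_apply (t^Suc m *\<^sub>R G (?y z t))) (at z within S)"
      using G y zt by (simp add: scaleR_blinfun.rep_eq mult.commute)
  next
    fix z assume "z \<in> S"
    then have "continuous_on (cbox 0 1) (\<lambda>t. t^m *\<^sub>R g (?y z t))"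
      by (intro continuous_intros continuous_on_compose2[OF cg]) (use y in auto)
    then show "(\<lambda>t. t^m *\<^sub>R g (?y z t)) integrable_on cbox 0 1" by (rule integrable_continuous)
  next
    show "continuous_on (S \<times> cbox 0 1) (\<lambda>(x, t). t^Suc m *\<^sub>R G (?y x t))"
      unfolding split_beta
      by (intro continuous_intros continuous_on_compose2[OF cG cy cyS])
  qed
  have "blinfun_apply (integral (cbox 0 1) (\<lambda>t. t^Suc m *\<^sub>R G (?y x t))) w =
      integral {0..1} (\<lambda>t. t^Suc m *\<^sub>R g' (?y x t) w)" for w
  proof -
    have "continuous_on (cbox 0 1) (\<lambda>t. t^Suc m *\<^sub>R G (?y x t))"
      by (intro continuous_intros continuous_on_compose2[OF cG]) (use y x in auto)
    then have "(\<lambda>t. t^Suc m *\<^sub>R G (?y x t)) integrable_on cbox 0 1" by (rule integrable_continuous)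
    then have "blinfun_apply (integral (cbox 0 1) (\<lambda>t. t^Suc m *\<^sub>R G (?y x t))) w =
       integral (cbox 0 1) (\<lambda>t. blinfun_apply (t^Suc m *\<^sub>R G (?y x t)) w)"
      by (rule blinfun_apply_integral)
    also have "\<dots> = integral {0..1} (\<lambda>t. t^Suc m *\<^sub>R g' (?y x t) w)"
      unfolding box_real by (rule integral_cong) (use y x in \<open>simp add: G scaleR_blinfun.rep_eq\<close>)
    finally show ?thesis .
  qed
  then have "blinfun_apply (integral (cbox 0 1) (\<lambda>t. t^Suc m *\<^sub>R G (?y x t))) =
      (\<lambda>w. integral {0..1} (\<lambda>t. t^Suc m *\<^sub>R g' (?y x t) w))" by blast
  with * show ?thesis using at_within_open[OF x S(2)] by (simp add: box_real)
qed

lemma smooth_on_ray_integral: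
  fixes g :: "'a::euclidean_space \<Rightarrow> 'b::euclidean_space"
  assumes S: "convex S" "open S" "q \<in> S" and g: "smooth_on S g"
  shows "smooth_on S (\<lambda>x. integral {0..1} (\<lambda>t. t^m *\<^sub>R g (q + t *\<^sub>R (x - q))))"
proof -
  have "Ck_on k S (\<lambda>x. integral {0..1} (\<lambda>t. t^m *\<^sub>R g (q + t *\<^sub>R (x - q))))" for k
    using g
  proof (induction k arbitrary: m g)
    case (0 m g)
    have "continuous_on S (\<lambda>x. frechet_derivative g (at x) w)" for w
      by (intro smooth_on_imp_continuous_on smooth_on_frechet_derivative 0)
    from has_derivative_imp_continuous_on[OF has_derivative_ray_integral[OF S smooth_on_has_derivative[OF 0] this]]
    show ?case by simp
  next
    case (Suc k m g)
    have c: "continuous_on S (\<lambda>x. frechet_derivative g (at x) w)" for w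
      by (intro smooth_on_imp_continuous_on smooth_on_frechet_derivative Suc)
    show ?case
      by (rule Ck_on_SucI[OF S(2) has_derivative_ray_integral[OF S smooth_on_has_derivative[OF Suc.prems] c]])
        (assumption | rule Suc.IH[OF smooth_on_frechet_derivative[OF Suc.prems]])+
  qed
  then show ?thesis by (simp add: smooth_on_def)
qed

text \<open>The fundamental theorem of calculus along the segment from \<open>q\<close> to
  \<open>x\<close>: the coefficients are the partial derivatives of \<open>g\<close> averaged over
  that segment.\<close>

lemma hadamard_lemma:
  fixes g :: "'a::euclidean_space \<Rightarrow> real"
  assumes S: "convex S" "open S" "q \<in> S" and g: "smooth_on S g"
  obtains G where "\<And>b. smooth_on S (G b)" "\<And>b. G b q = frechet_derivative g (at q) b"
    "\<And>x. x \<in> S \<Longrightarrow> g x = g q + (\<Sum>b\<in>Basis. ((x - q) \<bullet> b) * G b x)"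
proof
  let ?y = "\<lambda>x t. q + t *\<^sub>R (x - q)" and ?g' = "\<lambda>x. frechet_derivative g (at x)"
  \<comment> \<open>The factor \<open>t^0\<close> only brings the integrand into the form of
    \<open>smooth_on_ray_integral\<close>.\<close>
  let ?G = "\<lambda>b x. integral {0..1} (\<lambda>t. t^0 *\<^sub>R ?g' (?y x t) b)"
  show "smooth_on S (?G b)" for b
    by (intro smooth_on_ray_integral S smooth_on_frechet_derivative g)
  show "?G b q = frechet_derivative g (at q) b" for b
    by simp
  fix x assume x: "x \<in> S"
  have y: "?y x t \<in> S" if "t \<in> {0..1}" for t
    using segment_in_convex[OF S(1,3) x that] .
  have "((\<lambda>t. ?g' (?y x t) (x - q)) has_integral g (?y x 1) - g (?y x 0)) {0..1}"
  proof (rule fundamental_theorem_of_calculus)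
    fix t :: real assume t: "t \<in> {0..1}"
    have "((\<lambda>t. ?y x t) has_derivative (\<lambda>s. s *\<^sub>R (x - q))) (at t within {0..1})"
      by (auto intro!: derivative_eq_intros)
    from has_derivative_compose[OF this smooth_on_has_derivative[OF g y[OF t]]]
    show "((\<lambda>t. g (?y x t)) has_vector_derivative ?g' (?y x t) (x - q)) (at t within {0..1})"
      unfolding has_vector_derivative_def
      using has_derivative_linear[OF smooth_on_has_derivative[OF g y[OF t]]] by (simp add: linear_scale)
  qed simp
  moreover have "?g' (?y x t) (x - q) = (\<Sum>b\<in>Basis. ((x - q) \<bullet> b) * ?g' (?y x t) b)" if "t \<in> {0..1}" for t
    unfolding real_scaleR_def[symmetric]
    by (rule linear_basis_sum[OF has_derivative_linear[OF smooth_on_has_derivative[OF g y[OF that]]]])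
  ultimately have I: "((\<lambda>t. \<Sum>b\<in>Basis. ((x - q) \<bullet> b) * ?g' (?y x t) b) has_integral g x - g q) {0..1}"
    by (subst has_integral_cong[symmetric]) auto
  have "(\<lambda>t. ?g' (?y x t) b) integrable_on {0..1}" for b
    by (intro integrable_continuous_interval continuous_on_compose2[OF smooth_on_imp_continuous_on[OF smooth_on_frechet_derivative[OF g]]] continuous_intros)
      (use y in auto)
  then have "((\<lambda>t. \<Sum>b\<in>Basis. ((x - q) \<bullet> b) * ?g' (?y x t) b) has_integral
      (\<Sum>b\<in>Basis. ((x - q) \<bullet> b) * ?G b x)) {0..1}"
    by (intro has_integral_sum has_integral_mult_right) (auto intro: integrable_integral)
  from has_integral_unique[OF this I] show "g x = g q + (\<Sum>b\<in>Basis. ((x - q) \<bullet> b) * ?G b x)"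
    by simp
qed

section \<open>Linear total differential systems\<close>

lemma norm_sum_minus_suminf_le:
  fixes f :: "nat \<Rightarrow> 'a::banach"
  assumes "\<And>i. norm (f i) \<le> a * r ^ i" "0 \<le> r" "r < 1"
  shows "summable f" "norm (sum f {..<n} - suminf f) \<le> a * r ^ n / (1 - r)"
proof -
  have "(\<lambda>i. a * r ^ (i + n)) sums (a * r ^ n / (1 - r))" for n
  proof -
    have "(\<lambda>i. (a * r ^ n) * r ^ i) sums ((a * r ^ n) * (1 / (1 - r)))"
      using assms(2,3) by (intro sums_mult geometric_sums) auto
    moreover have "(\<lambda>i. (a * r ^ n) * r ^ i) = (\<lambda>i. a * r ^ (i + n))"
      by (rule ext) (simp add: power_add)
    ultimately show ?thesis by simp
  qed
  then have s: "summable (\<lambda>i. a * r ^ (i + n))" "(\<Sum>i. a * r ^ (i + n)) = a * r ^ n / (1 - r)" for n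
    using sums_summable sums_unique by (blast, metis)
  show f: "summable f"
    by (rule summable_comparison_test'[OF s(1)[of 0]]) (use assms(1) in auto)
  have "sum f {..<n} - suminf f = - (\<Sum>i. f (i + n))"
    by (subst suminf_minus_initial_segment[OF f]) simp
  also have "norm \<dots> \<le> (\<Sum>i. a * r ^ (i + n))"
    unfolding norm_minus_cancel by (rule norm_suminf_le[OF assms(1) s(1)])
  finally show "norm (sum f {..<n} - suminf f) \<le> a * r ^ n / (1 - r)" using s(2) by simp
qed

text \<open>The equation meant is
  \<open>(u has_derivative (\<lambda>w. A x w (u x))) (at x)\<close>, with \<open>A'\<close> the
  derivative of the coefficients. The condition \<open>C * D \<le> 1/2\<close> makes integration
  along rays halve sup norms. It restricts the domain alone and not the initial value.\<close>

locale linear_system =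
  fixes A :: "'a::euclidean_space \<Rightarrow> 'a \<Rightarrow>\<^sub>L ('b::euclidean_space \<Rightarrow>\<^sub>L 'b)"
    and A' :: "'a \<Rightarrow> 'a \<Rightarrow> 'a \<Rightarrow>\<^sub>L ('b \<Rightarrow>\<^sub>L 'b)"
    and S :: "'a set" and C D C' :: real
  assumes S: "convex S" "open S"
    and CD: "0 \<le> C" "0 \<le> D" "C * D \<le> 1/2" "0 \<le> C'"
    and diam: "\<And>x y. x \<in> S \<Longrightarrow> y \<in> S \<Longrightarrow> norm (x - y) \<le> D"
    and norm_A: "\<And>x. x \<in> S \<Longrightarrow> norm (A x) \<le> C"
    and deriv_A: "\<And>x. x \<in> S \<Longrightarrow> (A has_derivative A' x) (at x)"
    and cont_A': "\<And>w. continuous_on S (\<lambda>x. A' x w)"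
    and norm_A': "\<And>x w. x \<in> S \<Longrightarrow> norm (A' x w) \<le> C' * norm w"
begin

lemma norm_A_apply: "x \<in> S \<Longrightarrow> norm (A x w u) \<le> C * norm w * norm u"
  using norm_A[of x] norm_blinfun[of "A x w" u] norm_blinfun[of "A x" w]
  by (smt (verit) mult_right_mono norm_ge_zero)

lemma norm_A'_apply: "x \<in> S \<Longrightarrow> norm (A' x v w u) \<le> C' * norm v * norm w * norm u"
  using norm_A'[of x v] norm_blinfun[of "A' x v w" u] norm_blinfun[of "A' x v" w]
  by (smt (verit) mult_right_mono norm_ge_zero)

lemma cont_A: "continuous_on S A"
  using deriv_A by (rule has_derivative_imp_continuous_on)

text \<open>At a point \<open>y\<close> where \<open>norm (u y)\<close> is maximal on the segment
  from \<open>q\<close> to \<open>x\<close>, the mean value inequality gives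
  \<open>norm (u y) \<le> C * D * norm (u y)\<close>, which is at most half of
  \<open>norm (u y)\<close>.\<close>

lemma unique:
  assumes "q \<in> S" "x \<in> S" "u q = 0" and u: "\<And>x. x \<in> S \<Longrightarrow> (u has_derivative (\<lambda>w. A x w (u x))) (at x)"
  shows "u x = 0"
proof -
  let ?I = "closed_segment q x"
  have sub: "?I \<subseteq> S" using S(1) assms by (simp add: closed_segment_subset)
  have "continuous_on ?I (\<lambda>x. norm (u x))"
    using u sub by (intro continuous_on_norm) (meson continuous_at_imp_continuous_on has_derivative_continuous subsetD)
  then obtain y where y: "y \<in> ?I" "\<And>z. z \<in> ?I \<Longrightarrow> norm (u z) \<le> norm (u y)"
    using continuous_attains_sup[of ?I "\<lambda>x. norm (u x)"] by auto
  have "norm (u y - u q) \<le> (C * norm (u y)) * norm (y - q)"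
  proof (rule differentiable_bound[of ?I])
    fix z assume z: "z \<in> ?I"
    show "(u has_derivative (\<lambda>w. A z w (u z))) (at z within ?I)"
      using u sub z by (meson has_derivative_at_withinI subsetD)
    show "onorm (\<lambda>w. A z w (u z)) \<le> C * norm (u y)"
    proof (rule onorm_le)
      fix w
      have "norm (A z w (u z)) \<le> C * norm w * norm (u z)" using norm_A_apply z sub by blast
      also have "\<dots> \<le> C * norm w * norm (u y)" using y z CD by (intro mult_left_mono) auto
      finally show "norm (A z w (u z)) \<le> C * norm (u y) * norm w" by (simp add: mult_ac)
    qed
  qed (use y in auto)
  also have "\<dots> \<le> (C * norm (u y)) * D"
    using diam[of y q] y(1) sub assms(1) CD by (intro mult_left_mono) auto
  also have "\<dots> = (C * D) * norm (u y)" by simp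
  also have "\<dots> \<le> 1/2 * norm (u y)" by (rule mult_right_mono) (use CD in auto)
  finally have "norm (u y) \<le> 0" using assms(3) by simp
  then show ?thesis using y(2)[of x] by simp
qed

end

section \<open>The integral operator along rays and its Neumann series\<close>

locale linear_system_at = linear_system +
  fixes q
  assumes q: "q \<in> S"
begin

abbreviation ray where "ray x t \<equiv> q + t *\<^sub>R (x - q)"

lemma ray: "x \<in> S \<Longrightarrow> t \<in> {0..1} \<Longrightarrow> ray x t \<in> S"
  using segment_in_convex[OF S(1) q] .

text \<open>A solution with value \<open>c\<close> at \<open>q\<close> satisfies
  \<open>u x = c + T u x\<close>, by integrating its derivative along the ray from \<open>q\<close>
  to \<open>x\<close>.\<close>

definition T where
  "T u x = integral {0..1} (\<lambda>t. A (ray x t) (x - q) (u (ray x t)))"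

text \<open>The derivative of \<open>T u\<close> in direction \<open>w\<close>, if \<open>u'\<close>
  is that of \<open>u\<close>: the factor \<open>x - q\<close> gives the first term, the points of
  the ray give the terms weighted by \<open>t\<close>. The derivative \<open>u'\<close> is an
  argument of its own so that an iteration can carry both.\<close>

definition dT where
  "dT u u' x w = integral {0..1} (\<lambda>t. A (ray x t) w (u (ray x t)) +
     t *\<^sub>R (A' (ray x t) w (x - q) (u (ray x t)) + A (ray x t) (x - q) (u' (ray x t) w)))"

lemma cont_ray:
  assumes "continuous_on S f"
  shows "continuous_on (S \<times> {0..1}) (\<lambda>z. f (ray (fst z) (snd z)))"
    and "x \<in> S \<Longrightarrow> continuous_on {0..1} (\<lambda>t. f (ray x t))"
  by (rule continuous_on_compose2[OF assms], intro continuous_intros, use ray in auto)+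

lemma integral_bound:
  fixes f :: "real \<Rightarrow> 'b"
  assumes "continuous_on {0..1} f" "\<And>t. t \<in> {0..1} \<Longrightarrow> norm (f t) \<le> B"
  shows "norm (integral {0..1} f) \<le> B"
  using integral_bound[of 0 1 f B] assms by auto

lemma T_bound:
  assumes "continuous_on S u" "\<And>x. x \<in> S \<Longrightarrow> norm (u x) \<le> K" "x \<in> S"
  shows "norm (T u x) \<le> K / 2"
  unfolding T_def
proof (rule integral_bound)
  show "continuous_on {0..1} (\<lambda>t. A (ray x t) (x - q) (u (ray x t)))"
    by (intro continuous_intros cont_ray(2) cont_A assms)
  fix t :: real assume "t \<in> {0..1}"
  then have y: "ray x t \<in> S" using ray assms by blast
  have "norm (A (ray x t) (x - q) (u (ray x t))) \<le> C * norm (x - q) * norm (u (ray x t))"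
    by (rule norm_A_apply[OF y])
  also have "\<dots> \<le> (1/2) * K"
  proof (rule mult_mono)
    show "C * norm (x - q) \<le> 1/2"
      using mult_left_mono[OF diam[OF assms(3) q] CD(1)] CD(3) by linarith
  qed (use assms(2)[OF y] CD in auto)
  finally show "norm (A (ray x t) (x - q) (u (ray x t))) \<le> K / 2" by simp
qed

text \<open>The bound \<open>L\<close> on the derivative comes back with the factor 1/2, as the sup
  norm does in \<open>T_bound\<close>; the other terms involve only the bound \<open>K\<close> on
  \<open>u\<close>.\<close>

lemma dT_bound:
  assumes "continuous_on S u" "\<And>x. x \<in> S \<Longrightarrow> norm (u x) \<le> K" "x \<in> S"
    "continuous_on S (\<lambda>x. u' x w)" "\<And>x. x \<in> S \<Longrightarrow> norm (u' x w) \<le> L * norm w"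
  shows "norm (dT u u' x w) \<le> ((C + D * C') * K + L / 2) * norm w"
proof -
  let ?a = "\<lambda>t. A (ray x t) w (u (ray x t))" and ?b = "\<lambda>t. A' (ray x t) w (x - q) (u (ray x t))"
  let ?c = "\<lambda>t. A (ray x t) (x - q) (u' (ray x t) w)"
  have cont: "continuous_on {0..1} (\<lambda>t. ?a t + t *\<^sub>R (?b t + ?c t))"
    by (intro continuous_intros cont_ray(2)[OF cont_A] cont_ray(2)[OF cont_A'] cont_ray(2)[OF assms(1)] cont_ray(2)[OF assms(4)] assms(3))
  have "norm (?a t + t *\<^sub>R (?b t + ?c t)) \<le> ((C + D * C') * K + L / 2) * norm w" if t: "t \<in> {0..1}" for t
  proof -
    have y: "ray x t \<in> S" using ray assms t by blast
    have K: "0 \<le> K" using assms(2,3) by (meson norm_ge_zero order_trans)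
    have Dx: "norm (x - q) \<le> D" by (rule diam[OF assms(3) q])
    have 1: "norm (?a t) \<le> C * norm w * K"
      using norm_A_apply[OF y, of w "u (ray x t)"] mult_left_mono[OF assms(2)[OF y], of "C * norm w"] CD by auto
    have "norm (?b t) \<le> C' * norm w * norm (x - q) * norm (u (ray x t))"
      by (rule norm_A'_apply[OF y])
    also have "\<dots> \<le> C' * norm w * D * K"
      using Dx assms(2)[OF y] CD by (intro mult_mono) auto
    finally have 2: "norm (?b t) \<le> C' * norm w * D * K" .
    have "norm (?c t) \<le> C * norm (x - q) * norm (u' (ray x t) w)"
      by (rule norm_A_apply[OF y])
    also have "\<dots> \<le> (1/2) * (L * norm w)"
    proof (rule mult_mono)
      show "C * norm (x - q) \<le> 1/2"
        using mult_left_mono[OF Dx CD(1)] CD(3) by linarith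
    qed (use assms(5)[OF y] CD in auto)
    finally have 3: "norm (?c t) \<le> (1/2) * (L * norm w)" .
    have "norm (t *\<^sub>R (?b t + ?c t))
        \<le> 1 * norm (?b t + ?c t)"
      unfolding norm_scaleR by (rule mult_right_mono) (use t in auto)
    also have "\<dots> \<le> C' * norm w * D * K + (1/2) * (L * norm w)"
      using norm_triangle_le[OF add_mono[OF 2 3]] by simp
    finally have "norm (?a t + t *\<^sub>R (?b t + ?c t))
       \<le> C * norm w * K + (C' * norm w * D * K + (1/2) * (L * norm w))"
      using norm_triangle_le[OF add_mono[OF 1]] by blast
    then show ?thesis by (simp add: algebra_simps)
  qed
  with cont show ?thesis unfolding dT_def by (rule integral_bound)
qed

lemma dT_continuous:
  assumes "continuous_on S u" "continuous_on S (\<lambda>x. u' x w)"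
  shows "continuous_on S (\<lambda>x. dT u u' x w)"
proof -
  have "continuous_on (S \<times> cbox 0 1) (\<lambda>(x, t). A (ray x t) w (u (ray x t)) +
     t *\<^sub>R (A' (ray x t) w (x - q) (u (ray x t)) + A (ray x t) (x - q) (u' (ray x t) w)))"
    unfolding split_beta box_real
    by (intro continuous_intros cont_ray(1)[OF cont_A] cont_ray(1)[OF cont_A'] cont_ray(1)[OF assms(1)] cont_ray(1)[OF assms(2)])
  from integral_continuous_on_param[OF this] show ?thesis by (simp add: dT_def box_real)
qed

text \<open>The variable \<open>x\<close> enters \<open>T\<close> both through the ray and through
  the direction \<open>x - q\<close>. Expanding that direction in the basis pulls it out of the
  integral, and \<open>has_derivative_ray_integral\<close> deals with what remains.\<close>

lemma T_has_derivative:
  assumes u: "\<And>x. x \<in> S \<Longrightarrow> (u has_derivative u' x) (at x)" and u': "\<And>w. continuous_on S (\<lambda>x. u' x w)"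
    and x: "x \<in> S"
  shows "(T u has_derivative dT u u' x) (at x)"
proof -
  have *: "B v f = (\<Sum>b\<in>Basis. (v \<bullet> b) *\<^sub>R B b f)" for B :: "'a \<Rightarrow>\<^sub>L ('b \<Rightarrow>\<^sub>L 'b)" and v f
    by (rule linear_basis_sum) (auto intro!: linearI simp: blinfun.bilinear_simps)
  define g where "g b z = A z b (u z)" for b z
  define g' where "g' b z w = A' z w b (u z) + A z b (u' z w)" for b z w
  have cu: "continuous_on S u"
    using u by (rule has_derivative_imp_continuous_on)
  have dg: "(g b has_derivative g' b z) (at z)" if "z \<in> S" for b z
  proof -
    have "((\<lambda>z. A z b) has_derivative (\<lambda>w. A' z w b)) (at z)"
      by (rule bounded_linear.has_derivative[OF blinfun.bounded_linear_left deriv_A[OF that]])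
    from bounded_bilinear.FDERIV[OF bounded_bilinear_blinfun_apply this u[OF that]]
    show ?thesis unfolding g_def g'_def by (simp add: add.commute)
  qed
  have cg': "continuous_on S (\<lambda>x. g' b x w)" for b w
    unfolding g'_def by (intro continuous_intros cu cont_A' cont_A u')
  have cg: "continuous_on S (g b)" for b
    using dg by (rule has_derivative_imp_continuous_on)
  let ?I = "\<lambda>b x. integral {0..1} (\<lambda>t. t^0 *\<^sub>R g b (ray x t))"
  let ?J = "\<lambda>b x w. integral {0..1} (\<lambda>t. t^Suc 0 *\<^sub>R g' b (ray x t) w)"
  have I: "(?I b has_derivative ?J b x) (at x)" for b
    by (rule has_derivative_ray_integral[OF S q dg cg' x]) 
  have "((\<lambda>x. \<Sum>b\<in>Basis. ((x - q) \<bullet> b) *\<^sub>R ?I b x) has_derivative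
      (\<lambda>w. \<Sum>b\<in>Basis. ((x - q) \<bullet> b) *\<^sub>R ?J b x w + (w \<bullet> b) *\<^sub>R ?I b x)) (at x)"
    by (intro has_derivative_sum has_derivative_scaleR I) (auto intro!: derivative_eq_intros)
  moreover have "(\<Sum>b\<in>Basis. ((z - q) \<bullet> b) *\<^sub>R ?I b z) = T u z" if z: "z \<in> S" for z
  proof -
    have "T u z = integral {0..1} (\<lambda>t. \<Sum>b\<in>Basis. ((z - q) \<bullet> b) *\<^sub>R g b (ray z t))"
      unfolding T_def g_def by (subst *) simp
    also have "\<dots> = (\<Sum>b\<in>Basis. integral {0..1} (\<lambda>t. ((z - q) \<bullet> b) *\<^sub>R g b (ray z t)))"
      by (intro integral_sum finite_Basis integrable_continuous_interval continuous_intros cont_ray(2)[OF cg z])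
    finally show ?thesis by simp
  qed
  ultimately have 1: "(T u has_derivative
      (\<lambda>w. \<Sum>b\<in>Basis. ((x - q) \<bullet> b) *\<^sub>R ?J b x w + (w \<bullet> b) *\<^sub>R ?I b x)) (at x)"
    by (rule has_derivative_transform_within_open[OF _ S(2) x])
  have "(\<Sum>b\<in>Basis. ((x - q) \<bullet> b) *\<^sub>R ?J b x w + (w \<bullet> b) *\<^sub>R ?I b x) = dT u u' x w" for w
  proof -
    have "dT u u' x w = integral {0..1} (\<lambda>t. \<Sum>b\<in>Basis. ((x - q) \<bullet> b) *\<^sub>R (t^Suc 0 *\<^sub>R g' b (ray x t) w) + (w \<bullet> b) *\<^sub>R g b (ray x t))"
      unfolding dT_def g_def g'_def
      by (subst *[of _ w], subst *[of _ "x - q"], subst *[of _ "x - q"])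
        (simp add: scaleR_sum_right sum.distrib[symmetric] scaleR_add_right algebra_simps)
    also have "\<dots> = (\<Sum>b\<in>Basis. integral {0..1} (\<lambda>t. ((x - q) \<bullet> b) *\<^sub>R (t^Suc 0 *\<^sub>R g' b (ray x t) w) + (w \<bullet> b) *\<^sub>R g b (ray x t)))"
      by (intro integral_sum finite_Basis integrable_continuous_interval continuous_intros cont_ray(2)[OF cg x] cont_ray(2)[OF cg' x])
    also have "\<dots> = (\<Sum>b\<in>Basis. ((x - q) \<bullet> b) *\<^sub>R ?J b x w + (w \<bullet> b) *\<^sub>R ?I b x)"
      by (intro sum.cong refl, subst integral_add)
        (auto intro!: integrable_continuous_interval continuous_intros cont_ray(2)[OF cg x] cont_ray(2)[OF cg' x]
          simp del: scaleR_scaleR)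
    finally show ?thesis by simp
  qed
  then show ?thesis using 1 by presburger
qed


text \<open>The terms of the Neumann series for \<open>u = c + T u\<close>, not its partial sums,
  each paired with its derivative.\<close>

primrec picard :: "'b \<Rightarrow> nat \<Rightarrow> ('a \<Rightarrow> 'b) \<times> ('a \<Rightarrow> 'a \<Rightarrow> 'b)" where
  "picard c 0 = ((\<lambda>x. c), (\<lambda>x w. 0))"
| "picard c (Suc n) = (T (fst (picard c n)), dT (fst (picard c n)) (snd (picard c n)))"

lemma picard_derivative:
  "x \<in> S \<Longrightarrow> (fst (picard c n) has_derivative snd (picard c n) x) (at x)"
  "continuous_on S (\<lambda>x. snd (picard c n) x w)"
  "continuous_on S (fst (picard c n))"
proof (induction n arbitrary: x w)
  case (Suc n)
  {
    case 1 then show ?case using T_has_derivative[OF Suc.IH(1,2)] by simp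
  next
    case 2 then show ?case using dT_continuous[where u'="snd (picard c n)" and w=w, OF Suc.IH(3,2)] by simp
  next
    case 3 
    have "(fst (picard c (Suc n)) has_derivative snd (picard c (Suc n)) x) (at x)" if "x \<in> S" for x
      using T_has_derivative[OF Suc.IH(1,2) that] by simp
    then show ?case by (rule has_derivative_imp_continuous_on)
  }
qed auto

text \<open>For the derivatives the inhomogeneous term of \<open>dT_bound\<close> decays at the same
  rate 1/2 at which \<open>dT\<close> contracts, so the rate 1/2 cannot be kept. With rate 3/4 and
  constant 4 the induction closes because 1 + 4/2 = 4 * 3/4.\<close>

lemma picard_bound:
  assumes "x \<in> S"
  shows "norm (fst (picard c n) x) \<le> norm c * (1/2) ^ n"
    and "norm (snd (picard c n) x w) \<le> (4 * (C + D * C') * norm c * (3/4) ^ n) * norm w"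
  using assms
proof (induction n arbitrary: x w)
  case 0
  case 2
  show ?case using CD by simp
next
  case (Suc n)
  {
    case 1
    show ?case using T_bound[OF picard_derivative(3) Suc.IH(1) 1] by simp
  next
    case 2
    have "norm (snd (picard c (Suc n)) x w) \<le>
        ((C + D * C') * (norm c * (1/2) ^ n) + (4 * (C + D * C') * norm c * (3/4) ^ n) / 2) * norm w"
      using dT_bound[where u'="snd (picard c n)" and w=w, OF picard_derivative(3) Suc.IH(1) 2 picard_derivative(2) Suc.IH(2)] by simp
    also have "\<dots> \<le> (4 * (C + D * C') * norm c * (3/4) ^ Suc n) * norm w"
    proof (rule mult_right_mono)
      have "(C + D * C') * norm c * (1/2) ^ n \<le> (C + D * C') * norm c * (3/4) ^ n"
        using CD by (intro mult_left_mono power_mono) auto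
      then show "(C + D * C') * (norm c * (1/2) ^ n) + (4 * (C + D * C') * norm c * (3/4) ^ n) / 2
          \<le> 4 * (C + D * C') * norm c * (3/4) ^ Suc n"
        unfolding power_Suc by argo
    qed simp
    finally show ?case .
  }
qed simp

text \<open>The series of values and the series of derivatives both have geometric majorants, so the
  sum may be differentiated termwise. The constants are 2 = 1/(1 - 1/2) and 16 = 4/(1 - 3/4). The
  bound on \<open>u'\<close> later starts the estimate of the defect.\<close>

lemma picard_limit:
  obtains u u' where "\<And>x. x \<in> S \<Longrightarrow> (u has_derivative u' x) (at x)" "\<And>w. continuous_on S (\<lambda>x. u' x w)"
    "\<And>x. x \<in> S \<Longrightarrow> norm (u x) \<le> 2 * norm c"
    "\<And>x w. x \<in> S \<Longrightarrow> norm (u' x w) \<le> (16 * (C + D * C') * norm c) * norm w"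
    "\<And>x. x \<in> S \<Longrightarrow> u x = c + T u x"
proof -
  define f f' where "f n = fst (picard c n)" and "f' n = snd (picard c n)" for n
  define M where "M = 4 * (C + D * C') * norm c"
  have M: "M \<ge> 0" using CD by (simp add: M_def)
  define u u' where "u x = (\<Sum>n. f n x)" and "u' x w = (\<Sum>n. f' n x w)" for x w
  have bf: "norm (f n x) \<le> norm c * (1/2) ^ n" if "x \<in> S" for x n
    using picard_bound(1)[OF that] by (simp add: f_def)
  have bf': "norm (f' n x w) \<le> (M * norm w) * (3/4) ^ n" if "x \<in> S" for x n w
    using picard_bound(2)[OF that, of c n w] by (simp add: f'_def M_def mult_ac)
  have tail: "norm (sum (\<lambda>i. f i x) {..<n} - u x) \<le> 2 * norm c * (1/2) ^ n"
    and summ: "summable (\<lambda>i. f i x)" if "x \<in> S" for x n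
    using norm_sum_minus_suminf_le[of "\<lambda>i. f i x" "norm c" "1/2"] bf[OF that] unfolding u_def by (auto simp: mult_ac)
  have tail': "norm (sum (\<lambda>i. f' i x w) {..<n} - u' x w) \<le> 4 * M * (3/4) ^ n * norm w"
    and summ': "summable (\<lambda>i. f' i x w)" if "x \<in> S" for x n w
    using norm_sum_minus_suminf_le[of "\<lambda>i. f' i x w" "M * norm w" "3/4"] bf'[OF that]
    unfolding u'_def by (auto simp: mult_ac)
  have lim0: "(\<lambda>n. K * r ^ n) \<longlonglongrightarrow> 0" if "0 \<le> r" "r < 1" for K r :: real
    using that by (auto intro!: tendsto_mult_right_zero LIMSEQ_realpow_zero)
  have ev: "\<forall>\<^sub>F n in sequentially. K * (3/4) ^ n < e" if "e > 0" for K e :: real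
    using lim0[of "3/4" K] that by (auto dest: order_tendstoD)
  have "\<exists>g. \<forall>x\<in>S. (\<lambda>n. f n x) sums (g x) \<and> (g has_derivative u' x) (at x within S)"
  proof (rule has_derivative_series[OF S(1)])
    show "(f n has_derivative f' n x) (at x within S)" if "x \<in> S" for n x
      using picard_derivative(1)[OF that] unfolding f_def f'_def by (rule has_derivative_at_withinI)
    show "\<forall>\<^sub>F n in sequentially. \<forall>x\<in>S. \<forall>h. norm ((\<Sum>i<n. f' i x h) - u' x h) \<le> e * norm h" if "e > 0" for e
      using ev[OF that, of "4 * M"]
    proof (rule eventually_mono, intro ballI allI)
      fix n x h assume n: "4 * M * (3/4) ^ n < e" and x: "x \<in> S"
      show "norm ((\<Sum>i<n. f' i x h) - u' x h) \<le> e * norm h"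
        by (rule order_trans[OF tail'[OF x] mult_right_mono]) (use n in auto)
    qed
    show "q \<in> S" by (rule q)
    show "(\<lambda>n. f n q) sums u q" unfolding u_def by (rule summable_sums[OF summ[OF q]])
  qed
  then obtain g where g: "\<And>x. x \<in> S \<Longrightarrow> (\<lambda>n. f n x) sums (g x)" "\<And>x. x \<in> S \<Longrightarrow> (g has_derivative u' x) (at x within S)"
    by blast
  have "g x = u x" if "x \<in> S" for x using g(1)[OF that] by (simp add: u_def sums_iff)
  then have du: "(u has_derivative u' x) (at x)" if "x \<in> S" for x
    using g(2)[OF that] at_within_open[OF that S(2)] has_derivative_transform[OF that _ g(2)[OF that], of u] by metis
  have cu: "continuous_on S u"
    using du by (rule has_derivative_imp_continuous_on)
  have cu': "continuous_on S (\<lambda>x. u' x w)" for w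
  proof (rule uniform_limit_theorem)
    show "uniform_limit S (\<lambda>n x. \<Sum>i<n. f' i x w) (\<lambda>x. u' x w) sequentially"
    proof (rule uniform_limitI)
      fix e :: real assume "e > 0"
      from ev[OF this, of "4 * M * norm w"]
      show "\<forall>\<^sub>F n in sequentially. \<forall>x\<in>S. dist (\<Sum>i<n. f' i x w) (u' x w) < e"
      proof (rule eventually_mono, intro ballI)
        fix n x assume n: "4 * M * norm w * (3/4) ^ n < e" and x: "x \<in> S"
        have "4 * M * norm w * (3/4) ^ n = 4 * M * (3/4) ^ n * norm w" by simp
        then show "dist (\<Sum>i<n. f' i x w) (u' x w) < e"
          unfolding dist_norm using tail'[OF x, where n=n and w=w] n by linarith
      qed
    qed
    show "\<forall>\<^sub>F n in sequentially. continuous_on S (\<lambda>x. \<Sum>i<n. f' i x w)"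
      unfolding f'_def by (intro always_eventually allI continuous_on_sum picard_derivative(2))
  qed simp
  have fp: "u x = c + T u x" if x: "x \<in> S" for x
  proof -
    have s: "continuous_on S (\<lambda>x. \<Sum>i<n. f i x)" for n
      unfolding f_def by (intro continuous_on_sum picard_derivative(3))
    \<comment> \<open>\<open>T\<close> shifts the series by one index. The passage to the limit then
      needs only \<open>T_bound\<close>, applied to the difference between a partial sum and
      \<open>u\<close>.\<close>
    have "T (\<lambda>x. \<Sum>i<n. f i x) x = (\<Sum>i<n. f (Suc i) x)" for n
    proof -
      have "T (\<lambda>x. \<Sum>i<n. f i x) x = integral {0..1} (\<lambda>t. \<Sum>i<n. A (ray x t) (x - q) (f i (ray x t)))"
        unfolding T_def by (simp add: blinfun.sum_right)
      also have "\<dots> = (\<Sum>i<n. integral {0..1} (\<lambda>t. A (ray x t) (x - q) (f i (ray x t))))"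
        unfolding f_def by (intro integral_sum finite_lessThan integrable_continuous_interval continuous_intros
           cont_ray(2)[OF cont_A x] cont_ray(2)[OF picard_derivative(3) x])
      finally show ?thesis by (simp add: f_def T_def)
    qed
    moreover have "(\<Sum>i<Suc n. f i x) = c + (\<Sum>i<n. f (Suc i) x)" for n
      by (subst sum.lessThan_Suc_shift) (simp add: f_def)
    ultimately have e: "T (\<lambda>x. \<Sum>i<n. f i x) x = (\<Sum>i<Suc n. f i x) - c" for n by (simp del: sum.lessThan_Suc)
    have "T (\<lambda>x. (\<Sum>i<n. f i x) - u x) x = T (\<lambda>x. \<Sum>i<n. f i x) x - T u x" for n
      unfolding T_def blinfun.diff_right
      by (intro integral_diff integrable_continuous_interval continuous_intros
           cont_ray(2)[OF cont_A x] cont_ray(2)[OF s x] cont_ray(2)[OF cu x])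
    then have "norm ((\<Sum>i<Suc n. f i x) - c - T u x) \<le> (2 * norm c * (1/2) ^ n) / 2" for n
      using T_bound[OF continuous_on_diff[OF s cu] tail x] unfolding e by simp
    then have "norm ((\<Sum>i<Suc n. f i x) - c - T u x) \<le> norm c * (1/2) ^ n" for n by simp
    then have "(\<lambda>n. (\<Sum>i<Suc n. f i x) - c - T u x) \<longlonglongrightarrow> 0"
      by (intro Lim_null_comparison[OF always_eventually lim0[of "1/2" "norm c"]] allI) auto
    moreover have "(\<lambda>n. (\<Sum>i<Suc n. f i x) - c - T u x) \<longlonglongrightarrow> u x - c - T u x"
      by (intro tendsto_diff tendsto_const filterlim_compose[OF _ filterlim_Suc, of "\<lambda>n. \<Sum>i<n. f i x"])
        (use summable_LIMSEQ[OF summ[OF x]] in \<open>simp add: u_def\<close>)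
    ultimately have "u x - c - T u x = 0" using LIMSEQ_unique by blast
    then show ?thesis by (simp add: algebra_simps)
  qed
  show thesis
  proof (rule that[OF du cu' _ _ fp])
    show "norm (u x) \<le> 2 * norm c" if "x \<in> S" for x using tail[OF that, of 0] by simp
    show "norm (u' x w) \<le> (16 * (C + D * C') * norm c) * norm w" if "x \<in> S" for x w
      using tail'[OF that, where w=w and n=0] by (simp add: M_def algebra_simps)
  qed
qed

text \<open>The defect \<open>\<beta> x w = u' x w - A x w (u x)\<close> of a fixed point \<open>u\<close> of the radial integral
  equation satisfies a homogeneous radial integral equation itself, thanks to integrability.\<close>

lemma existence:
  assumes int: "\<And>x v w f. x \<in> S \<Longrightarrow> A' x w v f + A x v (A x w f) = A' x v w f + A x w (A x v f)"
  obtains u where "u q = c" "\<And>x. x \<in> S \<Longrightarrow> (u has_derivative (\<lambda>w. A x w (u x))) (at x)"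
proof -
  obtain u u' where du: "\<And>x. x \<in> S \<Longrightarrow> (u has_derivative u' x) (at x)" and cu': "\<And>w. continuous_on S (\<lambda>x. u' x w)"
    and bu: "\<And>x. x \<in> S \<Longrightarrow> norm (u x) \<le> 2 * norm c"
    and bu': "\<And>x w. x \<in> S \<Longrightarrow> norm (u' x w) \<le> (16 * (C + D * C') * norm c) * norm w"
    and fp: "\<And>x. x \<in> S \<Longrightarrow> u x = c + T u x"
    using picard_limit[of c] by blast
  have cu: "continuous_on S u"
    using du by (rule has_derivative_imp_continuous_on)
  define \<beta> where "\<beta> x w = u' x w - A x w (u x)" for x w
  have c\<beta>: "continuous_on S (\<lambda>x. \<beta> x w)" for w
    unfolding \<beta>_def by (intro continuous_intros cu cu' cont_A)
  have \<beta>: "\<beta> x w = integral {0..1} (\<lambda>t. t *\<^sub>R (A (ray x t) (x - q) (\<beta> (ray x t) w) - A (ray x t) w (\<beta> (ray x t) (x - q))))"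
    if x: "x \<in> S" for x w
  proof -
    have "((\<lambda>x. c + T u x) has_derivative dT u u' x) (at x)"
      using has_derivative_add[OF has_derivative_const T_has_derivative[OF du cu' x]] by simp
    then have "(u has_derivative dT u u' x) (at x)"
      by (rule has_derivative_transform_within_open[OF _ S(2) x]) (use fp in auto)
    then have u': "u' x = dT u u' x" using has_derivative_unique[OF du[OF x]] by blast
    \<comment> \<open>This is the derivative of
      \<open>t *\<^sub>R A (ray x t) w (u (ray x t))\<close>, whose increment over the unit interval
      is \<open>A x w (u x)\<close>. It is the integrand of \<open>dT\<close> with \<open>w\<close>
      and \<open>x - q\<close> exchanged in the terms weighted by \<open>t\<close>, so their
      difference is a commutator, which \<open>int\<close> expresses through the defect.\<close>
    let ?d = "\<lambda>t. A (ray x t) w (u (ray x t)) + t *\<^sub>R (A' (ray x t) (x - q) w (u (ray x t)) + A (ray x t) w (u' (ray x t) (x - q)))"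
    have "(?d has_integral 1 *\<^sub>R A (ray x 1) w (u (ray x 1)) - 0 *\<^sub>R A (ray x 0) w (u (ray x 0))) {0..1}"
    proof (rule fundamental_theorem_of_calculus)
      fix t :: real assume t: "t \<in> {0..1}"
      note y = ray[OF x t]
      have "((\<lambda>z. A z w) has_derivative (\<lambda>v. A' (ray x t) v w)) (at (ray x t))"
        by (rule bounded_linear.has_derivative[OF blinfun.bounded_linear_left deriv_A[OF y]])
      from bounded_bilinear.FDERIV[OF bounded_bilinear_blinfun_apply this du[OF y]]
      have d: "((\<lambda>z. A z w (u z)) has_derivative (\<lambda>v. A (ray x t) w (u' (ray x t) v) + A' (ray x t) v w (u (ray x t)))) (at (ray x t))" .
      have "((\<lambda>t. ray x t) has_derivative (\<lambda>s. s *\<^sub>R (x - q))) (at t within {0..1})"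
        by (auto intro!: derivative_eq_intros)
      from has_derivative_scaleR[OF has_derivative_ident has_derivative_compose[OF this d]]
      show "((\<lambda>t. t *\<^sub>R A (ray x t) w (u (ray x t))) has_vector_derivative ?d t) (at t within {0..1})"
        unfolding has_vector_derivative_def
      proof (rule has_derivative_eq_rhs, intro ext)
        fix s
        have "u' (ray x t) (s *\<^sub>R (x - q)) = s *\<^sub>R u' (ray x t) (x - q)"
          using has_derivative_linear[OF du[OF y]] by (rule linear_scale)
        moreover have "A' (ray x t) (s *\<^sub>R (x - q)) = s *\<^sub>R A' (ray x t) (x - q)"
          using has_derivative_linear[OF deriv_A[OF y]] by (rule linear_scale)
        ultimately show "t *\<^sub>R (A (ray x t) w (u' (ray x t) (s *\<^sub>R (x - q))) + A' (ray x t) (s *\<^sub>R (x - q)) w (u (ray x t)))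
          + s *\<^sub>R A (ray x t) w (u (ray x t)) = s *\<^sub>R ?d t"
          by (simp add: blinfun.bilinear_simps algebra_simps)
      qed
    qed simp
    then have Au: "A x w (u x) = integral {0..1} ?d" by (simp add: integral_unique)
    have "\<beta> x w = integral {0..1} (\<lambda>t. A (ray x t) w (u (ray x t)) +
       t *\<^sub>R (A' (ray x t) w (x - q) (u (ray x t)) + A (ray x t) (x - q) (u' (ray x t) w)) - ?d t)"
      unfolding \<beta>_def u' Au dT_def
      by (rule integral_diff[symmetric]; intro integrable_continuous_interval continuous_intros cont_ray(2)[OF cont_A x]
        cont_ray(2)[OF cont_A' x] cont_ray(2)[OF cu x] cont_ray(2)[OF cu' x])
    also have "\<dots> = integral {0..1} (\<lambda>t. t *\<^sub>R (A (ray x t) (x - q) (\<beta> (ray x t) w) - A (ray x t) w (\<beta> (ray x t) (x - q))))"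
    proof (rule integral_cong)
      fix t :: real assume t: "t \<in> {0..1}"
      have "A' (ray x t) w (x - q) (u (ray x t)) - A' (ray x t) (x - q) w (u (ray x t))
        = A (ray x t) w (A (ray x t) (x - q) (u (ray x t))) - A (ray x t) (x - q) (A (ray x t) w (u (ray x t)))"
        using int[OF ray[OF x t], where w=w and v="x - q" and f="u (ray x t)"] by (simp add: algebra_simps)
      then show "A (ray x t) w (u (ray x t)) +
       t *\<^sub>R (A' (ray x t) w (x - q) (u (ray x t)) + A (ray x t) (x - q) (u' (ray x t) w)) - ?d t =
       t *\<^sub>R (A (ray x t) (x - q) (\<beta> (ray x t) w) - A (ray x t) w (\<beta> (ray x t) (x - q)))"
        unfolding \<beta>_def blinfun.diff_right
        by (simp add: algebra_simps flip: scaleR_add_right scaleR_diff_right)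
    qed
    finally show ?thesis .
  qed
  \<comment> \<open>In the radial direction the two terms of the integrand cancel. The factor
    \<open>t\<close> has to stay: at \<open>t = 0\<close> the radial vector
    \<open>ray x t - q\<close> is zero and says nothing about \<open>x - q\<close>.\<close>
  have \<beta>0: "t *\<^sub>R \<beta> (ray x t) (x - q) = 0" if x: "x \<in> S" and t: "t \<in> {0..1}" for x t
  proof -
    have "\<beta> (ray x t) (ray x t - q) = 0" using \<beta>[OF ray[OF x t], of "ray x t - q"] by simp
    moreover have "\<beta> (ray x t) (t *\<^sub>R (x - q)) = t *\<^sub>R \<beta> (ray x t) (x - q)"
      using linear_scale[OF has_derivative_linear[OF du[OF ray[OF x t]]], of t "x - q"]
      by (simp only: \<beta>_def blinfun.scaleR_left blinfun.scaleR_right scaleR_diff_right[of t "u' (ray x t) (x - q)"])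
    ultimately show ?thesis by simp
  qed
  have \<beta>1: "\<beta> x w = integral {0..1} (\<lambda>t. t *\<^sub>R A (ray x t) (x - q) (\<beta> (ray x t) w))" if x: "x \<in> S" for x w
  proof (subst \<beta>[OF x], rule integral_cong)
    fix t :: real assume t: "t \<in> {0..1}"
    have "t *\<^sub>R A (ray x t) w (\<beta> (ray x t) (x - q)) = A (ray x t) w (t *\<^sub>R \<beta> (ray x t) (x - q))"
      by (simp only: blinfun.scaleR_right)
    also have "\<dots> = 0" by (simp only: \<beta>0[OF x t] blinfun.zero_right)
    finally show "t *\<^sub>R (A (ray x t) (x - q) (\<beta> (ray x t) w) - A (ray x t) w (\<beta> (ray x t) (x - q)))
      = t *\<^sub>R A (ray x t) (x - q) (\<beta> (ray x t) w)"
      by (simp only: scaleR_diff_right diff_zero)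
  qed
  have "\<beta> x w = 0" if x: "x \<in> S" for x w
  proof -
    define K where "K = (16 * (C + D * C') * norm c) * norm w + C * norm w * (2 * norm c)"
    \<comment> \<open>The homogeneous equation \<open>\<beta>1\<close> has the direction
      \<open>w\<close> fixed and halves every bound on \<open>\<beta>\<close>; \<open>K\<close> is
      the crude initial bound from the estimates for \<open>u'\<close> and \<open>u\<close>.\<close>
    have "norm (\<beta> x w) \<le> K * (1/2) ^ n" if "x \<in> S" for n x
      using that
    proof (induction n arbitrary: x)
      case 0
      have "norm (\<beta> x w) \<le> norm (u' x w) + norm (A x w (u x))"
        unfolding \<beta>_def by (rule norm_triangle_ineq4)
      also have "\<dots> \<le> K" unfolding K_def
        using bu'[OF 0, of w] norm_A_apply[OF 0, of w "u x"] mult_left_mono[OF bu[OF 0], of "C * norm w"] CD by auto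
      finally show ?case by simp
    next
      case (Suc n)
      have "norm (integral {0..1} (\<lambda>t. t *\<^sub>R A (ray x t) (x - q) (\<beta> (ray x t) w))) \<le> (K * (1/2) ^ n) / 2"
      proof (rule integral_bound)
        show "continuous_on {0..1} (\<lambda>t. t *\<^sub>R A (ray x t) (x - q) (\<beta> (ray x t) w))"
          by (intro continuous_intros cont_ray(2)[OF cont_A Suc.prems] cont_ray(2)[OF c\<beta> Suc.prems])
        fix t :: real assume t: "t \<in> {0..1}"
        note y = ray[OF Suc.prems t]
        have "norm (t *\<^sub>R A (ray x t) (x - q) (\<beta> (ray x t) w)) \<le> 1 * norm (A (ray x t) (x - q) (\<beta> (ray x t) w))"
          unfolding norm_scaleR by (rule mult_right_mono) (use t in auto)
        also have "\<dots> \<le> (C * norm (x - q)) * norm (\<beta> (ray x t) w)" using norm_A_apply[OF y] by simp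
        also have "\<dots> \<le> (1/2) * (K * (1/2) ^ n)"
        proof (rule mult_mono)
          show "C * norm (x - q) \<le> 1/2"
            using mult_left_mono[OF diam[OF Suc.prems q] CD(1)] CD(3) by linarith
        qed (use Suc.IH[OF y] in auto)
        finally show "norm (t *\<^sub>R A (ray x t) (x - q) (\<beta> (ray x t) w)) \<le> (K * (1/2) ^ n) / 2" by simp
      qed
      then show ?case using \<beta>1[OF Suc.prems] by simp
    qed
    then have "norm (\<beta> x w) \<le> K * (1/2) ^ n" for n using x by blast
    moreover have "(\<lambda>n. K * (1/2) ^ n) \<longlonglongrightarrow> 0"
      by (auto intro!: tendsto_mult_right_zero LIMSEQ_realpow_zero)
    ultimately have "norm (\<beta> x w) \<le> 0" by (intro LIMSEQ_le_const) auto
    then show ?thesis by simp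
  qed
  then have "u' x = (\<lambda>w. A x w (u x))" if "x \<in> S" for x using that by (auto simp: \<beta>_def)
  moreover have "u q = c" using fp[OF q] by (simp add: T_def)
  ultimately show thesis using that[of u] du by auto
qed

end

section \<open>Locally constant sheaves and finite fundamental groups\<close>

definition germ_eq :: "'a::topological_space set \<Rightarrow> 'a \<Rightarrow> ('a \<Rightarrow> 'b) \<Rightarrow> ('a \<Rightarrow> 'b) \<Rightarrow> bool" where
  "germ_eq M q f g \<longleftrightarrow> (\<exists>U. openin (top_of_set M) U \<and> q \<in> U \<and> (\<forall>x\<in>U. f x = g x))"

lemma germ_eqI: "openin (top_of_set M) U \<Longrightarrow> q \<in> U \<Longrightarrow> (\<And>x. x \<in> U \<Longrightarrow> f x = g x) \<Longrightarrow> germ_eq M q f g"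
  by (auto simp: germ_eq_def)

lemma germ_eq_refl: "q \<in> M \<Longrightarrow> germ_eq M q f f"
  by (rule germ_eqI[of _ M]) auto

lemma germ_eq_sym: "germ_eq M q f g \<Longrightarrow> germ_eq M q g f"
  by (auto simp: germ_eq_def)

lemma germ_eq_trans: "germ_eq M q f g \<Longrightarrow> germ_eq M q g k \<Longrightarrow> germ_eq M q f k"
  by (clarsimp simp: germ_eq_def) (metis IntD1 IntD2 IntI openin_Int)

lemma germ_eq_value: "germ_eq M q f g \<Longrightarrow> f q = g q"
  by (auto simp: germ_eq_def)

text \<open>The properties of potentials on which continuation rests. The condition
  \<open>nice_neighbourhood\<close> says that the space of germs is a trivial covering over
  arbitrarily small \<open>W\<close>: a germ at any point of \<open>W\<close> extends to all of
  \<open>W\<close> in exactly one way. Path-connectedness of \<open>W\<close> allows the end of a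
  path to be moved inside \<open>W\<close>.\<close>

locale locally_constant_sheaf =
  fixes M :: "'a::topological_space set" and sol :: "'a set \<Rightarrow> ('a \<Rightarrow> real) \<Rightarrow> bool"
  assumes sol_open: "sol U f \<Longrightarrow> openin (top_of_set M) U"
    and sol_subset: "sol U f \<Longrightarrow> openin (top_of_set M) V \<Longrightarrow> V \<subseteq> U \<Longrightarrow> sol V f"
    and sol_continuous: "sol U f \<Longrightarrow> continuous_on U f"
    and sol_exists: "p \<in> M \<Longrightarrow> \<exists>U f. p \<in> U \<and> sol U f"
    and nice_neighbourhood: "openin (top_of_set M) V \<Longrightarrow> p \<in> V \<Longrightarrow>
      \<exists>W. openin (top_of_set M) W \<and> p \<in> W \<and> W \<subseteq> V \<and> path_connected W \<and>
        (\<forall>q U f. q \<in> W \<and> q \<in> U \<and> sol U f \<longrightarrow> (\<exists>g. sol W g \<and> germ_eq M q f g)) \<and>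
        (\<forall>q f g. q \<in> W \<and> sol W f \<and> sol W g \<and> germ_eq M q f g \<longrightarrow> (\<forall>x\<in>W. f x = g x))"
begin

abbreviation "germ \<equiv> germ_eq M"

definition nice :: "'a set \<Rightarrow> bool" where
  "nice W \<longleftrightarrow> openin (top_of_set M) W \<and> path_connected W \<and>
     (\<forall>q U f. q \<in> W \<and> q \<in> U \<and> sol U f \<longrightarrow> (\<exists>g. sol W g \<and> germ q f g)) \<and>
     (\<forall>q f g. q \<in> W \<and> sol W f \<and> sol W g \<and> germ q f g \<longrightarrow> (\<forall>x\<in>W. f x = g x))"

lemma nice_exists:
  assumes "openin (top_of_set M) V" "p \<in> V"
  obtains W where "nice W" "p \<in> W" "W \<subseteq> V"
  using nice_neighbourhood[OF assms] that by (elim exE conjE) (simp add: nice_def)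

lemma nice_open: "nice W \<Longrightarrow> openin (top_of_set M) W"
  by (simp add: nice_def)

lemma nice_subset: "nice W \<Longrightarrow> W \<subseteq> M"
  using nice_open openin_imp_subset by blast

lemma nice_extend:
  assumes "nice W" "q \<in> W" "q \<in> U" "sol U f"
  obtains g where "sol W g" "germ q f g"
proof -
  have "\<exists>g. sol W g \<and> germ q f g" using assms by (simp add: nice_def)
  then show thesis using that by blast
qed

lemma nice_unique:
  "nice W \<Longrightarrow> q \<in> W \<Longrightarrow> sol W f \<Longrightarrow> sol W g \<Longrightarrow> germ q f g \<Longrightarrow> x \<in> W \<Longrightarrow> f x = g x"
  by (simp add: nice_def)

text \<open>Continuous sections of the sheaf of germs along a map \<open>H\<close>; germs are represented by functions.\<close>

definition sect :: "'c::topological_space set \<Rightarrow> ('c \<Rightarrow> 'a) \<Rightarrow> ('c \<Rightarrow> 'a \<Rightarrow> real) \<Rightarrow> bool" where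
  "sect T H G \<longleftrightarrow> (\<forall>t\<in>T. \<exists>N U f. openin (top_of_set T) N \<and> t \<in> N \<and> sol U f \<and>
     (\<forall>s\<in>N. H s \<in> U \<and> germ (H s) (G s) f))"

lemma sectE:
  assumes "sect T H G" "t \<in> T"
  obtains N U f where "openin (top_of_set T) N" "t \<in> N" "sol U f" "\<And>s. s \<in> N \<Longrightarrow> H s \<in> U"
    "\<And>s. s \<in> N \<Longrightarrow> germ (H s) (G s) f"
proof -
  from assms obtain N U f where "openin (top_of_set T) N" "t \<in> N" "sol U f" "\<forall>s\<in>N. H s \<in> U \<and> germ (H s) (G s) f"
    unfolding sect_def by meson
  then show thesis by (intro that[of N U f]) auto
qed

lemma sect_const:
  assumes "sol U f" "H ` T \<subseteq> U"
  shows "sect T H (\<lambda>_. f)"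
proof -
  have "U \<subseteq> M" using sol_open[OF assms(1)] openin_imp_subset by blast
  then have "germ (H s) f f" if "s \<in> T" for s using that assms(2) by (intro germ_eq_refl) auto
  then show ?thesis
    unfolding sect_def using assms by (intro ballI exI[of _ T] exI[of _ U] exI[of _ f]) auto
qed

lemma sect_cong:
  assumes "sect T H G" "\<And>t. t \<in> T \<Longrightarrow> H' t = H t" "\<And>t. t \<in> T \<Longrightarrow> G' t = G t"
  shows "sect T H' G'"
  unfolding sect_def
proof
  fix t assume "t \<in> T"
  then obtain N U f where N: "openin (top_of_set T) N" "t \<in> N" "sol U f" "\<And>s. s \<in> N \<Longrightarrow> H s \<in> U"
    "\<And>s. s \<in> N \<Longrightarrow> germ (H s) (G s) f"
    using sectE[OF assms(1)] by blast
  have "N \<subseteq> T" using openin_imp_subset[OF N(1)] .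
  then show "\<exists>N U f. openin (top_of_set T) N \<and> t \<in> N \<and> sol U f \<and> (\<forall>s\<in>N. H' s \<in> U \<and> germ (H' s) (G' s) f)"
    using N assms(2,3) by (intro exI[of _ N] exI[of _ U] exI[of _ f]) auto
qed

lemma sect_compose:
  assumes "sect T H G" "continuous_on T' r" "r ` T' \<subseteq> T"
  shows "sect T' (H \<circ> r) (G \<circ> r)"
  unfolding sect_def
proof
  fix t assume t: "t \<in> T'"
  then obtain N U f where N: "openin (top_of_set T) N" "r t \<in> N" "sol U f" "\<And>s. s \<in> N \<Longrightarrow> H s \<in> U"
    "\<And>s. s \<in> N \<Longrightarrow> germ (H s) (G s) f"
    using sectE[OF assms(1), of "r t"] assms(3) by blast
  have "openin (top_of_set T') (T' \<inter> r -` N)"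
    by (rule continuous_openin_preimage[OF assms(2) _ N(1)]) (use assms(3) in auto)
  then show "\<exists>N U f. openin (top_of_set T') N \<and> t \<in> N \<and> sol U f \<and>
      (\<forall>s\<in>N. (H \<circ> r) s \<in> U \<and> germ ((H \<circ> r) s) ((G \<circ> r) s) f)"
    using N t by (intro exI[of _ "T' \<inter> r -` N"] exI[of _ U] exI[of _ f]) auto
qed

text \<open>Uniqueness of lifts to a covering. Near each point of \<open>T\<close> both sections are
  given by single solutions on a common nice set, where agreement at one point spreads to all
  others; so agreement is locally constant along \<open>T\<close>.\<close>

lemma sect_unique:
  assumes T: "connected T" and H: "continuous_on T H" "H ` T \<subseteq> M"
    and G: "sect T H G" "sect T H G'"
    and t: "t \<in> T" "germ (H t) (G t) (G' t)" and s: "s \<in> T"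
  shows "germ (H s) (G s) (G' s)"
proof (rule connected_induction_simple[OF T t(1) s, where P = "\<lambda>s. germ (H s) (G s) (G' s)"])
  fix a assume a: "a \<in> T"
  obtain N U f where N: "openin (top_of_set T) N" "a \<in> N" "sol U f" "\<And>s. s \<in> N \<Longrightarrow> H s \<in> U"
    "\<And>s. s \<in> N \<Longrightarrow> germ (H s) (G s) f" using sectE[OF G(1) a] by blast
  obtain N' U' f' where N': "openin (top_of_set T) N'" "a \<in> N'" "sol U' f'" "\<And>s. s \<in> N' \<Longrightarrow> H s \<in> U'"
    "\<And>s. s \<in> N' \<Longrightarrow> germ (H s) (G' s) f'" using sectE[OF G(2) a] by blast
  have "openin (top_of_set M) (U \<inter> U')" "H a \<in> U \<inter> U'" using N N' sol_open by auto
  from nice_exists[OF this] obtain W where W: "nice W" "H a \<in> W" "W \<subseteq> U \<inter> U'" by blast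
  have sol: "sol W f" "sol W f'" using W N(3) N'(3) nice_open sol_subset by blast+
  let ?N = "N \<inter> N' \<inter> (T \<inter> H -` W)"
  have "germ (H y) (G y) (G' y)" if x: "x \<in> ?N" "germ (H x) (G x) (G' x)" and y: "y \<in> ?N" for x y
  proof -
    have "germ (H x) f (G' x)" using germ_eq_trans[OF germ_eq_sym[OF N(5)] x(2)] x(1) by simp
    from germ_eq_trans[OF this N'(5)] have "germ (H x) f f'" using x(1) by simp
    then have "f z = f' z" if "z \<in> W" for z using nice_unique[OF W(1) _ sol _ that] x(1) by blast
    then have "germ (H y) f f'" using y by (intro germ_eqI[OF nice_open[OF W(1)]]) auto
    from germ_eq_trans[OF germ_eq_trans[OF N(5) this] germ_eq_sym[OF N'(5)]] show ?thesis using y by simp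
  qed
  moreover have "openin (top_of_set T) ?N"
    by (intro openin_Int[OF openin_Int[OF N(1) N'(1)]] continuous_openin_preimage[OF H(1) _ nice_open[OF W(1)]])
      (use H(2) in auto)
  ultimately show "\<exists>N. openin (top_of_set T) N \<and> a \<in> N \<and>
      (\<forall>x\<in>N. \<forall>y\<in>N. germ (H x) (G x) (G' x) \<longrightarrow> germ (H y) (G y) (G' y))"
    using a N(2) N'(2) W(2) by (intro exI[of _ ?N] conjI ballI impI) (assumption | blast)+
qed (rule t(2))

text \<open>The pieces are closed, as two halves of an interval or of a rectangle are. Only points
  of \<open>A \<inter> B\<close> need work; elsewhere the other piece can be avoided by a
  neighbourhood.\<close>

lemma sect_glue:
  assumes A: "closed A" and B: "closed B" and H: "continuous_on (A \<union> B) H" "H ` (A \<union> B) \<subseteq> M"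
    and G: "sect A H G" "sect B H G'" and agree: "\<And>t. t \<in> A \<inter> B \<Longrightarrow> germ (H t) (G t) (G' t)"
  shows "sect (A \<union> B) H (\<lambda>t. if t \<in> A then G t else G' t)"
  unfolding sect_def
proof
  let ?G = "\<lambda>t. if t \<in> A then G t else G' t"
  fix t assume "t \<in> A \<union> B"
  then consider "t \<in> A" "t \<in> B" | "t \<in> A" "t \<notin> B" | "t \<notin> A" "t \<in> B" by blast
  then show "\<exists>N U f. openin (top_of_set (A \<union> B)) N \<and> t \<in> N \<and> sol U f \<and>
      (\<forall>s\<in>N. H s \<in> U \<and> germ (H s) (?G s) f)"
  proof cases
    case 1
    obtain N U f where N: "openin (top_of_set A) N" "t \<in> N" "sol U f" "\<And>s. s \<in> N \<Longrightarrow> H s \<in> U"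
      "\<And>s. s \<in> N \<Longrightarrow> germ (H s) (G s) f" using sectE[OF G(1) 1(1)] by blast
    obtain N' U' f' where N': "openin (top_of_set B) N'" "t \<in> N'" "sol U' f'" "\<And>s. s \<in> N' \<Longrightarrow> H s \<in> U'"
      "\<And>s. s \<in> N' \<Longrightarrow> germ (H s) (G' s) f'" using sectE[OF G(2) 1(2)] by blast
    obtain P P' where P: "open P" "N = A \<inter> P" "open P'" "N' = B \<inter> P'"
      using N(1) N'(1) unfolding openin_open by blast
    \<comment> \<open>The two local solutions are known to agree only on some \<open>Q\<close>
      around \<open>H t\<close>, so the neighbourhood \<open>?N\<close> is cut down to where
      \<open>H\<close> stays in \<open>Q\<close>.\<close>
    have "germ (H t) f f'"
      using agree[of t] 1 N(5)[OF N(2)] N'(5)[OF N'(2)] by (meson IntI germ_eq_sym germ_eq_trans)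
    then obtain Q where Q: "openin (top_of_set M) Q" "H t \<in> Q" "\<And>x. x \<in> Q \<Longrightarrow> f x = f' x"
      unfolding germ_eq_def by blast
    let ?N = "((A \<union> B) \<inter> (P \<inter> P')) \<inter> ((A \<union> B) \<inter> H -` (U \<inter> Q))"
    have pre: "openin (top_of_set (A \<union> B)) ((A \<union> B) \<inter> H -` (U \<inter> Q))"
      by (rule continuous_openin_preimage[OF H(1), of M]) (use H(2) Q(1) sol_open[OF N(3)] in auto)
    have "openin (top_of_set (A \<union> B)) ?N"
      by (rule openin_Int[OF openin_open_Int pre]) (use P in auto)
    moreover have "germ (H s) (?G s) f" if s: "s \<in> ?N" for s
    proof (cases "s \<in> A")
      case True then show ?thesis using N(5) P s by auto
    next
      case False
      then have "germ (H s) (G' s) f'" using N'(5) P s by auto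
      moreover have "germ (H s) f f'" using Q s by (intro germ_eqI[OF Q(1)]) auto
      ultimately have "germ (H s) (G' s) f" by (rule germ_eq_trans[OF _ germ_eq_sym])
      then show ?thesis using False by simp
    qed
    ultimately show ?thesis
      using N N' Q 1 P by (intro exI[of _ ?N] exI[of _ U] exI[of _ f]) auto
  next
    case 2
    obtain N U f where N: "openin (top_of_set A) N" "t \<in> N" "sol U f" "\<And>s. s \<in> N \<Longrightarrow> H s \<in> U"
      "\<And>s. s \<in> N \<Longrightarrow> germ (H s) (G s) f" using sectE[OF G(1) 2(1)] by blast
    obtain P where P: "open P" "N = A \<inter> P" using N(1) unfolding openin_open by blast
    have "openin (top_of_set (A \<union> B)) ((A \<union> B) \<inter> (P - B))"
      using P B by (intro openin_open_Int open_Diff)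
    then show ?thesis using N P 2 by (intro exI[of _ "(A \<union> B) \<inter> (P - B)"] exI[of _ U] exI[of _ f]) auto
  next
    case 3
    obtain N U f where N: "openin (top_of_set B) N" "t \<in> N" "sol U f" "\<And>s. s \<in> N \<Longrightarrow> H s \<in> U"
      "\<And>s. s \<in> N \<Longrightarrow> germ (H s) (G' s) f" using sectE[OF G(2) 3(2)] by blast
    obtain P where P: "open P" "N = B \<inter> P" using N(1) unfolding openin_open by blast
    have "openin (top_of_set (A \<union> B)) ((A \<union> B) \<inter> (P - A))"
      using P A by (intro openin_open_Int open_Diff)
    then show ?thesis using N P 3 by (intro exI[of _ "(A \<union> B) \<inter> (P - A)"] exI[of _ U] exI[of _ f]) auto
  qed
qed

section \<open>Lifting over a square and the monodromy theorem\<close>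

text \<open>The prescribed germ may sit over any point \<open>z\<close> of \<open>T\<close>. This
  makes the property pass to unions, since a section over one piece is prolonged to the other from a
  common point.\<close>

definition extends :: "('c::topological_space \<Rightarrow> 'a) \<Rightarrow> 'c set \<Rightarrow> bool" where
  "extends H T \<longleftrightarrow> (\<forall>z\<in>T. \<forall>U f. H z \<in> U \<and> sol U f \<longrightarrow> (\<exists>G. sect T H G \<and> germ (H z) (G z) f))"

lemma extendsE:
  assumes "extends H T" "z \<in> T" "H z \<in> U" "sol U f"
  obtains G where "sect T H G" "germ (H z) (G z) f"
proof -
  have "\<exists>G. sect T H G \<and> germ (H z) (G z) f" using assms unfolding extends_def by auto
  then show thesis using that by blast
qed

lemma extends_nice:
  assumes "nice W" "H ` T \<subseteq> W"
  shows "extends H T"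
  unfolding extends_def
proof (intro ballI allI impI, elim conjE)
  fix z U f assume z: "z \<in> T" "H z \<in> U" "sol U f"
  then obtain g where "sol W g" "germ (H z) f g" using nice_extend[OF assms(1)] assms(2) by blast
  then show "\<exists>G. sect T H G \<and> germ (H z) (G z) f"
    using sect_const[OF _ assms(2)] germ_eq_sym by (intro exI[of _ "\<lambda>_. g"]) blast
qed

text \<open>The second section is started at one common point with the germ of the first.
  Connectedness of the intersection then forces agreement on all of it by
  \<open>sect_unique\<close>, and the sections can be glued.\<close>

lemma extends_Un:
  assumes A: "closed A" "extends H A" and B: "closed B" "extends H B"
    and AB: "connected (A \<inter> B)" "A \<inter> B \<noteq> {}" and H: "continuous_on (A \<union> B) H" "H ` (A \<union> B) \<subseteq> M"
  shows "extends H (A \<union> B)"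
proof -
  \<comment> \<open>Stated for arbitrary sets because it is applied again with the pieces exchanged,
    for a point \<open>z\<close> of the second one.\<close>
  have *: "\<exists>G. sect (A \<union> B) H G \<and> germ (H z) (G z) f"
    if A: "closed A" "extends H A" and B: "closed B" "extends H B"
    and AB: "connected (A \<inter> B)" "A \<inter> B \<noteq> {}" and H: "continuous_on (A \<union> B) H" "H ` (A \<union> B) \<subseteq> M"
    and z: "z \<in> A" "H z \<in> U" "sol U f" for A B z U f
  proof -
    obtain G where G: "sect A H G" "germ (H z) (G z) f" by (rule extendsE[OF A(2) z])
    obtain w where w: "w \<in> A" "w \<in> B" using AB by blast
    obtain U' g where g: "sol U' g" "H w \<in> U'" "germ (H w) (G w) g" by (rule sectE[OF G(1) w(1)]) auto
    obtain G' where G': "sect B H G'" "germ (H w) (G' w) g" by (rule extendsE[OF B(2) w(2) g(2,1)])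
    have "germ (H t) (G t) (G' t)" if t: "t \<in> A \<inter> B" for t
    proof (rule sect_unique[OF AB(1) _ _ _ _ _ _ t, of H G G' w])
      show "continuous_on (A \<inter> B) H" using H(1) by (rule continuous_on_subset) auto
      show "sect (A \<inter> B) H G" "sect (A \<inter> B) H G'"
        using sect_compose[OF G(1), of "A \<inter> B" id] sect_compose[OF G'(1), of "A \<inter> B" id] by (auto simp: o_def)
      show "germ (H w) (G w) (G' w)" using g(3) G'(2) by (meson germ_eq_sym germ_eq_trans)
    qed (use H w in auto)
    from sect_glue[OF A(1) B(1) H G(1) G'(1) this] show ?thesis
      using G(2) z by (intro exI[of _ "\<lambda>t. if t \<in> A then G t else G' t"]) auto
  qed
  show ?thesis
    unfolding extends_def
    using *[OF A B AB H] *[OF B A] AB H by (metis Int_commute Un_commute UnE)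
qed

text \<open>Small rectangles are mapped into nice sets. \<open>Bolzano\<close> replaces a
  subdivision by a Lebesgue number and is used twice: in the second coordinate, to get a thin strip
  around each \<open>s\<close>, and then in the first, to join the strips. Neighbouring pieces meet
  in a segment.\<close>

lemma extends_square:
  fixes H :: "real \<times> real \<Rightarrow> 'a"
  assumes H: "continuous_on ({0..1} \<times> {0..1}) H" "H ` ({0..1} \<times> {0..1}) \<subseteq> M"
  shows "extends H ({0..1} \<times> {0..1})"
proof -
  have cl: "closed ({a..b} \<times> {c..d})" for a b c d :: real by (intro closed_Times) auto
  have strip: "\<exists>\<delta>>0. \<forall>c d. 0 \<le> c \<and> c \<le> s \<and> s \<le> d \<and> d \<le> 1 \<and> d - c < \<delta> \<longrightarrow> extends H ({c..d} \<times> {0..1})"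
    if s: "0 \<le> s" "s \<le> 1" for s
  proof -
    \<comment> \<open>The width of the strip may depend on \<open>a\<close> and \<open>b\<close>;
      joining two rectangles takes the minimum of their widths.\<close>
    let ?R = "\<lambda>a b. \<exists>\<delta>>0. \<forall>c d. 0 \<le> c \<and> c \<le> s \<and> s \<le> d \<and> d \<le> 1 \<and> d - c < \<delta> \<longrightarrow> extends H ({c..d} \<times> {a..b})"
    have "0 \<le> (0::real) \<and> 0 \<le> (1::real) \<and> 1 \<le> (1::real) \<longrightarrow> ?R 0 1"
    proof (rule Bolzano[of 0 1 "\<lambda>a b. 0 \<le> a \<and> a \<le> b \<and> b \<le> 1 \<longrightarrow>
        ?R a b"])
      fix a b e :: real
      assume 1: "0 \<le> a \<and> a \<le> b \<and> b \<le> 1 \<longrightarrow> ?R a b"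
        and 2: "0 \<le> b \<and> b \<le> e \<and> e \<le> 1 \<longrightarrow> ?R b e"
        and ab: "a \<le> b" "b \<le> e"
      show "0 \<le> a \<and> a \<le> e \<and> e \<le> 1 \<longrightarrow> ?R a e"
      proof
        assume ae: "0 \<le> a \<and> a \<le> e \<and> e \<le> 1"
        obtain \<delta>1 where \<delta>1: "\<delta>1 > 0" "\<And>c d. 0 \<le> c \<Longrightarrow> c \<le> s \<Longrightarrow> s \<le> d \<Longrightarrow> d \<le> 1 \<Longrightarrow> d - c < \<delta>1 \<Longrightarrow> extends H ({c..d} \<times> {a..b})"
          using 1 ae ab by (meson order_trans)
        obtain \<delta>2 where \<delta>2: "\<delta>2 > 0" "\<And>c d. 0 \<le> c \<Longrightarrow> c \<le> s \<Longrightarrow> s \<le> d \<Longrightarrow> d \<le> 1 \<Longrightarrow> d - c < \<delta>2 \<Longrightarrow> extends H ({c..d} \<times> {b..e})"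
          using 2 ae ab by (meson order_trans)
        have "extends H ({c..d} \<times> {a..e})" if cd: "0 \<le> c" "c \<le> s" "s \<le> d" "d \<le> 1" "d - c < min \<delta>1 \<delta>2" for c d
        proof -
          have eq: "{c..d} \<times> {a..e} = {c..d} \<times> {a..b} \<union> {c..d} \<times> {b..e}" using ab by auto
          have int: "({c..d} \<times> {a..b}) \<inter> ({c..d} \<times> {b..e}) = {c..d} \<times> {b}" using ab by auto
          have sub: "{c..d} \<times> {a..b} \<union> {c..d} \<times> {b..e} \<subseteq> {0..1} \<times> {0..1}" using ab ae cd by auto
          show ?thesis unfolding eq
          proof (rule extends_Un[OF cl \<delta>1(2) cl \<delta>2(2)])
            show "connected (({c..d} \<times> {a..b}) \<inter> ({c..d} \<times> {b..e}))" unfolding int by (intro connected_Times) auto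
            show "({c..d} \<times> {a..b}) \<inter> ({c..d} \<times> {b..e}) \<noteq> {}" unfolding int using cd by auto
            show "continuous_on ({c..d} \<times> {a..b} \<union> {c..d} \<times> {b..e}) H" using H(1) sub by (rule continuous_on_subset)
            show "H ` ({c..d} \<times> {a..b} \<union> {c..d} \<times> {b..e}) \<subseteq> M" using H(2) sub by blast
          qed (use cd in auto)
        qed
        then show "?R a e"
          using \<delta>1(1) \<delta>2(1) by (intro exI[of _ "min \<delta>1 \<delta>2"]) auto
      qed
    next
      fix t :: real assume t: "0 \<le> t" "t \<le> 1"
      have "H (s, t) \<in> M" using H(2) s t by auto
      with nice_exists[of M "H (s, t)"] obtain W where W: "nice W" "H (s, t) \<in> W" by auto
      have "openin (top_of_set ({0..1} \<times> {0..1})) (({0..1} \<times> {0..1}) \<inter> H -` W)"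
        by (rule continuous_openin_preimage[OF H(1) _ nice_open[OF W(1)]]) (use H(2) in auto)
      then have "\<exists>e>0. \<forall>z\<in>{0..1} \<times> {0..1}. dist z (s, t) < e \<longrightarrow> z \<in> ({0..1} \<times> {0..1}) \<inter> H -` W"
        using s t W(2) unfolding openin_euclidean_subtopology_iff by (elim conjE bspec) auto
      then obtain e where e: "e > 0" "\<And>z. z \<in> {0..1} \<times> {0..1} \<Longrightarrow> dist z (s, t) < e \<Longrightarrow> H z \<in> W"
        by blast
      have "extends H ({c..d} \<times> {a..b})" if "0 \<le> c" "c \<le> s" "s \<le> d" "d \<le> 1" "d - c < e/2"
        "0 \<le> a" "a \<le> t" "t \<le> b" "b \<le> 1" "b - a < e/2" for a b c d
      proof (rule extends_nice[OF W(1)], clarify)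
        fix x y assume xy: "x \<in> {c..d}" "y \<in> {a..b}"
        have "dist (x, y) (s, t) \<le> dist x s + dist y t"
          unfolding dist_Pair_Pair by (rule sqrt_sum_squares_le_sum) auto
        also have "\<dots> < e" using xy that by (auto simp: dist_real_def)
        finally show "H (x, y) \<in> W" using xy that by (intro e(2)) auto
      qed
      then show "\<exists>d>0. \<forall>a b. a \<le> t \<and> t \<le> b \<and> b - a < d \<longrightarrow> 0 \<le> a \<and> a \<le> b \<and> b \<le> 1 \<longrightarrow>
        ?R a b"
        using e(1) by (intro exI[of _ "e/2"] conjI allI impI) auto
    qed simp
    then show ?thesis by simp
  qed
  have "0 \<le> (0::real) \<and> 0 \<le> (1::real) \<and> 1 \<le> (1::real) \<longrightarrow> extends H ({0..1} \<times> {0..1})"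
  proof (rule Bolzano[of 0 1 "\<lambda>c d. 0 \<le> c \<and> c \<le> d \<and> d \<le> 1 \<longrightarrow> extends H ({c..d} \<times> {0..1})"])
    fix a b c :: real
    assume 1: "0 \<le> a \<and> a \<le> b \<and> b \<le> 1 \<longrightarrow> extends H ({a..b} \<times> {0..1})"
      and 2: "0 \<le> b \<and> b \<le> c \<and> c \<le> 1 \<longrightarrow> extends H ({b..c} \<times> {0..1})" and abc: "a \<le> b" "b \<le> c"
    show "0 \<le> a \<and> a \<le> c \<and> c \<le> 1 \<longrightarrow> extends H ({a..c} \<times> {0..1})"
    proof
      assume ac: "0 \<le> a \<and> a \<le> c \<and> c \<le> 1"
      have eq: "{a..c} \<times> {0..1} = {a..b} \<times> {0..1::real} \<union> {b..c} \<times> {0..1::real}" using abc by auto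
      have int: "({a..b} \<times> {0..1::real}) \<inter> ({b..c} \<times> {0..1::real}) = {b} \<times> {0..1}" using abc by auto
      have sub: "{a..b} \<times> {0..1::real} \<union> {b..c} \<times> {0..1::real} \<subseteq> {0..1} \<times> {0..1}" using abc ac by auto
      show "extends H ({a..c} \<times> {0..1})" unfolding eq
      proof (rule extends_Un[OF cl _ cl])
        show "connected (({a..b} \<times> {0..1::real}) \<inter> ({b..c} \<times> {0..1::real}))" unfolding int by (intro connected_Times) auto
        show "({a..b} \<times> {0..1::real}) \<inter> ({b..c} \<times> {0..1::real}) \<noteq> {}" unfolding int by auto
        show "continuous_on ({a..b} \<times> {0..1} \<union> {b..c} \<times> {0..1}) H" using H(1) sub by (rule continuous_on_subset)
        show "H ` ({a..b} \<times> {0..1} \<union> {b..c} \<times> {0..1}) \<subseteq> M" using H(2) sub by blast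
      qed (use abc ac 1 2 in auto)
    qed
  next
    fix s :: real assume "0 \<le> s" "s \<le> 1"
    from strip[OF this] obtain \<delta> where "\<delta> > 0" "\<And>c d. 0 \<le> c \<Longrightarrow> c \<le> s \<Longrightarrow> s \<le> d \<Longrightarrow> d \<le> 1 \<Longrightarrow> d - c < \<delta> \<Longrightarrow> extends H ({c..d} \<times> {0..1})"
      by blast
    then show "\<exists>d>0. \<forall>a b. a \<le> s \<and> s \<le> b \<and> b - a < d \<longrightarrow> 0 \<le> a \<and> a \<le> b \<and> b \<le> 1 \<longrightarrow> extends H ({a..b} \<times> {0..1})"
      by (intro exI[of _ \<delta>]) auto
  qed simp
  then show ?thesis by simp
qed

text \<open>The first coordinate of the square is the homotopy parameter. A section \<open>K\<close>
  over the whole square is compared edge by edge: with \<open>G\<close> and \<open>G'\<close> along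
  the two paths, and with constant sections along the other two edges, which are mapped to a point
  because the homotopy fixes the ends.\<close>

lemma homotopic_sect_end:
  assumes h: "homotopic_paths M \<gamma> \<gamma>'" and G: "sect {0..1} \<gamma> G" "sect {0..1} \<gamma>' G'"
    and start: "germ (\<gamma> 0) (G 0) (G' 0)"
  shows "germ (\<gamma> 1) (G 1) (G' 1)"
proof -
  obtain H :: "real \<times> real \<Rightarrow> 'a" where H: "continuous_on ({0..1} \<times> {0..1}) H" "H ` ({0..1} \<times> {0..1}) \<subseteq> M"
    and H0: "\<And>x. x \<in> {0..1} \<Longrightarrow> H (0, x) = \<gamma> x" and H1: "\<And>x. x \<in> {0..1} \<Longrightarrow> H (1, x) = \<gamma>' x"
    and He: "\<And>t. t \<in> {0..1} \<Longrightarrow> H (t, 0) = \<gamma> 0" "\<And>t. t \<in> {0..1} \<Longrightarrow> H (t, 1) = \<gamma> 1"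
  proof -
    from h obtain K :: "real \<times> real \<Rightarrow> 'a" where K: "continuous_on ({0..1} \<times> {0..1}) K" "K \<in> ({0..1} \<times> {0..1}) \<rightarrow> M"
      "\<forall>x\<in>{0..1}. K (0, x) = \<gamma> x" "\<forall>x\<in>{0..1}. K (1, x) = \<gamma>' x"
      "\<forall>t\<in>{0..1}. pathstart (K \<circ> Pair t) = pathstart \<gamma> \<and> pathfinish (K \<circ> Pair t) = pathfinish \<gamma>"
      unfolding homotopic_paths by (elim exE conjE)
    then show thesis by (intro that[of K]) (auto simp: pathstart_def pathfinish_def)
  qed
  obtain U f where f: "sol U f" "\<gamma> 0 \<in> U" "germ (\<gamma> 0) (G 0) f"
    by (rule sectE[OF G(1), of 0]) auto
  obtain U1 f1 where f1: "sol U1 f1" "\<gamma> 1 \<in> U1" "germ (\<gamma> 1) (G 1) f1"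
    by (rule sectE[OF G(1), of 1]) auto
  obtain K where K: "sect ({0..1} \<times> {0..1}) H K" "germ (\<gamma> 0) (K (0, 0)) f"
    by (rule extendsE[OF extends_square[OF H], of "(0, 0)" U f]) (use f He(1)[of 0] in auto)
  have edge: "germ (H (r s)) (K (r s)) (L s)"
    if r: "continuous_on {0..1} r" "r ` {0..1} \<subseteq> {0..1} \<times> {0..1}" and L: "sect {0..1} \<delta> L"
      and \<delta>: "\<And>s. s \<in> {0..1} \<Longrightarrow> H (r s) = \<delta> s" and a: "a \<in> {0..1}" "germ (H (r a)) (K (r a)) (L a)"
      and s: "s \<in> {0..1}" for r :: "real \<Rightarrow> real \<times> real" and L \<delta> a s
  proof -
    have "sect {0..1} (H \<circ> r) L" using L by (rule sect_cong) (auto simp: \<delta>)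
    moreover have "continuous_on {0..1} (H \<circ> r)" using r H by (meson continuous_on_compose continuous_on_subset)
    moreover have "(H \<circ> r) ` {0..1} \<subseteq> M" unfolding image_comp[symmetric] using r(2) H(2) by blast
    ultimately have "germ ((H \<circ> r) s) ((K \<circ> r) s) (L s)"
      by (intro sect_unique[OF _ _ _ sect_compose[OF K(1) r] _ a(1) _ s]) (use a in auto)
    then show ?thesis by simp
  qed
  have left: "germ (H (0, s)) (K (0, s)) (G s)" if "s \<in> {0..1}" for s
  proof (rule edge[of "Pair 0" \<gamma> G 0])
    show "germ (H (0, 0)) (K (0, 0)) (G 0)"
      using germ_eq_trans[OF K(2) germ_eq_sym[OF f(3)]] He(1)[of 0] by simp
  qed (use that G H0 in \<open>auto intro!: continuous_intros\<close>)
  have bot: "germ (H (s, 0)) (K (s, 0)) f" if "s \<in> {0..1}" for s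
  proof (rule edge[of "\<lambda>s. (s, 0)" "\<lambda>_. \<gamma> 0" "\<lambda>_. f" 0])
    show "sect {0..1} (\<lambda>_. \<gamma> 0) (\<lambda>_. f)" by (rule sect_const[OF f(1)]) (use f in auto)
  qed (use that K He(1) in \<open>auto intro!: continuous_intros\<close>)
  have top: "germ (H (s, 1)) (K (s, 1)) f1" if "s \<in> {0..1}" for s
  proof (rule edge[of "\<lambda>s. (s, 1)" "\<lambda>_. \<gamma> 1" "\<lambda>_. f1" 0])
    show "sect {0..1} (\<lambda>_. \<gamma> 1) (\<lambda>_. f1)" by (rule sect_const[OF f1(1)]) (use f1 in auto)
    show "germ (H (0, 1)) (K (0, 1)) f1"
      using germ_eq_trans[OF left[of 1], of f1] f1(3) He(2)[of 0] by simp
  qed (use that He(2) in \<open>auto intro!: continuous_intros\<close>)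
  have right: "germ (H (1, s)) (K (1, s)) (G' s)" if "s \<in> {0..1}" for s
  proof (rule edge[of "Pair 1" \<gamma>' G' 0])
    show "germ (H (1, 0)) (K (1, 0)) (G' 0)"
      using germ_eq_trans[OF germ_eq_trans[OF bot[of 1], of "G 0"], of "G' 0"] germ_eq_sym[OF f(3)] start He(1)[of 1] by simp
  qed (use that G H1 in \<open>auto intro!: continuous_intros\<close>)
  have "germ (\<gamma> 1) f1 (G' 1)"
    using germ_eq_trans[OF germ_eq_sym[OF top[of 1]], of "G' 1"] right[of 1] He(2)[of 1] by simp
  with f1(3) show ?thesis by (rule germ_eq_trans)
qed


section \<open>Continuation of a germ and finiteness of its branches\<close>

text \<open>The analogue of analytic continuation along some path from \<open>x\<close> to
  \<open>q\<close>; only the germs of \<open>f\<close> at \<open>x\<close> and of \<open>g\<close>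
  at \<open>q\<close> matter.\<close>

definition reach :: "'a \<Rightarrow> ('a \<Rightarrow> real) \<Rightarrow> 'a \<Rightarrow> ('a \<Rightarrow> real) \<Rightarrow> bool" where
  "reach x f q g \<longleftrightarrow> (\<exists>\<gamma> G. path \<gamma> \<and> path_image \<gamma> \<subseteq> M \<and> \<gamma> 0 = x \<and> \<gamma> 1 = q \<and>
     sect {0..1} \<gamma> G \<and> germ x (G 0) f \<and> germ q (G 1) g)"

lemma reach_germ: "reach x f q g \<Longrightarrow> germ q g g' \<Longrightarrow> reach x f q g'"
  unfolding reach_def
  by (elim exE conjE, rule exI, rule exI, intro conjI, assumption+, rule germ_eq_trans, assumption+)

lemma reach_refl:
  assumes "x \<in> U" "sol U f"
  shows "reach x f x f"
proof -
  have x: "x \<in> M" using assms sol_open openin_imp_subset by blast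
  then have "sect {0..1} (\<lambda>_. x) (\<lambda>_. f)" using assms by (intro sect_const[OF assms(2)]) auto
  moreover have "path (\<lambda>_. x)" by (simp add: path_def)
  moreover have "path_image (\<lambda>_. x) \<subseteq> M" using x by (auto simp: path_image_def)
  ultimately show ?thesis
    unfolding reach_def using germ_eq_refl[OF x] by (intro exI[of _ "\<lambda>_. x"] exI[of _ "\<lambda>_. f"]) auto
qed

lemma reach_sol:
  assumes "reach x f q g"
  obtains U k where "q \<in> U" "sol U k" "germ q g k"
proof -
  from assms obtain \<gamma> :: "real \<Rightarrow> 'a" and G where G: "\<gamma> 1 = q" "sect {0..1} \<gamma> G" "germ q (G 1) g"
    unfolding reach_def by blast
  obtain N U k where "(1::real) \<in> N" "sol U k" "\<And>s. s \<in> N \<Longrightarrow> \<gamma> s \<in> U" "\<And>s. s \<in> N \<Longrightarrow> germ (\<gamma> s) (G s) k"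
    by (rule sectE[OF G(2), of 1]) auto
  then have k: "sol U k" "q \<in> U" "germ q (G 1) k" using G(1) by auto
  show thesis
    by (rule that[OF k(2,1) germ_eq_trans[OF germ_eq_sym[OF G(3)] k(3)]])
qed

text \<open>The path is prolonged inside \<open>W\<close>, where \<open>g\<close> itself serves as
  the section over the added half.\<close>

lemma reach_step:
  assumes r: "reach x f q g" and W: "sol W g" "path_connected W" and q: "q \<in> W" "q' \<in> W"
  shows "reach x f q' g"
proof -
  from r obtain \<gamma> G where G: "path \<gamma>" "path_image \<gamma> \<subseteq> M" "\<gamma> 0 = x" "\<gamma> 1 = q" "sect {0..1} \<gamma> G"
    "germ x (G 0) f" "germ q (G 1) g" unfolding reach_def by blast
  have WM: "W \<subseteq> M" using sol_open[OF W(1)] openin_imp_subset by blast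
  from W(2) q obtain \<delta> where \<delta>: "path \<delta>" "path_image \<delta> \<subseteq> W" "pathstart \<delta> = q" "pathfinish \<delta> = q'"
    unfolding path_connected_def by blast
  define \<eta> where "\<eta> = \<gamma> +++ \<delta>"
  have \<eta>: "path \<eta>" "path_image \<eta> \<subseteq> M" "\<eta> 0 = x" "\<eta> 1 = q'"
  proof -
    have e: "pathfinish \<gamma> = pathstart \<delta>" using G(4) \<delta>(3) by (simp add: pathfinish_def)
    show "path \<eta>" unfolding \<eta>_def by (rule path_join_imp[OF G(1) \<delta>(1) e])
    show "path_image \<eta> \<subseteq> M" unfolding \<eta>_def by (rule subset_path_image_join) (use G(2) \<delta>(2) WM in auto)
    show "\<eta> 0 = x" "\<eta> 1 = q'" using G(3) \<delta>(4) by (simp_all add: \<eta>_def joinpaths_def pathfinish_def)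
  qed
  have iv: "{0..1/2} \<union> {1/2..1} = {0..1::real}" by auto
  have s1: "sect {0..1/2} \<eta> (\<lambda>t. G (2 * t))"
  proof -
    have "sect {0..1/2} (\<gamma> \<circ> (\<lambda>t. 2 * t)) (G \<circ> (\<lambda>t. 2 * t))"
      by (rule sect_compose[OF G(5)]) (auto intro!: continuous_intros)
    then show ?thesis
      by (rule sect_cong) (auto simp: \<eta>_def joinpaths_def)
  qed
  have s2: "sect {1/2..1} \<eta> (\<lambda>_. g)"
  proof (rule sect_const[OF W(1)], clarify)
    fix t :: real assume t: "t \<in> {1/2..1}"
    show "\<eta> t \<in> W"
    proof (cases "t = 1/2")
      case True show ?thesis unfolding True using G(4) q by (simp add: \<eta>_def joinpaths_def)
    next
      case False
      then have "\<eta> t = \<delta> (2 * t - 1)" using t by (simp add: \<eta>_def joinpaths_def)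
      moreover have "2 * t - 1 \<in> {0..1}" using t by auto
      ultimately show ?thesis using \<delta>(2) by (auto simp: path_image_def)
    qed
  qed
  have s: "sect ({0..1/2} \<union> {1/2..1}) \<eta> (\<lambda>t. if t \<in> {0..1/2} then G (2 * t) else g)"
  proof (rule sect_glue[OF _ _ _ _ s1 s2])
    fix t :: real assume "t \<in> {0..1/2} \<inter> {1/2..1}"
    then have t: "t = 1/2" by auto
    show "germ (\<eta> t) (G (2 * t)) g" unfolding t using G(4,7) by (simp add: \<eta>_def joinpaths_def)
  qed (use \<eta>(1,2) in \<open>auto simp: iv path_def path_image_def\<close>)
  show ?thesis unfolding reach_def
  proof (intro exI conjI)
    show "sect {0..1} \<eta> (\<lambda>t. if t \<in> {0..1/2} then G (2 * t) else g)" using s unfolding iv .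
    show "germ q' ((\<lambda>t. if t \<in> {0..1/2} then G (2 * t) else g) 1) g"
      using germ_eq_refl[of q' M g] q(2) WM by auto
  qed (use \<eta> G(6) in auto)
qed

text \<open>Germs are not objects here, so finiteness is expressed by a finite set of
  representatives; the functions \<open>g\<close> themselves are constrained only near
  \<open>q\<close>. Existence of a branch is included so that maxima are taken over nonempty
  sets.\<close>

definition finitely_reachable :: "'a \<Rightarrow> ('a \<Rightarrow> real) \<Rightarrow> 'a \<Rightarrow> bool" where
  "finitely_reachable x f q \<longleftrightarrow> (\<exists>g. reach x f q g) \<and> (\<exists>A. finite A \<and> (\<forall>g. reach x f q g \<longrightarrow> (\<exists>a\<in>A. germ q g a)))"

text \<open>One finite family of solutions represents the branches at all points of \<open>W\<close>
  at once: a branch at \<open>p\<close> extends over \<open>W\<close>, is moved to \<open>q\<close>,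
  and is recognised there among finitely many germs.\<close>

lemma finitely_reachable_nice:
  assumes fin: "finitely_reachable x f q" and W: "nice W" "q \<in> W"
  obtains K where "finite K" "K \<noteq> {}" "\<And>k. k \<in> K \<Longrightarrow> sol W k"
    "\<And>k p. k \<in> K \<Longrightarrow> p \<in> W \<Longrightarrow> reach x f p k"
    "\<And>p g. p \<in> W \<Longrightarrow> reach x f p g \<Longrightarrow> \<exists>k\<in>K. germ p g k"
proof -
  from fin obtain A g0 where A: "finite A" "\<And>g. reach x f q g \<Longrightarrow> \<exists>a\<in>A. germ q g a" and g0: "reach x f q g0"
    unfolding finitely_reachable_def by blast
  have pc: "path_connected W" using W(1) by (simp add: nice_def)
  \<comment> \<open>Only those representatives are kept that come from a reachable solution on all
    of \<open>W\<close>; \<open>\<kappa>\<close> chooses such a solution for each.\<close>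
  define B where "B = {a \<in> A. \<exists>k. sol W k \<and> reach x f q k \<and> germ q k a}"
  have "\<forall>a\<in>B. \<exists>k. sol W k \<and> reach x f q k \<and> germ q k a" by (auto simp: B_def)
  then obtain \<kappa> where \<kappa>: "\<And>a. a \<in> B \<Longrightarrow> sol W (\<kappa> a) \<and> reach x f q (\<kappa> a) \<and> germ q (\<kappa> a) a"
    by metis
  have cover: "\<exists>k\<in>\<kappa> ` B. germ p g k" if p: "p \<in> W" and g: "reach x f p g" for p g
  proof -
    obtain U k where k: "p \<in> U" "sol U k" "germ p g k" using reach_sol[OF g] by blast
    obtain l where l: "sol W l" "germ p k l" using nice_extend[OF W(1) p k(1,2)] by blast
    have gl: "germ p g l" using k(3) l(2) by (rule germ_eq_trans)
    have "reach x f q l" using reach_step[OF reach_germ[OF g gl] l(1) pc p W(2)] .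
    then obtain a where a: "a \<in> A" "germ q l a" using A(2) by blast
    then have "a \<in> B" using \<open>reach x f q l\<close> l(1) by (auto simp: B_def)
    then have "germ q l (\<kappa> a)" using \<kappa>[of a] a(2) by (blast intro: germ_eq_trans[OF _ germ_eq_sym])
    then have "l y = \<kappa> a y" if "y \<in> W" for y
      using nice_unique[OF W l(1) _ _ that] \<kappa>[OF \<open>a \<in> B\<close>] by blast
    then have "germ p l (\<kappa> a)" by (intro germ_eqI[OF nice_open[OF W(1)] p])
    then show ?thesis using gl \<open>a \<in> B\<close> germ_eq_trans by blast
  qed
  show thesis
  proof (rule that[of "\<kappa> ` B"])
    show "finite (\<kappa> ` B)" using A(1) by (auto simp: B_def)
    show "\<kappa> ` B \<noteq> {}" using cover[OF W(2) g0] by blast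
    show "sol W k" if "k \<in> \<kappa> ` B" for k using that \<kappa> by blast
    show "reach x f p k" if "k \<in> \<kappa> ` B" "p \<in> W" for k p
      using that \<kappa> reach_step[OF _ _ pc W(2)] by blast
  qed (use cover in blast)
qed

lemma finitely_reachable_everywhere:
  assumes M: "connected M" and x: "finitely_reachable x f x" "x \<in> M" and q: "q \<in> M"
  shows "finitely_reachable x f q"
proof (rule connected_induction_simple[OF M x(2) q, where P = "finitely_reachable x f"])
  fix a assume "a \<in> M"
  then obtain W where W: "nice W" "a \<in> W" using nice_exists[of M a] by auto
  have "finitely_reachable x f p" if q: "q \<in> W" "finitely_reachable x f q" and p: "p \<in> W" for p q
  proof -
    obtain K where K: "finite K" "K \<noteq> {}" "\<And>k p. k \<in> K \<Longrightarrow> p \<in> W \<Longrightarrow> reach x f p k"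
      "\<And>p g. p \<in> W \<Longrightarrow> reach x f p g \<Longrightarrow> \<exists>k\<in>K. germ p g k"
      using finitely_reachable_nice[OF q(2) W(1) q(1)] by metis
    obtain k where "k \<in> K" using K(2) by blast
    then show ?thesis unfolding finitely_reachable_def
      using K p by (intro conjI exI[of _ k] exI[of _ K]) auto
  qed
  then show "\<exists>T. openin (top_of_set M) T \<and> a \<in> T \<and>
      (\<forall>x'\<in>T. \<forall>y\<in>T. finitely_reachable x f x' \<longrightarrow> finitely_reachable x f y)"
    using W nice_open[OF W(1)] by (intro exI[of _ W] conjI ballI impI) (assumption | blast)+
qed (rule x(1))

text \<open>By \<open>homotopic_sect_end\<close> the germ at the end of a loop depends only on the
  class of the loop, so one chosen section per element of the fundamental group yields every branch
  at \<open>x\<close>.\<close>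

lemma finitely_reachable_base:
  assumes fin: "finite (carrier (fundamental_group M x))" and x: "x \<in> U" "sol U f"
  shows "finitely_reachable x f x"
  unfolding finitely_reachable_def
proof
  show "\<exists>g. reach x f x g" using reach_refl[OF x] by blast
  let ?P = "\<lambda>\<gamma> G. \<gamma> \<in> loops M x \<and> sect {0..1} \<gamma> G \<and> germ x (G 0) f"
  \<comment> \<open>The choice also ranges over the loop in \<open>C\<close> that carries the
    section. It is evaluated only for classes in which such a loop and section are already
    known.\<close>
  define \<Gamma> where "\<Gamma> C = (SOME G. \<exists>\<gamma>\<in>C. ?P \<gamma> G)" for C
  have "\<exists>a\<in>(\<lambda>C. \<Gamma> C 1) ` carrier (fundamental_group M x). germ x g a" if "reach x f x g" for g
  proof -
    from that obtain \<gamma> G where G: "path \<gamma>" "path_image \<gamma> \<subseteq> M" "\<gamma> 0 = x" "\<gamma> 1 = x" "sect {0..1} \<gamma> G"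
      "germ x (G 0) f" "germ x (G 1) g" unfolding reach_def by blast
    then have \<gamma>: "\<gamma> \<in> loops M x" by (auto simp: loops_def pathstart_def pathfinish_def)
    define C where "C = loop_homotopy M x `` {\<gamma>}"
    have C: "C \<in> carrier (fundamental_group M x)"
      using \<gamma> by (auto simp: C_def fundamental_group_def quotient_def)
    have "\<gamma> \<in> C" unfolding C_def using equiv_class_self[OF equiv_loop_homotopy \<gamma>] .
    then have "\<exists>G. \<exists>\<gamma>\<in>C. ?P \<gamma> G" using G \<gamma> by blast
    then have "\<exists>\<gamma>\<in>C. ?P \<gamma> (\<Gamma> C)" unfolding \<Gamma>_def by (rule someI_ex)
    then obtain \<gamma>' where \<gamma>': "\<gamma>' \<in> C" "sect {0..1} \<gamma>' (\<Gamma> C)" "germ x (\<Gamma> C 0) f" by blast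
    then have "homotopic_paths M \<gamma> \<gamma>'" by (auto simp: C_def loop_homotopy_def)
    moreover have "germ (\<gamma> 0) (G 0) (\<Gamma> C 0)"
      using germ_eq_trans[OF G(6) germ_eq_sym[OF \<gamma>'(3)]] G(3) by simp
    ultimately have "germ x (G 1) (\<Gamma> C 1)"
      using homotopic_sect_end[OF _ G(5) \<gamma>'(2)] G(4) by simp
    from germ_eq_trans[OF germ_eq_sym[OF G(7)] this] show ?thesis using C by blast
  qed
  then show "\<exists>A. finite A \<and> (\<forall>g. reach x f x g \<longrightarrow> (\<exists>a\<in>A. germ x g a))"
    using fin by (intro exI[of _ "(\<lambda>C. \<Gamma> C 1) ` carrier (fundamental_group M x)"]) auto
qed

lemma local_maximum_if_finite_fundamental_group:
  assumes M: "connected M" "compact M" and x: "x \<in> M" and fin: "finite (carrier (fundamental_group M x))"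
  obtains U f q where "sol U f" "q \<in> U" "\<And>y. y \<in> U \<Longrightarrow> f y \<le> f q"
proof -
  obtain U0 f0 where f0: "x \<in> U0" "sol U0 f0" using sol_exists[OF x] by blast
  have fr: "finitely_reachable x f0 q" if "q \<in> M" for q
    using finitely_reachable_everywhere[OF M(1) finitely_reachable_base[OF fin f0] x that] .
  \<comment> \<open>The maximum over all branches. That it ranges over finitely many values, and
    varies continuously, is seen locally in \<open>loc\<close>, where the branches are those of a
    fixed finite family.\<close>
  define F where "F q = Max {g q |g. reach x f0 q g}" for q
  have loc: "\<exists>W K. nice W \<and> q \<in> W \<and> finite K \<and> K \<noteq> {} \<and> (\<forall>k\<in>K. sol W k) \<and> (\<forall>p\<in>W. F p = Max ((\<lambda>k. k p) ` K))"
    if q: "q \<in> M" for q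
  proof -
    obtain W where W: "nice W" "q \<in> W" using nice_exists[of M q] q by auto
    obtain K where K: "finite K" "K \<noteq> {}" "\<And>k. k \<in> K \<Longrightarrow> sol W k"
      "\<And>k p. k \<in> K \<Longrightarrow> p \<in> W \<Longrightarrow> reach x f0 p k"
      "\<And>p g. p \<in> W \<Longrightarrow> reach x f0 p g \<Longrightarrow> \<exists>k\<in>K. germ p g k"
      using finitely_reachable_nice[OF fr[OF q] W] by blast
    have "{g p |g. reach x f0 p g} = (\<lambda>k. k p) ` K" if "p \<in> W" for p
    proof
      show "{g p |g. reach x f0 p g} \<subseteq> (\<lambda>k. k p) ` K"
        using K(5)[OF that] germ_eq_value by blast
      show "(\<lambda>k. k p) ` K \<subseteq> {g p |g. reach x f0 p g}" using K(4) that by blast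
    qed
    then show ?thesis using W K by (intro exI[of _ W] exI[of _ K]) (auto simp: F_def)
  qed
  have cont_Max: "continuous_on W (\<lambda>p. Max ((\<lambda>k. k p) ` K))"
    if "finite K" "K \<noteq> {}" "\<forall>k\<in>K. continuous_on W k" for W :: "'a set" and K :: "('a \<Rightarrow> real) set"
    using that
  proof (induction K rule: finite_ne_induct)
    case (insert k K)
    then show ?case by (auto intro!: continuous_on_max)
  qed simp
  have "continuous_on M F"
  proof (rule continuous_on_def[THEN iffD2], intro ballI)
    fix q assume "q \<in> M"
    from loc[OF this] obtain W K where W: "nice W" "q \<in> W" "finite K" "K \<noteq> {}" "\<forall>k\<in>K. sol W k"
      "\<forall>p\<in>W. F p = Max ((\<lambda>k. k p) ` K)" by blast
    have "continuous_on W F"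
      using cont_Max[of K W] W sol_continuous by (subst continuous_on_cong[OF refl]) auto
    then have "(F \<longlongrightarrow> F q) (at q within W)" using W(2) by (simp add: continuous_on_def)
    moreover obtain P where "open P" "W = M \<inter> P" using nice_open[OF W(1)] unfolding openin_open by blast
    then have "at q within M = at q within W"
      using W(2) by (intro at_within_nhd[of q P]) auto
    ultimately show "(F \<longlongrightarrow> F q) (at q within M)" by simp
  qed
  then obtain q where q: "q \<in> M" "\<And>y. y \<in> M \<Longrightarrow> F y \<le> F q"
    using continuous_attains_sup[OF M(2)] x by blast
  from loc[OF q(1)] obtain W K where W: "nice W" "q \<in> W" "finite K" "K \<noteq> {}" "\<forall>k\<in>K. sol W k"
    "\<forall>p\<in>W. F p = Max ((\<lambda>k. k p) ` K)" by blast
  have "F q \<in> (\<lambda>k. k q) ` K" using W Max_in[of "(\<lambda>k. k q) ` K"] by auto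
  then obtain k where k: "k \<in> K" "F q = k q" by blast
  show thesis
  proof (rule that[of W k q])
    fix y assume y: "y \<in> W"
    \<comment> \<open>The branch \<open>k\<close> that attains the maximum at \<open>q\<close> stays
      below \<open>F\<close>, and \<open>F\<close> is nowhere larger than
      \<open>F q = k q\<close>.\<close>
    have "k y \<le> F y" using W y k by auto
    also have "\<dots> \<le> k q" using q(2)[of y] nice_subset[OF W(1)] y k(2) by auto
    finally show "k y \<le> k q" .
  qed (use W k in auto)
qed

end

section \<open>Smooth functions and tangent vectors\<close>

context smooth_manifold
begin

lemma smooth_fun_openin: "smooth_fun U f \<Longrightarrow> openin (top_of_set M) U"
  by (simp add: smooth_fun_def)

lemma smooth_fun_subset_M: "smooth_fun U f \<Longrightarrow> U \<subseteq> M"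
  using smooth_fun_openin openin_imp_subset by blast

lemma smooth_funD:
  "smooth_fun U f \<Longrightarrow> (V, \<phi>) \<in> charts \<Longrightarrow> smooth_on (\<phi> ` (U \<inter> V)) (f \<circ> inv_into V \<phi>)"
  by (auto simp: smooth_fun_def)

lemma chart_inj: "(V, \<phi>) \<in> charts \<Longrightarrow> inj_on \<phi> V"
  using chart_homeomorphism[of V \<phi>] by (auto intro: inj_on_inverseI dest: homeomorphism_apply1)

lemma chart_homeo: 
  assumes "(V, \<phi>) \<in> charts" 
  shows "homeomorphism V (\<phi> ` V) \<phi> (inv_into V \<phi>)"
proof -
  obtain \<psi> where h: "homeomorphism V (\<phi> ` V) \<phi> \<psi>" using chart_homeomorphism[OF assms] by blast
  show ?thesis
    by (rule homeomorphism_cong[OF h refl refl]) 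
      (auto simp: chart_inj[OF assms] inv_into_f_f homeomorphism_apply1[OF h])
qed

lemma chart_subset: "(V, \<phi>) \<in> charts \<Longrightarrow> V \<subseteq> M"
  using chart_domain_open openin_imp_subset by blast

lemma chart_image_open_Int:
  assumes c: "(V, \<phi>) \<in> charts" and U: "openin (top_of_set M) U"
  shows "open (\<phi> ` (U \<inter> V))"
proof -
  have "openin (top_of_set V) (U \<inter> V)"
    by (rule openin_subset_trans[OF openin_Int[OF U chart_domain_open[OF c]] _ chart_subset[OF c]]) simp
  then have "openin (top_of_set (\<phi> ` V)) (\<phi> ` (U \<inter> V))"
    by (rule homeomorphism_imp_open_map[OF chart_homeo[OF c]])
  then show ?thesis using chart_image_open[OF c] openin_open_eq by blast
qed

lemma chart_preimage_open:
  assumes c: "(V, \<phi>) \<in> charts" and X: "open X"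
  shows "openin (top_of_set M) (V \<inter> \<phi> -` X)"
proof -
  have "continuous_on V \<phi>" using chart_homeo[OF c] by (simp add: homeomorphism_def)
  then have "openin (top_of_set V) (V \<inter> \<phi> -` X)"
    using X by (simp add: continuous_openin_preimage_gen)
  then show ?thesis using chart_domain_open[OF c] openin_trans by blast
qed

lemma smooth_funI:
  assumes "openin (top_of_set M) U"
    and "\<And>V \<phi>. (V, \<phi>) \<in> charts \<Longrightarrow> smooth_on (\<phi> ` (U \<inter> V)) (f \<circ> inv_into V \<phi>)"
  shows "smooth_fun U f"
  using assms by (auto simp: smooth_fun_def)

lemma smooth_fun_subset:
  assumes "smooth_fun U f" "openin (top_of_set M) V" "V \<subseteq> U"
  shows "smooth_fun V f"
proof (rule smooth_funI[OF assms(2)])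
  fix W \<phi> assume "(W, \<phi>) \<in> charts"
  from smooth_funD[OF assms(1) this] show "smooth_on (\<phi> ` (V \<inter> W)) (f \<circ> inv_into W \<phi>)"
    by (rule smooth_on_subset) (use assms(3) in blast)
qed

lemma smooth_fun_cong:
  assumes "smooth_fun U f" "\<And>q. q \<in> U \<Longrightarrow> f q = g q"
  shows "smooth_fun U g"
proof (rule smooth_funI[OF smooth_fun_openin[OF assms(1)]])
  fix V \<phi> assume c: "(V, \<phi>) \<in> charts"
  have "(f \<circ> inv_into V \<phi>) x = (g \<circ> inv_into V \<phi>) x" if "x \<in> \<phi> ` (U \<inter> V)" for x
    using that assms(2) chart_inj[OF c] by auto
  note eq = smooth_on_cong[OF chart_image_open_Int[OF c smooth_fun_openin[OF assms(1)]] this]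
  show "smooth_on (\<phi> ` (U \<inter> V)) (g \<circ> inv_into V \<phi>)"
    by (rule eq[THEN iffD1, OF _ smooth_funD[OF assms(1) c]])
qed

lemma smooth_fun_local:
  assumes "openin (top_of_set M) U" "\<And>q. q \<in> U \<Longrightarrow> \<exists>W. q \<in> W \<and> smooth_fun W f"
  shows "smooth_fun U f"
proof (rule smooth_funI[OF assms(1)], rule smooth_on_local)
  fix V \<phi> x assume c: "(V, \<phi>) \<in> charts" and x: "x \<in> \<phi> ` (U \<inter> V)"
  then obtain q where q: "q \<in> U" "q \<in> V" "x = \<phi> q" by blast
  obtain W where W: "q \<in> W" "smooth_fun W f" using assms(2)[OF q(1)] by blast
  show "\<exists>T. open T \<and> x \<in> T \<and> smooth_on T (f \<circ> inv_into V \<phi>)"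
    using chart_image_open_Int[OF c smooth_fun_openin[OF W(2)]] smooth_funD[OF W(2) c] q W
    by (intro exI[of _ "\<phi> ` (W \<inter> V)"]) auto
qed

lemma smooth_fun_const: "openin (top_of_set M) U \<Longrightarrow> smooth_fun U (\<lambda>q. c)"
  by (rule smooth_funI) (auto simp: o_def smooth_on_const)

lemma smooth_fun_add:
  assumes "smooth_fun U f" "smooth_fun U g" 
  shows "smooth_fun U (\<lambda>q. f q + g q)"
proof (rule smooth_funI[OF smooth_fun_openin[OF assms(1)]])
  fix V \<phi> assume c: "(V, \<phi>) \<in> charts"
  show "smooth_on (\<phi> ` (U \<inter> V)) ((\<lambda>q. f q + g q) \<circ> inv_into V \<phi>)"
    using smooth_on_add[OF chart_image_open_Int[OF c smooth_fun_openin[OF assms(1)]] smooth_funD[OF assms(1) c] smooth_funD[OF assms(2) c]]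
    by (simp add: o_def)
qed

lemma smooth_fun_mult:
  assumes "smooth_fun U f" "smooth_fun U g" 
  shows "smooth_fun U (\<lambda>q. f q * g q)"
proof (rule smooth_funI[OF smooth_fun_openin[OF assms(1)]])
  fix V \<phi> assume c: "(V, \<phi>) \<in> charts"
  show "smooth_on (\<phi> ` (U \<inter> V)) ((\<lambda>q. f q * g q) \<circ> inv_into V \<phi>)"
    using smooth_on_mult[OF chart_image_open_Int[OF c smooth_fun_openin[OF assms(1)]] smooth_funD[OF assms(1) c] smooth_funD[OF assms(2) c]]
    by (simp add: o_def)
qed

text \<open>In any other chart the function is the composition with a transition map, which is
  smooth by \<open>charts_compatible\<close>.\<close>

lemma smooth_fun_chartI:
  assumes c: "(V, \<phi>) \<in> charts" and U: "openin (top_of_set M) U" "U \<subseteq> V"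
    and f: "smooth_on (\<phi> ` U) (f \<circ> inv_into V \<phi>)"
  shows "smooth_fun U f"
proof (rule smooth_funI[OF U(1)])
  fix W \<theta> assume d: "(W, \<theta>) \<in> charts"
  have UV: "U \<inter> V = U" using U by blast
  have o: "open (\<theta> ` (U \<inter> W))" "open (\<phi> ` U)"
    using chart_image_open_Int[OF d U(1)] chart_image_open_Int[OF c U(1)] UV by auto
  have im: "(\<phi> \<circ> inv_into W \<theta>) ` (\<theta> ` (U \<inter> W)) \<subseteq> \<phi> ` U"
    using chart_inj[OF d] by auto
  have "smooth_on (\<theta> ` (U \<inter> W)) (\<phi> \<circ> inv_into W \<theta>)"
    using charts_compatible[OF d c] by (rule smooth_on_subset) (use U in blast)
  from smooth_on_compose[OF o im f this]
  have "smooth_on (\<theta> ` (U \<inter> W)) (\<lambda>x. (f \<circ> inv_into V \<phi>) ((\<phi> \<circ> inv_into W \<theta>) x))" .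
  then show "smooth_on (\<theta> ` (U \<inter> W)) (f \<circ> inv_into W \<theta>)"
    by (rule smooth_on_cong[OF o(1), THEN iffD1, rotated])
      (use U chart_inj[OF c] chart_inj[OF d] in auto)
qed

lemma smooth_nearI: "smooth_fun U f \<Longrightarrow> p \<in> U \<Longrightarrow> smooth_near p f"
  by (auto simp: smooth_near_def)

lemma smooth_near_common:
  assumes "smooth_near p f" "smooth_near p g"
  obtains U where "p \<in> U" "smooth_fun U f" "smooth_fun U g"
proof -
  obtain U V where "p \<in> U" "smooth_fun U f" "p \<in> V" "smooth_fun V g"
    using assms by (auto simp: smooth_near_def)
  then show thesis
    by (intro that[of "U \<inter> V"]) (auto intro: smooth_fun_subset openin_Int smooth_fun_openin)
qed

lemma smooth_near_const: "p \<in> M \<Longrightarrow> smooth_near p (\<lambda>q. c)"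
  by (rule smooth_nearI[OF smooth_fun_const[of M]]) auto

lemma smooth_near_add: "smooth_near p f \<Longrightarrow> smooth_near p g \<Longrightarrow> smooth_near p (\<lambda>q. f q + g q)"
  by (metis smooth_near_common smooth_fun_add smooth_nearI)

lemma smooth_near_mult: "smooth_near p f \<Longrightarrow> smooth_near p g \<Longrightarrow> smooth_near p (\<lambda>q. f q * g q)"
  by (metis smooth_near_common smooth_fun_mult smooth_nearI)

lemma smooth_near_sum:
  "p \<in> M \<Longrightarrow> (\<And>i. i \<in> I \<Longrightarrow> smooth_near p (f i)) \<Longrightarrow> smooth_near p (\<lambda>q. \<Sum>i\<in>I. f i q)"
  by (induction I rule: infinite_finite_induct) (auto intro: smooth_near_const smooth_near_add)

section \<open>Calculus of derivations\<close>

lemma tangent_local: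
  assumes v: "v \<in> tangent_space p" and "p \<in> U" "smooth_fun U f" "\<And>q. q \<in> U \<Longrightarrow> f q = g q"
  shows "v f = v g"
proof -
  have "\<forall>f g U. p \<in> U \<and> smooth_fun U f \<and> (\<forall>q\<in>U. f q = g q) \<longrightarrow> v f = v g"
    using v unfolding tangent_space_def by blast
  then show ?thesis using assms(2-4) by blast
qed

lemma tangent_lincomb:
  assumes v: "v \<in> tangent_space p" and "smooth_near p f" "smooth_near p g"
  shows "v (\<lambda>q. a * f q + b * g q) = a * v f + b * v g"
proof -
  have "\<forall>f g a b. smooth_near p f \<and> smooth_near p g \<longrightarrow> v (\<lambda>q. a * f q + b * g q) = a * v f + b * v g"
    using v unfolding tangent_space_def by blast
  then show ?thesis using assms(2-) by blast
qed

lemma tangent_mult: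
  assumes v: "v \<in> tangent_space p" and "smooth_near p f" "smooth_near p g"
  shows "v (\<lambda>q. f q * g q) = v f * g p + f p * v g"
proof -
  have "\<forall>f g. smooth_near p f \<and> smooth_near p g \<longrightarrow> v (\<lambda>q. f q * g q) = v f * g p + f p * v g"
    using v unfolding tangent_space_def by blast
  then show ?thesis using assms(2-) by blast
qed

lemma tangent_not_smooth:
  assumes v: "v \<in> tangent_space p" and "\<not> smooth_near p f"
  shows "v f = 0"
  using assms unfolding tangent_space_def by blast

lemma tangent_add:
  assumes "v \<in> tangent_space p" "smooth_near p f" "smooth_near p g"
  shows "v (\<lambda>q. f q + g q) = v f + v g"
  using tangent_lincomb[OF assms, of 1 1] by simp

lemma tangent_const:
  assumes v: "v \<in> tangent_space p" and p: "p \<in> M"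
  shows "v (\<lambda>q. c) = 0"
proof -
  note n = smooth_near_const[OF p]
  \<comment> \<open>The product rule for 1 * 1 says that this value equals its double.\<close>
  have "v (\<lambda>q. 1) = 0" using tangent_mult[OF v n[of 1] n[of 1]] by simp
  then show ?thesis using tangent_lincomb[OF v n[of 1] n[of 1], of c 0] by simp
qed

lemma tangent_sum:
  assumes v: "v \<in> tangent_space p" and p: "p \<in> M" and f: "\<And>i. i \<in> I \<Longrightarrow> smooth_near p (f i)"
  shows "v (\<lambda>q. \<Sum>i\<in>I. f i q) = (\<Sum>i\<in>I. v (f i))"
  using f
proof (induction I rule: infinite_finite_induct)
  case (insert i I)
  have "v (\<lambda>q. f i q + (\<Sum>i\<in>I. f i q)) = v (f i) + v (\<lambda>q. \<Sum>i\<in>I. f i q)"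
    by (intro tangent_add[OF v] smooth_near_sum[OF p] insert.prems) auto
  then show ?case using insert by simp
qed (auto simp: tangent_const[OF v p])

lemma tangent_spaceI:
  assumes "\<And>f g U. p \<in> U \<Longrightarrow> smooth_fun U f \<Longrightarrow> (\<And>q. q \<in> U \<Longrightarrow> f q = g q) \<Longrightarrow> v f = v g"
    and "\<And>f g a b. smooth_near p f \<Longrightarrow> smooth_near p g \<Longrightarrow> v (\<lambda>q. a * f q + b * g q) = a * v f + b * v g"
    and "\<And>f g. smooth_near p f \<Longrightarrow> smooth_near p g \<Longrightarrow> v (\<lambda>q. f q * g q) = v f * g p + f p * v g"
    and "\<And>f. \<not> smooth_near p f \<Longrightarrow> v f = 0"
  shows "v \<in> tangent_space p"
  unfolding tangent_space_def using assms by (intro CollectI conjI allI impI; (elim conjE)?; simp)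

lemma tangent_space_lincomb:
  assumes "v \<in> tangent_space p" "w \<in> tangent_space p"
  shows "(\<lambda>u. a * v u + b * w u) \<in> tangent_space p"
proof (rule tangent_spaceI)
  fix f g U assume "p \<in> U" "smooth_fun U f" "\<And>q. q \<in> U \<Longrightarrow> f q = g q"
  then show "a * v f + b * w f = a * v g + b * w g"
    using tangent_local[OF assms(1), of U f g] tangent_local[OF assms(2), of U f g] by simp
qed (simp_all add: tangent_lincomb[OF assms(1)] tangent_lincomb[OF assms(2)] tangent_mult[OF assms(1)] tangent_mult[OF assms(2)]
   tangent_not_smooth[OF assms(1)] tangent_not_smooth[OF assms(2)] algebra_simps)

section \<open>The module of global vector fields\<close>

lemma vector_field_tangent: "X \<in> vector_fields \<Longrightarrow> p \<in> M \<Longrightarrow> X p \<in> tangent_space p"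
  by (simp add: vector_fields_def)

lemma vector_field_outside: "X \<in> vector_fields \<Longrightarrow> p \<notin> M \<Longrightarrow> X p u = 0"
  by (simp add: vector_fields_def)

lemma vector_field_smooth: "X \<in> vector_fields \<Longrightarrow> smooth_fun U f \<Longrightarrow> smooth_fun U (\<lambda>p. X p f)"
  by (simp add: vector_fields_def)

lemma vector_field_smooth_near: "X \<in> vector_fields \<Longrightarrow> smooth_near q f \<Longrightarrow> smooth_near q (\<lambda>p. X p f)"
  unfolding smooth_near_def using vector_field_smooth by blast

lemma vector_field_lincomb:
  assumes X: "X \<in> vector_fields" "Y \<in> vector_fields" and f: "smooth_fun M f" "smooth_fun M g"
  shows "(\<lambda>p u. f p * X p u + g p * Y p u) \<in> vector_fields"
proof -
  have "smooth_fun U (\<lambda>p. f p * X p u + g p * Y p u)" if u: "smooth_fun U u" for U u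
  proof -
    note o = smooth_fun_openin[OF u] and s = smooth_fun_subset_M[OF u]
    show ?thesis
      by (rule smooth_fun_add[OF smooth_fun_mult[OF smooth_fun_subset[OF f(1) o s] vector_field_smooth[OF X(1) u]]
            smooth_fun_mult[OF smooth_fun_subset[OF f(2) o s] vector_field_smooth[OF X(2) u]]])
  qed
  moreover have "(\<lambda>u. f p * X p u + g p * Y p u) \<in> tangent_space p" if "p \<in> M" for p
    using tangent_space_lincomb[OF vector_field_tangent[OF X(1) that] vector_field_tangent[OF X(2) that]] .
  moreover have "(\<lambda>u. f p * X p u + g p * Y p u) = (\<lambda>u. 0)" if "p \<notin> M" for p
    using that vector_field_outside[OF X(1)] vector_field_outside[OF X(2)] by simp
  ultimately show ?thesis unfolding vector_fields_def by blast
qed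

lemma vector_field_zero: "(\<lambda>p u. 0) \<in> vector_fields"
proof -
  have "(\<lambda>u. 0) \<in> tangent_space p" for p by (rule tangent_spaceI) auto
  then show ?thesis unfolding vector_fields_def using smooth_fun_const[OF smooth_fun_openin] by blast
qed

lemma vector_field_mult:
  "X \<in> vector_fields \<Longrightarrow> smooth_fun M f \<Longrightarrow> (\<lambda>p u. f p * X p u) \<in> vector_fields"
  using vector_field_lincomb[of X X f "\<lambda>_. 0"] smooth_fun_const[of M 0] by auto

lemma vector_field_sum:
  assumes "\<And>i. i \<in> I \<Longrightarrow> X i \<in> vector_fields" "\<And>i. i \<in> I \<Longrightarrow> smooth_fun M (f i)"
  shows "(\<lambda>p u. \<Sum>i\<in>I. f i p * X i p u) \<in> vector_fields"
  using assms
proof (induction I rule: infinite_finite_induct)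
  case (insert i I)
  have "(\<lambda>p u. f i p * X i p u + 1 * (\<Sum>i\<in>I. f i p * X i p u)) \<in> vector_fields"
    by (rule vector_field_lincomb) (use insert smooth_fun_const[of M 1] in auto)
  then show ?case using insert by simp
qed (auto simp: vector_field_zero)

end

section \<open>Coordinate fields\<close>

locale manifold_chart = smooth_manifold M charts
  for M :: "'a::topological_space set" and charts :: "('a set \<times> ('a \<Rightarrow> real ^ 'n)) set" +
  fixes V :: "'a set" and \<phi> :: "'a \<Rightarrow> real ^ 'n"
  assumes chart: "(V, \<phi>) \<in> charts"
begin

abbreviation "\<psi> \<equiv> inv_into V \<phi>"

lemma \<psi>_\<phi>: "q \<in> V \<Longrightarrow> \<psi> (\<phi> q) = q"
  using chart_inj[OF chart] by simp

lemma \<phi>_\<psi>: "x \<in> \<phi> ` V \<Longrightarrow> \<phi> (\<psi> x) = x"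
  by (rule f_inv_into_f)

lemma \<psi>_in: "x \<in> \<phi> ` V \<Longrightarrow> \<psi> x \<in> V"
  by (rule inv_into_into)

lemma V_open: "openin (top_of_set M) V"
  by (rule chart_domain_open[OF chart])

lemma V_subset: "V \<subseteq> M"
  by (rule chart_subset[OF chart])

definition pd :: "real ^ 'n \<Rightarrow> ('a \<Rightarrow> real) \<Rightarrow> 'a \<Rightarrow> real" where
  "pd v f q = frechet_derivative (f \<circ> \<psi>) (at (\<phi> q)) v"

lemma pd_has_derivative:
  assumes "smooth_near q f" "q \<in> V"
  shows "((f \<circ> \<psi>) has_derivative (\<lambda>v. pd v f q)) (at (\<phi> q))"
proof -
  obtain U where U: "q \<in> U" "smooth_fun U f" using assms(1) by (auto simp: smooth_near_def)
  show ?thesis unfolding pd_def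
    using smooth_on_has_derivative[OF smooth_funD[OF U(2) chart], of "\<phi> q"] U(1) assms(2) by simp
qed

lemma pd_smooth:
  assumes "smooth_fun U f"
  shows "smooth_fun (U \<inter> V) (pd v f)"
proof (rule smooth_fun_chartI[OF chart openin_Int[OF smooth_fun_openin[OF assms] V_open]])
  have "smooth_on (\<phi> ` (U \<inter> V)) (\<lambda>x. frechet_derivative (f \<circ> \<psi>) (at x) v)"
    by (rule smooth_on_frechet_derivative[OF smooth_funD[OF assms chart]])
  then show "smooth_on (\<phi> ` (U \<inter> V)) (pd v f \<circ> \<psi>)"
    by (rule smooth_on_cong[OF chart_image_open_Int[OF chart smooth_fun_openin[OF assms]], THEN iffD1, rotated])
      (auto simp: pd_def \<psi>_\<phi>)
qed simp

lemma pd_smooth_near: "smooth_near q f \<Longrightarrow> q \<in> V \<Longrightarrow> smooth_near q (pd v f)"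
  unfolding smooth_near_def using pd_smooth by blast

lemma pd_eqI:
  assumes "q \<in> V" "openin (top_of_set M) U" "q \<in> U" "\<And>x. x \<in> U \<Longrightarrow> f x = g x"
    and "((f \<circ> \<psi>) has_derivative F) (at (\<phi> q))"
  shows "pd v g q = F v"
proof -
  have "((g \<circ> \<psi>) has_derivative F) (at (\<phi> q))"
    by (rule has_derivative_transform_within_open[OF assms(5) chart_image_open_Int[OF chart assms(2)]])
      (use assms chart_inj[OF chart] in auto)
  then show ?thesis unfolding pd_def by (simp add: frechet_derivative_at[symmetric])
qed

lemma pd_cong:
  assumes "q \<in> V" "smooth_near q f" "openin (top_of_set M) U" "q \<in> U" "\<And>x. x \<in> U \<Longrightarrow> f x = g x"
  shows "pd v g q = pd v f q"
  by (rule pd_eqI[OF assms(1,3,4,5) pd_has_derivative[OF assms(2,1)]])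

lemma pd_lincomb:
  assumes q: "q \<in> V" and f: "smooth_near q f" "smooth_near q g"
  shows "pd v (\<lambda>x. a * f x + b * g x) q = a * pd v f q + b * pd v g q"
proof -
  have "((\<lambda>x. a * (f \<circ> \<psi>) x + b * (g \<circ> \<psi>) x) has_derivative (\<lambda>v. a * pd v f q + b * pd v g q)) (at (\<phi> q))"
    by (intro has_derivative_add has_derivative_mult_right pd_has_derivative f q)
  then show ?thesis
    using pd_eqI[OF q, of M "\<lambda>x. a * f x + b * g x"] q V_subset by (auto simp: o_def)
qed

lemma pd_mult:
  assumes q: "q \<in> V" and f: "smooth_near q f" "smooth_near q g"
  shows "pd v (\<lambda>x. f x * g x) q = pd v f q * g q + f q * pd v g q"
proof -
  have "((\<lambda>x. (f \<circ> \<psi>) x * (g \<circ> \<psi>) x) has_derivative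
      (\<lambda>v. (f \<circ> \<psi>) (\<phi> q) * pd v g q + pd v f q * (g \<circ> \<psi>) (\<phi> q))) (at (\<phi> q))"
    by (intro has_derivative_mult pd_has_derivative f q)
  then show ?thesis
    using pd_eqI[OF q, of M "\<lambda>x. f x * g x"] q V_subset by (auto simp: o_def \<psi>_\<phi>)
qed

lemma pd_linear: "q \<in> V \<Longrightarrow> smooth_near q f \<Longrightarrow> linear (\<lambda>v. pd v f q)"
  using has_derivative_linear[OF pd_has_derivative] by blast

lemma pd_basis: "q \<in> V \<Longrightarrow> smooth_near q f \<Longrightarrow> pd v f q = (\<Sum>b\<in>Basis. (v \<bullet> b) * pd b f q)"
  unfolding real_scaleR_def[symmetric] by (rule linear_basis_sum[OF pd_linear])

definition coord :: "real ^ 'n \<Rightarrow> 'a \<Rightarrow> real" where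
  "coord b x = \<phi> x \<bullet> b"

lemma smooth_fun_coord: "smooth_fun V (coord b)"
proof (rule smooth_fun_chartI[OF chart V_open order_refl])
  have "smooth_on (\<phi> ` V) (\<lambda>x. x \<bullet> b)"
    by (rule smooth_on_linear[OF chart_image_open[OF chart] bounded_linear_inner_left])
  then show "smooth_on (\<phi> ` V) (coord b \<circ> \<psi>)"
    by (rule smooth_on_cong[OF chart_image_open[OF chart], THEN iffD1, rotated]) (auto simp: coord_def \<psi>_\<phi>)
qed

lemma smooth_near_coord: "q \<in> V \<Longrightarrow> smooth_near q (coord b)"
  by (rule smooth_nearI[OF smooth_fun_coord])

lemma pd_coord:
  assumes "q \<in> V"
  shows "pd v (coord b) q = v \<bullet> b"
proof -
  have "((\<lambda>x. x \<bullet> b) has_derivative (\<lambda>v. v \<bullet> b)) (at (\<phi> q))"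
    by (rule bounded_linear_imp_has_derivative[OF bounded_linear_inner_left])
  then have "((coord b \<circ> \<psi>) has_derivative (\<lambda>v. v \<bullet> b)) (at (\<phi> q))"
    by (rule has_derivative_transform_within_open[OF _ chart_image_open[OF chart]])
      (use assms in \<open>auto simp: coord_def \<psi>_\<phi>\<close>)
  then show ?thesis unfolding pd_def by (simp add: frechet_derivative_at[symmetric])
qed

text \<open>Hadamard's lemma on a ball around \<open>\<phi> q\<close> writes \<open>f\<close> near
  \<open>q\<close> as a constant plus products of coordinate differences, which vanish at
  \<open>q\<close>, with smooth functions \<open>g b\<close>. The product rule leaves only the
  values \<open>g b q\<close>, and these are the partial derivatives of \<open>f\<close>.\<close>

lemma tangent_expansion:
  assumes \<tau>: "\<tau> \<in> tangent_space q" and q: "q \<in> V" and f: "smooth_near q f"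
  shows "\<tau> f = (\<Sum>b\<in>Basis. \<tau> (coord b) * pd b f q)"
proof -
  have qM: "q \<in> M" using q V_subset by blast
  obtain U where U: "q \<in> U" "smooth_fun U f" using f by (auto simp: smooth_near_def)
  have oU: "open (\<phi> ` (U \<inter> V))" by (rule chart_image_open_Int[OF chart smooth_fun_openin[OF U(2)]])
  obtain r where r: "r > 0" "ball (\<phi> q) r \<subseteq> \<phi> ` (U \<inter> V)"
    using oU U(1) q open_contains_ball by (metis IntI imageI)
  let ?S = "ball (\<phi> q) r"
  define W where "W = V \<inter> \<phi> -` ?S"
  have W: "openin (top_of_set M) W" "q \<in> W" "W \<subseteq> V"
    unfolding W_def using chart_preimage_open[OF chart open_ball] q r by auto
  have WU: "W \<subseteq> U"
  proof
    fix x assume x: "x \<in> W"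
    then have "\<phi> x \<in> \<phi> ` (U \<inter> V)" "x \<in> V" using r by (auto simp: W_def)
    then show "x \<in> U" using chart_inj[OF chart] by (auto dest: inj_onD)
  qed
  have \<phi>W: "\<phi> ` W \<subseteq> ?S" by (auto simp: W_def)
  have "?S \<subseteq> \<phi> ` W" using r(2) by (auto simp: W_def)
  have sf: "smooth_on ?S (f \<circ> \<psi>)" using smooth_funD[OF U(2) chart] r(2) by (rule smooth_on_subset)
  obtain G where G: "\<And>b. smooth_on ?S (G b)" "\<And>b. G b (\<phi> q) = frechet_derivative (f \<circ> \<psi>) (at (\<phi> q)) b"
    "\<And>x. x \<in> ?S \<Longrightarrow> (f \<circ> \<psi>) x = (f \<circ> \<psi>) (\<phi> q) + (\<Sum>b\<in>Basis. ((x - \<phi> q) \<bullet> b) * G b x)"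
    using hadamard_lemma[OF convex_ball open_ball _ sf, of "\<phi> q"] r(1) by (auto simp: o_def)
  define g where "g b x = G b (\<phi> x)" for b x
  have g: "smooth_fun W (g b)" for b
  proof (rule smooth_fun_chartI[OF chart W(1,3)])
    have "open (\<phi> ` W)" using chart_image_open_Int[OF chart W(1)] W(3) by (simp add: inf.absorb1)
    moreover have "G b x = (g b \<circ> \<psi>) x" if "x \<in> \<phi> ` W" for x
      using that W(3) by (auto simp: g_def \<psi>_\<phi> subset_iff)
    ultimately show "smooth_on (\<phi> ` W) (g b \<circ> \<psi>)"
      by (rule smooth_on_cong[THEN iffD1, OF _ _ smooth_on_subset[OF G(1) \<phi>W]])
  qed
  have eq: "f x = f q + (\<Sum>b\<in>Basis. (coord b x + - coord b q) * g b x)" if "x \<in> W" for x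
    using G(3)[of "\<phi> x"] that q by (auto simp: W_def g_def coord_def \<psi>_\<phi> inner_diff_left)
  have ng: "smooth_near q (g b)" for b using g W(2) by (rule smooth_nearI)
  note nc = smooth_near_coord[OF q] and nk = smooth_near_const[OF qM]
  have ncg: "smooth_near q (\<lambda>x. (coord b x + - coord b q) * g b x)" for b
    by (intro smooth_near_mult smooth_near_add nc nk ng)
  have "\<tau> f = \<tau> (\<lambda>x. f q + (\<Sum>b\<in>Basis. (coord b x + - coord b q) * g b x))"
    by (rule tangent_local[OF \<tau> W(2) smooth_fun_subset[OF U(2) W(1) WU] eq])
  also have "\<dots> = \<tau> (\<lambda>x. f q) + \<tau> (\<lambda>x. \<Sum>b\<in>Basis. (coord b x + - coord b q) * g b x)"
    by (rule tangent_add[OF \<tau> nk smooth_near_sum[OF qM ncg]])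
  also have "\<dots> = (\<Sum>b\<in>Basis. \<tau> (\<lambda>x. (coord b x + - coord b q) * g b x))"
    using tangent_sum[OF \<tau> qM ncg] tangent_const[OF \<tau> qM] by simp
  also have "\<dots> = (\<Sum>b\<in>Basis. \<tau> (coord b) * pd b f q)"
  proof (rule sum.cong[OF refl])
    fix b
    have "\<tau> (\<lambda>x. (coord b x + - coord b q) * g b x) = \<tau> (\<lambda>x. coord b x + - coord b q) * g b q"
      using tangent_mult[OF \<tau> smooth_near_add[OF nc nk] ng, of b "- coord b q" b] by simp
    also have "\<tau> (\<lambda>x. coord b x + - coord b q) = \<tau> (coord b)"
      using tangent_add[OF \<tau> nc nk, of b "- coord b q"] tangent_const[OF \<tau> qM] by simp
    also have "g b q = pd b f q" by (simp add: g_def G(2) pd_def)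
    finally show "\<tau> (\<lambda>x. (coord b x + - coord b q) * g b x) = \<tau> (coord b) * pd b f q" .
  qed
  finally show ?thesis .
qed

end

text \<open>Connections act on global fields, so the coordinate fields of a chart have to be
  extended to \<open>M\<close> by a cutoff. On \<open>P\<close> nothing is changed; \<open>K\<close>
  is a closed set inside the chart off which \<open>\<rho>\<close> vanishes, and its closedness in
  \<open>M\<close> is what keeps the extension by zero smooth.\<close>

locale bump_chart = manifold_chart M charts V \<phi>
  for M :: "'a::topological_space set" and charts :: "('a set \<times> ('a \<Rightarrow> real ^ 'n)) set"
    and V :: "'a set" and \<phi> :: "'a \<Rightarrow> real ^ 'n" +
  fixes \<rho> :: "'a \<Rightarrow> real" and P K :: "'a set"
  assumes \<rho>_smooth: "smooth_fun M \<rho>"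
    and P_open: "openin (top_of_set M) P" and P_V: "P \<subseteq> V" and \<rho>_P: "\<And>q. q \<in> P \<Longrightarrow> \<rho> q = 1"
    and K_V: "K \<subseteq> V" and K_closed: "openin (top_of_set M) (M - K)" and \<rho>_K: "\<And>q. q \<in> M - K \<Longrightarrow> \<rho> q = 0"
begin

lemma P_M: "P \<subseteq> M"
  using P_V V_subset by blast

text \<open>Two open sets cover \<open>U\<close>: on \<open>U \<inter> V\<close> the function is a
  product of smooth functions, and on \<open>U \<inter> (M - K)\<close> it is zero.\<close>

lemma cutoff_smooth:
  assumes U: "openin (top_of_set M) U" and s: "smooth_fun (U \<inter> V) s"
  shows "smooth_fun U (\<lambda>q. if q \<in> V then \<rho> q * s q else 0)"
proof (rule smooth_fun_local[OF U])
  fix q assume q: "q \<in> U"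
  show "\<exists>W. q \<in> W \<and> smooth_fun W (\<lambda>q. if q \<in> V then \<rho> q * s q else 0)"
  proof (cases "q \<in> V")
    case True
    have "smooth_fun (U \<inter> V) (\<lambda>q. \<rho> q * s q)"
      by (rule smooth_fun_mult[OF smooth_fun_subset[OF \<rho>_smooth] s])
        (use V_subset in \<open>auto intro: openin_Int U V_open\<close>)
    then have "smooth_fun (U \<inter> V) (\<lambda>q. if q \<in> V then \<rho> q * s q else 0)"
      by (rule smooth_fun_cong) auto
    then show ?thesis using q True by blast
  next
    case False
    have "smooth_fun (U \<inter> (M - K)) (\<lambda>q. 0)"
      by (rule smooth_fun_const[OF openin_Int[OF U K_closed]])
    then have "smooth_fun (U \<inter> (M - K)) (\<lambda>q. if q \<in> V then \<rho> q * s q else 0)"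
      by (rule smooth_fun_cong) (use \<rho>_K in auto)
    moreover have "q \<in> U \<inter> (M - K)" using q False K_V openin_imp_subset[OF U] by blast
    ultimately show ?thesis by (intro exI[of _ "U \<inter> (M - K)"] conjI)
  qed
qed

text \<open>The test \<open>smooth_near q f\<close> follows the convention that tangent vectors
  vanish on functions that are not smooth near the point.\<close>

definition coord_field :: "real ^ 'n \<Rightarrow> 'a vfield" where
  "coord_field v q f = (if q \<in> V \<and> smooth_near q f then \<rho> q * pd v f q else 0)"

lemma coord_field_P: "q \<in> P \<Longrightarrow> smooth_near q f \<Longrightarrow> coord_field v q f = pd v f q"
  using P_V \<rho>_P by (auto simp: coord_field_def)

lemma coord_field_tangent: "coord_field v q \<in> tangent_space q"
proof (cases "q \<in> V")
  case True
  show ?thesis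
  proof (rule tangent_spaceI)
    fix f g U assume U: "q \<in> U" "smooth_fun U f" "\<And>q. q \<in> U \<Longrightarrow> f q = g q"
    have "smooth_near q f" "smooth_near q g"
      using U(1) smooth_fun_cong[OF U(2,3)] U(2) smooth_nearI by blast+
    then show "coord_field v q f = coord_field v q g"
      using pd_cong[OF True _ smooth_fun_openin[OF U(2)] U(1,3)] by (simp add: coord_field_def)
  next
    fix f g a b assume f: "smooth_near q f" "smooth_near q g"
    have "smooth_near q (\<lambda>q. a * f q + b * g q)"
      using True V_subset by (intro smooth_near_add smooth_near_mult smooth_near_const f) auto
    then show "coord_field v q (\<lambda>q. a * f q + b * g q) = a * coord_field v q f + b * coord_field v q g"
      using f True by (simp add: coord_field_def pd_lincomb algebra_simps)
  next
    fix f g assume f: "smooth_near q f" "smooth_near q g"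
    have "smooth_near q (\<lambda>q. f q * g q)" by (intro smooth_near_mult f)
    then show "coord_field v q (\<lambda>q. f q * g q) = coord_field v q f * g q + f q * coord_field v q g"
      using f True by (simp add: coord_field_def pd_mult algebra_simps)
  qed (simp add: coord_field_def)
next
  case False
  then have "coord_field v q = (\<lambda>f. 0)" by (auto simp: coord_field_def fun_eq_iff)
  then show ?thesis by (auto intro: tangent_spaceI)
qed

lemma coord_field_vector_field: "coord_field v \<in> vector_fields"
proof -
  have "smooth_fun U (\<lambda>p. coord_field v p f)" if f: "smooth_fun U f" for U f
  proof -
    have "smooth_fun U (\<lambda>q. if q \<in> V then \<rho> q * pd v f q else 0)"
      by (rule cutoff_smooth[OF smooth_fun_openin[OF f] pd_smooth[OF f]])
    then show ?thesis
      by (rule smooth_fun_cong) (auto simp: coord_field_def intro: smooth_nearI[OF f])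
  qed
  moreover have "coord_field v p = (\<lambda>f. 0)" if "p \<notin> M" for p using that V_subset by (auto simp: coord_field_def fun_eq_iff)
  ultimately show ?thesis unfolding vector_fields_def using coord_field_tangent by blast
qed

text \<open>The inner function agrees with \<open>pd w f\<close> on a whole neighbourhood of
  \<open>q\<close> because \<open>P\<close> is open; agreement at \<open>q\<close> alone would not
  allow a second differentiation.\<close>

lemma coord_field_coord_field:
  assumes "q \<in> P" "smooth_near q f"
  shows "coord_field v q (\<lambda>x. coord_field w x f) = pd v (pd w f) q"
proof -
  obtain U where U: "q \<in> U" "smooth_fun U f" using assms(2) by (auto simp: smooth_near_def)
  have q: "q \<in> V" using assms P_V by blast
  have n: "smooth_near q (pd w f)" by (rule pd_smooth_near[OF assms(2) q])
  have eq: "pd w f x = coord_field w x f" if "x \<in> U \<inter> P" for x using that coord_field_P U smooth_nearI by auto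
  have o: "openin (top_of_set M) (U \<inter> P)" by (rule openin_Int[OF smooth_fun_openin[OF U(2)] P_open])
  have "pd v (\<lambda>x. coord_field w x f) q = pd v (pd w f) q"
    by (rule pd_cong[OF q n o _ eq]) (use U assms in auto)
  moreover have "smooth_near q (\<lambda>x. coord_field w x f)"
    by (rule vector_field_smooth_near[OF coord_field_vector_field assms(2)])
  ultimately show ?thesis using coord_field_P[OF assms(1)] by simp
qed

text \<open>Multiplying by \<open>\<rho>\<^sup>2\<close> makes the expansion of a field in the coordinate fields a global identity.\<close>

definition component :: "'a vfield \<Rightarrow> real ^ 'n \<Rightarrow> 'a \<Rightarrow> real" where
  "component X b q = (if q \<in> V then \<rho> q * X q (coord b) else 0)"

lemma component_smooth:
  assumes "X \<in> vector_fields"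
  shows "smooth_fun M (component X b)"
proof -
  have "smooth_fun (M \<inter> V) (\<lambda>q. X q (coord b))"
    using vector_field_smooth[OF assms smooth_fun_coord] V_subset by (simp add: inf.absorb2)
  then show ?thesis unfolding component_def by (intro cutoff_smooth) auto
qed

lemma component_P: "q \<in> P \<Longrightarrow> component X b q = X q (coord b)"
  using P_V \<rho>_P by (auto simp: component_def)

lemma expansion:
  assumes X: "X \<in> vector_fields"
  shows "(\<lambda>q u. (\<rho> q)\<^sup>2 * X q u) = (\<lambda>q u. \<Sum>b\<in>Basis. component X b q * coord_field b q u)"
proof (intro ext)
  fix q u
  consider "q \<in> V" "smooth_near q u" | "q \<in> V" "\<not> smooth_near q u" | "q \<in> M" "q \<notin> V" | "q \<notin> M" "q \<notin> V"
    using V_subset by blast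
  then show "(\<rho> q)\<^sup>2 * X q u = (\<Sum>b\<in>Basis. component X b q * coord_field b q u)"
  proof cases
    case 1
    have t: "X q \<in> tangent_space q" using vector_field_tangent[OF X] 1 V_subset by blast
    show ?thesis unfolding tangent_expansion[OF t 1] using 1
      by (simp add: component_def coord_field_def sum_distrib_left power2_eq_square mult_ac)
  next
    case 2
    have t: "X q \<in> tangent_space q" using vector_field_tangent[OF X] 2 V_subset by blast
    show ?thesis using tangent_not_smooth[OF t 2(2)] 2 by (simp add: coord_field_def)
  next
    case 3
    then show ?thesis using \<rho>_K[of q] K_V by (auto simp: component_def)
  next
    case 4
    then show ?thesis using vector_field_outside[OF X] by (simp add: component_def)
  qed
qed

lemma \<rho>2_smooth: "smooth_fun M (\<lambda>q. (\<rho> q)\<^sup>2)"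
  unfolding power2_eq_square by (rule smooth_fun_mult[OF \<rho>_smooth \<rho>_smooth])

lemma tangent_\<rho>2:
  assumes "\<tau> \<in> tangent_space q" "q \<in> P"
  shows "\<tau> (\<lambda>x. (\<rho> x)\<^sup>2) = 0"
proof -
  have "\<tau> (\<lambda>x. 1) = \<tau> (\<lambda>x. (\<rho> x)\<^sup>2)"
    by (rule tangent_local[OF assms smooth_fun_const[OF P_open]]) (use \<rho>_P in auto)
  then show ?thesis using tangent_const[OF assms(1), of 1] assms(2) P_M by auto
qed

end

section \<open>Christoffel symbols\<close>

context affine_manifold
begin

lemma nabla_vector_field: "X \<in> vector_fields \<Longrightarrow> Y \<in> vector_fields \<Longrightarrow> nabla X Y \<in> vector_fields"
  using connection by (simp add: connection_def)

lemma nabla_left: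
  assumes "X \<in> vector_fields" "X' \<in> vector_fields" "Y \<in> vector_fields" "smooth_fun M f" "smooth_fun M g"
  shows "nabla (\<lambda>p u. f p * X p u + g p * X' p u) Y = (\<lambda>p u. f p * nabla X Y p u + g p * nabla X' Y p u)"
  using connection assms by (simp add: connection_def)

lemma nabla_right:
  assumes "X \<in> vector_fields" "Y \<in> vector_fields" "Y' \<in> vector_fields"
  shows "nabla X (\<lambda>p u. a * Y p u + b * Y' p u) = (\<lambda>p u. a * nabla X Y p u + b * nabla X Y' p u)"
  using connection assms by (simp add: connection_def)

lemma nabla_right_mult:
  assumes "X \<in> vector_fields" "Y \<in> vector_fields" "smooth_fun M f"
  shows "nabla X (\<lambda>p u. f p * Y p u) = (\<lambda>p u. X p f * Y p u + f p * nabla X Y p u)"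
  using connection assms by (simp add: connection_def)

lemma smooth_fun_M_const: "smooth_fun M (\<lambda>_. c)"
  by (rule smooth_fun_const) simp

lemma nabla_left_mult:
  assumes "X \<in> vector_fields" "Y \<in> vector_fields" "smooth_fun M f"
  shows "nabla (\<lambda>p u. f p * X p u) Y = (\<lambda>p u. f p * nabla X Y p u)"
  using nabla_left[OF assms(1,1,2,3) smooth_fun_M_const[of 0]] by simp

lemma nabla_left_sum:
  assumes Y: "Y \<in> vector_fields"
    and X: "\<And>i. i \<in> I \<Longrightarrow> X i \<in> vector_fields" "\<And>i. i \<in> I \<Longrightarrow> smooth_fun M (f i)" and I: "finite I"
  shows "nabla (\<lambda>p u. \<Sum>i\<in>I. f i p * X i p u) Y = (\<lambda>p u. \<Sum>i\<in>I. f i p * nabla (X i) Y p u)"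
  using I X
proof (induction I rule: finite_induct)
  case empty
  show ?case using nabla_left_mult[OF vector_field_zero Y smooth_fun_M_const[of 0]] by simp
next
  case (insert i I)
  have v: "(\<lambda>p u. \<Sum>i\<in>I. f i p * X i p u) \<in> vector_fields"
    by (rule vector_field_sum) (use insert in auto)
  have "nabla (\<lambda>p u. f i p * X i p u + 1 * (\<Sum>i\<in>I. f i p * X i p u)) Y
      = (\<lambda>p u. f i p * nabla (X i) Y p u + 1 * nabla (\<lambda>p u. \<Sum>i\<in>I. f i p * X i p u) Y p u)"
    by (rule nabla_left[OF _ v Y _ smooth_fun_M_const]) (use insert in auto)
  then show ?case using insert by simp
qed

lemma nabla_right_sum:
  assumes X: "X \<in> vector_fields"
    and Y: "\<And>i. i \<in> I \<Longrightarrow> Y i \<in> vector_fields" "\<And>i. i \<in> I \<Longrightarrow> smooth_fun M (f i)" and I: "finite I"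
  shows "nabla X (\<lambda>p u. \<Sum>i\<in>I. f i p * Y i p u)
      = (\<lambda>p u. \<Sum>i\<in>I. X p (f i) * Y i p u + f i p * nabla X (Y i) p u)"
  using I Y
proof (induction I rule: finite_induct)
  case empty
  show ?case using nabla_right[OF X vector_field_zero vector_field_zero, of 0 0] by simp
next
  case (insert i I)
  have v: "(\<lambda>p u. \<Sum>i\<in>I. f i p * Y i p u) \<in> vector_fields"
    by (rule vector_field_sum) (use insert in auto)
  have w: "(\<lambda>p u. f i p * Y i p u) \<in> vector_fields"
    by (rule vector_field_mult) (use insert in auto)
  have "nabla X (\<lambda>p u. 1 * (f i p * Y i p u) + 1 * (\<Sum>i\<in>I. f i p * Y i p u))
      = (\<lambda>p u. 1 * nabla X (\<lambda>p u. f i p * Y i p u) p u + 1 * nabla X (\<lambda>p u. \<Sum>i\<in>I. f i p * Y i p u) p u)"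
    by (rule nabla_right[OF X w v])
  then show ?case using insert nabla_right_mult[OF X, of "Y i" "f i"] by simp
qed

end

locale affine_chart = affine_manifold M charts nabla + bump_chart M charts V \<phi> \<rho> P K
  for M :: "'a::topological_space set" and charts :: "('a set \<times> ('a \<Rightarrow> real ^ 'n)) set"
    and nabla :: "'a vfield \<Rightarrow> 'a vfield \<Rightarrow> 'a vfield"
    and V :: "'a set" and \<phi> :: "'a \<Rightarrow> real ^ 'n" and \<rho> :: "'a \<Rightarrow> real" and P K :: "'a set"
begin

text \<open>Locality of the connection in its first argument: the square of \<open>\<rho>\<close> is
  1 at \<open>q\<close>, and multiplied by it \<open>X\<close> becomes a global combination of
  coordinate fields, to which linearity over functions applies.\<close>

lemma nabla_left_expansion:
  assumes q: "q \<in> P" and X: "X \<in> vector_fields" and Y: "Y \<in> vector_fields"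
  shows "nabla X Y q u = (\<Sum>b\<in>Basis. component X b q * nabla (coord_field b) Y q u)"
proof -
  have "nabla (\<lambda>q u. (\<rho> q)\<^sup>2 * X q u) Y = (\<lambda>q u. (\<rho> q)\<^sup>2 * nabla X Y q u)"
    by (rule nabla_left_mult[OF X Y \<rho>2_smooth])
  then have "nabla (\<lambda>q u. (\<rho> q)\<^sup>2 * X q u) Y q u = nabla X Y q u"
    using \<rho>_P[OF q] by simp
  moreover have "nabla (\<lambda>q u. \<Sum>b\<in>Basis. component X b q * coord_field b q u) Y
      = (\<lambda>q u. \<Sum>b\<in>Basis. component X b q * nabla (coord_field b) Y q u)"
    by (intro nabla_left_sum Y coord_field_vector_field component_smooth X finite_Basis)
  ultimately show ?thesis unfolding expansion[OF X] by simp
qed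

text \<open>As for the first argument, except that the Leibniz rule also differentiates the square
  of \<open>\<rho>\<close>; that term vanishes because \<open>\<rho>\<close> is constant near points
  of \<open>P\<close>.\<close>

lemma nabla_right_expansion:
  assumes q: "q \<in> P" and X: "X \<in> vector_fields" and Y: "Y \<in> vector_fields"
  shows "nabla X Y q u = (\<Sum>b\<in>Basis. X q (component Y b) * coord_field b q u + component Y b q * nabla X (coord_field b) q u)"
proof -
  have t: "X q \<in> tangent_space q" using vector_field_tangent[OF X] q P_M by blast
  have "nabla X (\<lambda>q u. (\<rho> q)\<^sup>2 * Y q u) = (\<lambda>q u. X q (\<lambda>q. (\<rho> q)\<^sup>2) * Y q u + (\<rho> q)\<^sup>2 * nabla X Y q u)"
    by (rule nabla_right_mult[OF X Y \<rho>2_smooth])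
  then have "nabla X (\<lambda>q u. (\<rho> q)\<^sup>2 * Y q u) q u = nabla X Y q u"
    using \<rho>_P[OF q] tangent_\<rho>2[OF t q] by simp
  moreover have "nabla X (\<lambda>q u. \<Sum>b\<in>Basis. component Y b q * coord_field b q u)
      = (\<lambda>q u. \<Sum>b\<in>Basis. X q (component Y b) * coord_field b q u + component Y b q * nabla X (coord_field b) q u)"
    by (intro nabla_right_sum X coord_field_vector_field component_smooth Y finite_Basis)
  ultimately show ?thesis unfolding expansion[OF Y] by simp
qed

text \<open>On \<open>P\<close> this is the Christoffel symbol with lower indices \<open>v\<close>,
  \<open>w\<close> and upper index \<open>k\<close>. Being a \<open>component\<close> it carries the
  cutoff, and so it is a smooth function on all of \<open>M\<close>.\<close>

definition christoffel :: "real ^ 'n \<Rightarrow> real ^ 'n \<Rightarrow> real ^ 'n \<Rightarrow> 'a \<Rightarrow> real" where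
  "christoffel v w k = component (nabla (coord_field v) (coord_field w)) k"

lemma christoffel_smooth: "smooth_fun M (christoffel v w k)"
  unfolding christoffel_def by (intro component_smooth nabla_vector_field coord_field_vector_field)

lemma christoffel_P: "q \<in> P \<Longrightarrow> christoffel v w k q = nabla (coord_field v) (coord_field w) q (coord k)"
  unfolding christoffel_def by (rule component_P)

lemma nabla_coord_fields:
  assumes "q \<in> P" "smooth_near q u"
  shows "nabla (coord_field v) (coord_field w) q u = (\<Sum>k\<in>Basis. christoffel v w k q * pd k u q)"
proof -
  have "nabla (coord_field v) (coord_field w) q \<in> tangent_space q"
    using assms P_M by (intro vector_field_tangent nabla_vector_field coord_field_vector_field) auto
  from tangent_expansion[OF this _ assms(2)] show ?thesis
    using assms P_V by (auto simp: christoffel_P)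
qed

lemma pd_pd_coord:
  assumes "q \<in> V"
  shows "pd v (pd w (coord k)) q = 0"
proof -
  have "((\<lambda>_. w \<bullet> k) \<circ> \<psi> has_derivative (\<lambda>_. 0)) (at (\<phi> q))" by (simp add: o_def)
  from pd_eqI[OF assms V_open assms _ this, of "pd w (coord k)"] show ?thesis
    by (simp add: pd_coord)
qed

text \<open>Cut off fields need not commute outside \<open>P\<close>, so their bracket cannot be
  treated as the zero field. Torsion-freeness writes it as a combination of vector fields, in the
  shape to which \<open>nabla_left\<close> applies.\<close>

lemma coord_field_bracket:
  "lie_bracket (coord_field v) (coord_field w) = (\<lambda>p u. 1 * nabla (coord_field v) (coord_field w) p u + (- 1) * nabla (coord_field w) (coord_field v) p u)"
proof -
  have "torsion nabla (coord_field v) (coord_field w) = (\<lambda>p u. 0)"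
    using torsion_free coord_field_vector_field by (simp add: torsion_free_def)
  then show ?thesis unfolding torsion_def by (simp add: fun_eq_iff)
qed

text \<open>The bracket annihilates the coordinate functions on \<open>P\<close>, because their
  second partial derivatives vanish.\<close>

lemma christoffel_sym:
  assumes "q \<in> P"
  shows "christoffel v w k q = christoffel w v k q"
proof -
  have q: "q \<in> V" using assms P_V by blast
  have "lie_bracket (coord_field v) (coord_field w) q (coord k) = 0"
    using smooth_near_coord[OF q] coord_field_coord_field[OF assms smooth_near_coord[OF q]] pd_pd_coord[OF q]
    by (simp add: lie_bracket_def)
  then show ?thesis using christoffel_P[OF assms] unfolding coord_field_bracket by simp
qed

lemma coord_field_coord: "q \<in> P \<Longrightarrow> coord_field v q (coord b) = v \<bullet> b"
  using coord_field_P smooth_near_coord pd_coord P_V by auto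

text \<open>The coefficient with index \<open>m\<close> of the curvature of the fields in directions
  \<open>l\<close>, \<open>i\<close>, applied to the field in direction \<open>j\<close>.\<close>

lemma curvature_identity:
  assumes q: "q \<in> P" and m: "m \<in> Basis"
  shows "pd l (christoffel i j m) q + (\<Sum>k\<in>Basis. christoffel i j k q * christoffel l k m q)
    = pd i (christoffel l j m) q + (\<Sum>k\<in>Basis. christoffel l j k q * christoffel i k m q)"
proof -
  have vf: "nabla (coord_field v) (coord_field w) \<in> vector_fields" for v w by (intro nabla_vector_field coord_field_vector_field)
  have qV: "q \<in> V" using q P_V by blast
  have sn: "smooth_near q (christoffel v w k)" for v w k
    by (rule smooth_nearI[OF christoffel_smooth]) (use q P_M in auto)
  \<comment> \<open>The bracket is under control only on \<open>P\<close>. Expanding the first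
    argument of \<open>nabla\<close> at \<open>q\<close> uses just the components there, which agree
    by \<open>christoffel_sym\<close>.\<close>
  have "nabla (lie_bracket (coord_field l) (coord_field i)) (coord_field j) q (coord m) = nabla (nabla (coord_field l) (coord_field i)) (coord_field j) q (coord m) - nabla (nabla (coord_field i) (coord_field l)) (coord_field j) q (coord m)"
    unfolding coord_field_bracket by (subst nabla_left[OF vf vf coord_field_vector_field smooth_fun_M_const smooth_fun_M_const]) simp
  also have "\<dots> = 0"
    unfolding nabla_left_expansion[OF q vf coord_field_vector_field] christoffel_def[symmetric]
    by (simp add: christoffel_sym[OF q, of l i])
  finally have b0: "nabla (lie_bracket (coord_field l) (coord_field i)) (coord_field j) q (coord m) = 0" .
  have t: "nabla (coord_field l) (nabla (coord_field i) (coord_field j)) q (coord m)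
      = pd l (christoffel i j m) q + (\<Sum>k\<in>Basis. christoffel i j k q * christoffel l k m q)" for l i
  proof -
    have "nabla (coord_field l) (nabla (coord_field i) (coord_field j)) q (coord m) =
        (\<Sum>k\<in>Basis. pd l (christoffel i j k) q * (k \<bullet> m) + christoffel i j k q * christoffel l k m q)"
      unfolding nabla_right_expansion[OF q coord_field_vector_field vf] christoffel_def[symmetric]
      by (simp add: coord_field_P[OF q sn] coord_field_coord[OF q] christoffel_P[OF q])
    also have "\<dots> = (\<Sum>k\<in>Basis. if k = m then pd l (christoffel i j k) q else 0) + (\<Sum>k\<in>Basis. christoffel i j k q * christoffel l k m q)"
    proof -
      have "(\<Sum>k\<in>Basis. pd l (christoffel i j k) q * (k \<bullet> m)) = (\<Sum>k\<in>Basis. if k = m then pd l (christoffel i j k) q else 0)"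
        by (rule sum.cong) (use m in \<open>auto simp: inner_Basis\<close>)
      then show ?thesis unfolding sum.distrib by simp
    qed
    finally show ?thesis using m by simp
  qed
  have "curvature nabla (coord_field l) (coord_field i) (coord_field j) = (\<lambda>p u. 0)"
    using flat coord_field_vector_field by (simp add: flat_def)
  then have "nabla (coord_field l) (nabla (coord_field i) (coord_field j)) q (coord m) - nabla (coord_field i) (nabla (coord_field l) (coord_field j)) q (coord m)
     - nabla (lie_bracket (coord_field l) (coord_field i)) (coord_field j) q (coord m) = 0"
    unfolding curvature_def by meson
  then show ?thesis unfolding b0 t by simp
qed

section \<open>The Hessian of a function in coordinates\<close>

lemma nabla_d_coord_fields:
  assumes "q \<in> P" "smooth_near q f"
  shows "nabla_d nabla f (coord_field v) (coord_field w) q = pd v (pd w f) q - (\<Sum>k\<in>Basis. christoffel v w k q * pd k f q)"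
  unfolding nabla_d_def by (simp add: coord_field_coord_field[OF assms] nabla_coord_fields[OF assms])

lemma nabla_d_left_expansion:
  assumes q: "q \<in> P" and f: "smooth_near q f" and X: "X \<in> vector_fields" and Y: "Y \<in> vector_fields"
  shows "nabla_d nabla f X Y q = (\<Sum>a\<in>Basis. component X a q * nabla_d nabla f (coord_field a) Y q)"
proof -
  have qV: "q \<in> V" using q P_V by blast
  have t: "X q \<in> tangent_space q" using vector_field_tangent[OF X] q P_M by blast
  have s: "smooth_near q (\<lambda>x. Y x f)" by (rule vector_field_smooth_near[OF Y f])
  have "X q (\<lambda>x. Y x f) = (\<Sum>a\<in>Basis. component X a q * coord_field a q (\<lambda>x. Y x f))"
    unfolding tangent_expansion[OF t qV s] by (simp add: component_P[OF q] coord_field_P[OF q s])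
  then show ?thesis
    unfolding nabla_d_def nabla_left_expansion[OF q X Y] by (simp add: sum_subtractf right_diff_distrib)
qed

text \<open>The derivatives of the components of \<open>Y\<close> occur both in
  \<open>X (Y f)\<close> and in the covariant derivative applied to \<open>f\<close>, and they
  cancel. This is why the Hessian is a tensor in \<open>Y\<close> although neither term is.\<close>

lemma nabla_d_right_expansion:
  assumes q: "q \<in> P" and f: "smooth_near q f" and X: "X \<in> vector_fields" and Y: "Y \<in> vector_fields"
  shows "nabla_d nabla f X Y q = (\<Sum>b\<in>Basis. component Y b q * nabla_d nabla f X (coord_field b) q)"
proof -
  have qM: "q \<in> M" using q P_M by blast
  have t: "X q \<in> tangent_space q" using vector_field_tangent[OF X] qM by blast
  obtain U where U: "q \<in> U" "smooth_fun U f" using f by (auto simp: smooth_near_def)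
  have o: "openin (top_of_set M) (U \<inter> P)" by (rule openin_Int[OF smooth_fun_openin[OF U(2)] P_open])
  have c: "smooth_near q (component Y b)" for b by (rule smooth_nearI[OF component_smooth[OF Y] qM])
  have e: "smooth_near q (\<lambda>x. coord_field b x f)" for b by (rule vector_field_smooth_near[OF coord_field_vector_field f])
  have eq: "Y x f = (\<Sum>b\<in>Basis. component Y b x * coord_field b x f)" if "x \<in> U \<inter> P" for x
  proof -
    have "(\<rho> x)\<^sup>2 * Y x f = (\<Sum>b\<in>Basis. component Y b x * coord_field b x f)"
      using expansion[OF Y] by meson
    then show ?thesis using that \<rho>_P by simp
  qed
  have "X q (\<lambda>x. Y x f) = X q (\<lambda>x. \<Sum>b\<in>Basis. component Y b x * coord_field b x f)"
    by (rule tangent_local[OF t _ smooth_fun_subset[OF vector_field_smooth[OF Y U(2)] o] eq]) (use U q in auto)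
  also have "\<dots> = (\<Sum>b\<in>Basis. X q (\<lambda>x. component Y b x * coord_field b x f))"
    by (rule tangent_sum[OF t qM smooth_near_mult[OF c e]])
  also have "\<dots> = (\<Sum>b\<in>Basis. X q (component Y b) * coord_field b q f + component Y b q * X q (\<lambda>x. coord_field b x f))"
    using tangent_mult[OF t c e] by simp
  finally show ?thesis
    unfolding nabla_d_def nabla_right_expansion[OF q X Y] 
    by (simp add: sum_subtractf[symmetric] algebra_simps)
qed

end

section \<open>Parallel functions in a chart\<close>

lemma blinfun_of_bilinear:
  fixes B :: "'a::euclidean_space \<Rightarrow> 'b::euclidean_space \<Rightarrow> 'c::euclidean_space"
  assumes "bilinear B"
  obtains T :: "'a \<Rightarrow>\<^sub>L 'b \<Rightarrow>\<^sub>L 'c" where "\<And>v u. T v u = B v u"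
proof -
  have b: "bounded_bilinear B" using assms by (simp add: bilinear_conv_bounded_bilinear)
  show thesis
  proof (rule that[of "Blinfun (bounded_bilinear.prod_right B)"])
    show "Blinfun (bounded_bilinear.prod_right B) v u = B v u" for v u
      by (simp add: bounded_linear_Blinfun_apply[OF bounded_bilinear.bounded_linear_prod_right[OF b]]
        bounded_bilinear.prod_right.rep_eq[OF b])
  qed
qed

lemma linear_system_subset:
  assumes "linear_system A A' S C D C'" "T \<subseteq> S" "convex T" "open T"
  shows "linear_system A A' T C D C'"
proof -
  interpret linear_system A A' S C D C' by fact
  show ?thesis
  proof unfold_locales
    show "norm (x - y) \<le> D" if "x \<in> T" "y \<in> T" for x y using diam[of x y] assms(2) that by blast
    show "norm (A x) \<le> C" "(A has_derivative A' x) (at x)" "norm (A' x w) \<le> C' * norm w" if "x \<in> T" for x w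
      using norm_A deriv_A norm_A' assms(2) that by blast+
    show "continuous_on T (\<lambda>x. A' x w)" for w using cont_A' assms(2) by (rule continuous_on_subset)
  qed (use assms(3,4) CD in auto)
qed

lemma linear_system_exists:
  fixes A :: "'a::euclidean_space \<Rightarrow> 'a \<Rightarrow>\<^sub>L ('b::euclidean_space \<Rightarrow>\<^sub>L 'b)"
  assumes U: "open U" "c \<in> U" and dA: "\<And>x. x \<in> U \<Longrightarrow> (A has_derivative A' x) (at x)"
    and cA': "\<And>w. continuous_on U (\<lambda>x. A' x w)"
  obtains r C D C' where "r > 0" "ball c r \<subseteq> U" "linear_system A A' (ball c r) C D C'"
proof -
  obtain R where R: "R > 0" "cball c R \<subseteq> U" using U open_contains_cball by blast
  have cA: "continuous_on U A"
    using dA by (rule has_derivative_imp_continuous_on)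
  have bound: "\<exists>B\<ge>0. \<forall>x\<in>cball c R. norm (F x) \<le> B" if "continuous_on U F" for F :: "'a \<Rightarrow> 'a \<Rightarrow>\<^sub>L ('b \<Rightarrow>\<^sub>L 'b)"
  proof -
    have "compact (F ` cball c R)"
      using that R(2) by (intro compact_continuous_image) (auto intro: continuous_on_subset)
    then obtain B where "\<forall>y\<in>F ` cball c R. norm y \<le> B" using compact_imp_bounded bounded_iff by metis
    moreover have "norm (F c) \<ge> 0" by simp
    ultimately show ?thesis using R(1) by (intro exI[of _ B]) (auto intro: order_trans[of 0 "norm (F c)"])
  qed
  obtain C where C: "C \<ge> 0" "\<And>x. x \<in> cball c R \<Longrightarrow> norm (A x) \<le> C" using bound[OF cA] by blast
  have "\<exists>B. \<forall>w. B w \<ge> 0 \<and> (\<forall>x\<in>cball c R. norm (A' x w) \<le> B w)"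
    using bound[OF cA'] by metis
  then obtain B where B: "\<And>w. B w \<ge> 0" "\<And>x w. x \<in> cball c R \<Longrightarrow> norm (A' x w) \<le> B w" by blast
  \<comment> \<open>\<open>A' x\<close> is linear, so bounds in the basis directions add up to a
    bound in all directions.\<close>
  define C' where "C' = (\<Sum>b\<in>Basis. B b)"
  \<comment> \<open>The ball has diameter at most \<open>2 * r\<close>, and
    \<open>C * (2 * r)\<close> is at most \<open>C / (2 * (C + 1))\<close>, hence at most 1/2. The
    summand 1 covers the case \<open>C = 0\<close>.\<close>
  define r where "r = min R (1 / (4 * (C + 1)))"
  have r: "r > 0" "r \<le> R" "2 * r \<le> 1 / (2 * (C + 1))"
    using R(1) C(1) by (auto simp: r_def min_def field_simps)
  have "C * (2 * r) \<le> C * (1 / (2 * (C + 1)))" by (rule mult_left_mono[OF r(3) C(1)])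
  also have "\<dots> \<le> 1/2" using C(1) by (simp add: field_simps)
  finally have Cr: "C * (2 * r) \<le> 1/2" .
  have sub: "ball c r \<subseteq> cball c R" "ball c r \<subseteq> U" using r(2) R(2) by auto
  have A': "norm (A' x w) \<le> C' * norm w" if x: "x \<in> cball c R" for x w
  proof -
    have "x \<in> U" using x R(2) by blast
    from has_derivative_linear[OF dA[OF this]] have l: "linear (A' x)" .
    have "A' x w = (\<Sum>b\<in>Basis. (w \<bullet> b) *\<^sub>R A' x b)" by (rule linear_basis_sum[OF l])
    then have "norm (A' x w) \<le> (\<Sum>b\<in>Basis. norm ((w \<bullet> b) *\<^sub>R A' x b))" using norm_sum by metis
    also have "\<dots> \<le> (\<Sum>b\<in>Basis. B b * norm w)"
    proof (rule sum_mono)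
      fix b :: 'a assume "b \<in> Basis"
      then have "\<bar>w \<bullet> b\<bar> * norm (A' x b) \<le> norm w * B b"
        using B(2)[OF x, of b] B(1)[of b] by (intro mult_mono Basis_le_norm) auto
      then show "norm ((w \<bullet> b) *\<^sub>R A' x b) \<le> B b * norm w" by (simp add: mult.commute)
    qed
    finally show ?thesis by (simp add: C'_def sum_distrib_right)
  qed
  have "linear_system A A' (ball c r) C (2 * r) C'"
  proof unfold_locales
    show "norm (x - y) \<le> 2 * r" if "x \<in> ball c r" "y \<in> ball c r" for x y
      using that dist_triangle[of x y c] by (simp add: dist_norm[symmetric] dist_commute)
    show "0 \<le> C'" unfolding C'_def by (intro sum_nonneg B)
    show "continuous_on (ball c r) (\<lambda>x. A' x w)" for w using cA' sub(2) by (rule continuous_on_subset)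
  qed (use C r Cr A' sub dA in auto)
  then show thesis using that r(1) sub(2) by blast
qed

text \<open>\<open>G v\<close> is the second derivative along \<open>v\<close>. If it were positive,
  the first derivative along \<open>v\<close>, zero at \<open>c\<close>, would be positive just
  beyond \<open>c\<close>, and by the mean value theorem \<open>f\<close> would exceed
  \<open>f c\<close> there.\<close>

lemma smooth_maximum_second_derivative:
  fixes f :: "'a::euclidean_space \<Rightarrow> real"
  assumes S: "open S" "c \<in> S" and f: "\<And>x. x \<in> S \<Longrightarrow> (f has_derivative F x) (at x)"
    and F: "((\<lambda>x. F x v) has_derivative G) (at c)" and max: "\<And>x. x \<in> S \<Longrightarrow> f x \<le> f c"
  shows "F c w = 0" "G v \<le> 0"
proof -
  have F0: "F c = (\<lambda>_. 0)"
    by (rule differential_zero_maxmin[OF S(2,1) f[OF S(2)]]) (use max in auto)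
  then show "F c w = 0" by simp
  show "G v \<le> 0"
  proof (rule ccontr)
    assume "\<not> G v \<le> 0"
    then have pos: "G v > 0" by simp
    let ?l = "\<lambda>s::real. c + s *\<^sub>R v"
    have dl: "(?l has_derivative (\<lambda>s. s *\<^sub>R v)) (at s)" for s by (auto intro!: derivative_eq_intros)
    have "((\<lambda>s. F (?l s) v) has_derivative (\<lambda>s. G (s *\<^sub>R v))) (at 0)"
      by (rule has_derivative_compose[OF dl]) (use F in simp)
    moreover have "G (s *\<^sub>R v) = G v * s" for s
      using linear_scale[OF has_derivative_linear[OF F]] by simp
    ultimately have "((\<lambda>s. F (?l s) v) has_real_derivative G v) (at 0)"
      by (simp add: has_field_derivative_def)
    from DERIV_pos_inc_right[OF this pos] obtain d where d: "d > 0" "\<And>s. 0 < s \<Longrightarrow> s < d \<Longrightarrow> 0 < F (?l s) v"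
      using F0 by auto
    have "open (?l -` S)" by (intro open_vimage S continuous_intros)
    moreover have "0 \<in> ?l -` S" using S by simp
    ultimately obtain e where e: "e > 0" "ball 0 e \<subseteq> ?l -` S" using open_contains_ball by blast
    define s where "s = min d e / 2"
    have s: "0 < s" "s < d" "s < e" using d(1) e(1) by (auto simp: s_def)
    have inS: "?l t \<in> S" if "0 \<le> t" "t \<le> s" for t using that s e(2) by (auto simp: subset_iff dist_real_def)
    have df: "((\<lambda>s. f (?l s)) has_real_derivative F (?l t) v) (at t)" if "0 \<le> t" "t \<le> s" for t
    proof -
      have "((\<lambda>s. f (?l s)) has_derivative (\<lambda>s. F (?l t) (s *\<^sub>R v))) (at t)"
        by (rule has_derivative_compose[OF dl f[OF inS[OF that]]])
      then show ?thesis
        using linear_scale[OF has_derivative_linear[OF f[OF inS[OF that]]]]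
        by (simp add: has_field_derivative_def mult.commute[of _ "F (?l t) v"] mult_commute_abs)
    qed
    obtain z where z: "0 < z" "z < s" "f (?l s) - f (?l 0) = (s - 0) * F (?l z) v"
      using MVT2[OF s(1) df] by auto
    have "(s - 0) * F (?l z) v > 0" using z d(2)[of z] s by simp
    then show False using z(3) max[OF inS[of s]] s by simp
  qed
qed

lemma sum_snd_Basis:
  fixes c :: "'a::euclidean_space \<Rightarrow> 'a \<Rightarrow> 'a \<Rightarrow> real"
  assumes "j \<in> Basis"
  shows "(\<Sum>i\<in>Basis. \<Sum>j'\<in>Basis. \<Sum>k\<in>Basis. c i j' k * (((v \<bullet> i) * (a \<bullet> k)) *\<^sub>R j' \<bullet> j))
    = (\<Sum>i\<in>Basis. \<Sum>k\<in>Basis. (v \<bullet> i) * c i j k * (a \<bullet> k))"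
proof -
  have "(\<Sum>j'\<in>Basis. \<Sum>k\<in>Basis. c i j' k * (((v \<bullet> i) * (a \<bullet> k)) *\<^sub>R j' \<bullet> j))
    = (\<Sum>j'\<in>Basis. if j' = j then \<Sum>k\<in>Basis. (v \<bullet> i) * c i j k * (a \<bullet> k) else 0)" for i
    by (rule sum.cong[OF refl]) (use assms in \<open>auto simp: inner_Basis intro!: sum.cong\<close>)
  then show ?thesis using assms by simp
qed

context affine_chart
begin

definition christoffel_coord :: "real ^ 'n \<Rightarrow> real ^ 'n \<Rightarrow> real ^ 'n \<Rightarrow> real ^ 'n \<Rightarrow> real" where
  "christoffel_coord i j k x = christoffel i j k (\<psi> x)"

lemma \<psi>_P: "x \<in> \<phi> ` P \<Longrightarrow> \<psi> x \<in> P"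
  using P_V \<psi>_\<phi> by auto

lemma \<phi>_\<psi>_P: "x \<in> \<phi> ` P \<Longrightarrow> \<phi> (\<psi> x) = x"
  using P_V \<psi>_\<phi> by auto

lemma christoffel_coord_smooth: "smooth_on (\<phi> ` P) (christoffel_coord i j k)"
proof -
  have "smooth_on (\<phi> ` (M \<inter> V)) (christoffel i j k \<circ> \<psi>)"
    by (rule smooth_funD[OF christoffel_smooth chart])
  then have "smooth_on (\<phi> ` P) (christoffel i j k \<circ> \<psi>)"
    by (rule smooth_on_subset) (use P_V V_subset in auto)
  then show ?thesis by (simp add: o_def christoffel_coord_def[abs_def])
qed

lemma christoffel_coord_derivative:
  assumes x: "x \<in> \<phi> ` P"
  shows "(christoffel_coord i j k has_derivative (\<lambda>v. pd v (christoffel i j k) (\<psi> x))) (at x)"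
proof -
  have "\<psi> x \<in> V" "smooth_near (\<psi> x) (christoffel i j k)"
    using \<psi>_P[OF x] P_V P_M smooth_nearI[OF christoffel_smooth] by auto
  from pd_has_derivative[OF this(2,1)] show ?thesis
    by (simp add: \<phi>_\<psi>_P[OF x] o_def christoffel_coord_def[abs_def])
qed

text \<open>The equations \<open>df = \<alpha>\<close>, \<open>\<nabla>\<alpha> = 0\<close> for a pair \<open>(f, \<alpha>)\<close> as a linear system in coordinates.\<close>

definition gradient_term :: "(real ^ 'n) \<Rightarrow>\<^sub>L (real \<times> (real ^ 'n)) \<Rightarrow>\<^sub>L (real \<times> (real ^ 'n))" where
  "gradient_term = (SOME T. \<forall>v u. blinfun_apply (blinfun_apply T v) u = (snd u \<bullet> v, 0))"

definition christoffel_term :: "real ^ 'n \<Rightarrow> real ^ 'n \<Rightarrow> real ^ 'n \<Rightarrow> (real ^ 'n) \<Rightarrow>\<^sub>L (real \<times> (real ^ 'n)) \<Rightarrow>\<^sub>L (real \<times> (real ^ 'n))" where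
  "christoffel_term i j k = (SOME T. \<forall>v u. blinfun_apply (blinfun_apply T v) u = (0, ((v \<bullet> i) * (snd u \<bullet> k)) *\<^sub>R j))"

lemma gradient_term_apply: "gradient_term v u = (snd u \<bullet> v, 0)"
proof -
  have "bilinear (\<lambda>(v :: real ^ 'n) (u :: real \<times> (real ^ 'n)). (snd u \<bullet> v, 0 :: real ^ 'n))"
    by (auto simp: bilinear_def inner_simps intro!: linearI)
  then have "\<exists>T :: (real ^ 'n) \<Rightarrow>\<^sub>L (real \<times> (real ^ 'n)) \<Rightarrow>\<^sub>L (real \<times> (real ^ 'n)). \<forall>v u. T v u = (snd u \<bullet> v, 0)"
    by (rule blinfun_of_bilinear) blast
  from someI_ex[OF this] show ?thesis unfolding gradient_term_def by blast
qed

lemma christoffel_term_apply: "christoffel_term i j k v u = (0, ((v \<bullet> i) * (snd u \<bullet> k)) *\<^sub>R j)"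
proof -
  have "bilinear (\<lambda>(v :: real ^ 'n) (u :: real \<times> (real ^ 'n)). (0 :: real, ((v \<bullet> i) * (snd u \<bullet> k)) *\<^sub>R j))"
    by (auto simp: bilinear_def inner_simps algebra_simps intro!: linearI)
  then have "\<exists>T :: (real ^ 'n) \<Rightarrow>\<^sub>L (real \<times> (real ^ 'n)) \<Rightarrow>\<^sub>L (real \<times> (real ^ 'n)). \<forall>v u. T v u = (0, ((v \<bullet> i) * (snd u \<bullet> k)) *\<^sub>R j)"
    by (rule blinfun_of_bilinear) blast
  from someI_ex[OF this] show ?thesis unfolding christoffel_term_def by blast
qed

text \<open>For a pair \<open>(f, \<alpha>)\<close> with coefficients \<open>\<alpha>_j\<close> this
  reads \<open>\<partial>_i f = \<alpha>_i\<close> and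
  \<open>\<partial>_i \<alpha>_j = \<Sum>k. \<Gamma>_ij^k \<alpha>_k\<close>; the second line is
  \<open>\<nabla>\<alpha> = 0\<close>.\<close>

definition parallel_system where
  "parallel_system x = gradient_term + (\<Sum>i\<in>Basis. \<Sum>j\<in>Basis. \<Sum>k\<in>Basis. christoffel_coord i j k x *\<^sub>R christoffel_term i j k)"

definition parallel_system' where
  "parallel_system' x w = (\<Sum>i\<in>Basis. \<Sum>j\<in>Basis. \<Sum>k\<in>Basis. pd w (christoffel i j k) (\<psi> x) *\<^sub>R christoffel_term i j k)"

lemma parallel_system_fst: "fst (parallel_system x v u) = snd u \<bullet> v"
  by (simp add: parallel_system_def blinfun.add_left blinfun.sum_left blinfun.scaleR_left gradient_term_apply christoffel_term_apply fst_sum)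

lemma parallel_system_snd:
  assumes "j \<in> Basis"
  shows "snd (parallel_system x v u) \<bullet> j = (\<Sum>i\<in>Basis. \<Sum>k\<in>Basis. (v \<bullet> i) * christoffel_coord i j k x * (snd u \<bullet> k))"
proof -
  have "snd (parallel_system x v u) \<bullet> j = (\<Sum>i\<in>Basis. \<Sum>j'\<in>Basis. \<Sum>k\<in>Basis.
      christoffel_coord i j' k x * (((v \<bullet> i) * (snd u \<bullet> k)) *\<^sub>R j' \<bullet> j))"
    by (simp add: parallel_system_def blinfun.add_left blinfun.sum_left blinfun.scaleR_left gradient_term_apply christoffel_term_apply snd_sum inner_sum_left mult.assoc)
  then show ?thesis by (simp only: sum_snd_Basis[OF assms])
qed

lemma parallel_system'_fst: "fst (parallel_system' x w v u) = 0"
  by (simp add: parallel_system'_def blinfun.sum_left blinfun.scaleR_left christoffel_term_apply fst_sum)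

lemma parallel_system'_snd:
  assumes "j \<in> Basis"
  shows "snd (parallel_system' x w v u) \<bullet> j =
    (\<Sum>i\<in>Basis. \<Sum>k\<in>Basis. (v \<bullet> i) * pd w (christoffel i j k) (\<psi> x) * (snd u \<bullet> k))"
proof -
  have "snd (parallel_system' x w v u) \<bullet> j = (\<Sum>i\<in>Basis. \<Sum>j'\<in>Basis. \<Sum>k\<in>Basis.
      pd w (christoffel i j' k) (\<psi> x) * (((v \<bullet> i) * (snd u \<bullet> k)) *\<^sub>R j' \<bullet> j))"
    by (simp add: parallel_system'_def blinfun.sum_left blinfun.scaleR_left christoffel_term_apply snd_sum inner_sum_left mult.assoc)
  then show ?thesis by (simp only: sum_snd_Basis[OF assms])
qed

lemma parallel_system_derivative: "x \<in> \<phi> ` P \<Longrightarrow> (parallel_system has_derivative parallel_system' x) (at x)"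
  unfolding parallel_system_def[abs_def] parallel_system'_def[abs_def]
  by (auto intro!: derivative_eq_intros christoffel_coord_derivative)

lemma parallel_system'_continuous: "continuous_on (\<phi> ` P) (\<lambda>x. parallel_system' x w)"
proof -
  have "continuous_on (\<phi> ` P) (\<lambda>x. pd w (christoffel i j k) (\<psi> x))" for i j k
  proof -
    have "continuous_on (\<phi> ` P) (\<lambda>x. frechet_derivative (christoffel_coord i j k) (at x) w)"
      by (rule smooth_on_imp_continuous_on[OF smooth_on_frechet_derivative[OF christoffel_coord_smooth]])
    then show ?thesis
      by (rule continuous_on_eq) (simp add: frechet_derivative_at[OF christoffel_coord_derivative, symmetric])
  qed
  then show ?thesis unfolding parallel_system'_def by (intro continuous_intros)
qed

text \<open>The first component is the symmetry of the Christoffel symbols, hence torsion-freeness;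
  the second is \<open>curvature_identity\<close>, hence flatness. All else is reordering of
  sums.\<close>

lemma parallel_system_integrable:
  assumes x: "x \<in> \<phi> ` P"
  shows "parallel_system' x w v u + parallel_system x v (parallel_system x w u) = parallel_system' x v w u + parallel_system x w (parallel_system x v u)"
proof (rule prod_eqI)
  let ?q = "\<psi> x"
  have q: "?q \<in> P" by (rule \<psi>_P[OF x])
  have f: "fst (parallel_system x v (parallel_system x w u)) = (\<Sum>j\<in>Basis. \<Sum>i\<in>Basis. \<Sum>k\<in>Basis. (v \<bullet> j) * (w \<bullet> i) * christoffel_coord i j k x * (snd u \<bullet> k))" for v w
  proof -
    have "fst (parallel_system x v (parallel_system x w u)) = (\<Sum>j\<in>Basis. (snd (parallel_system x w u) \<bullet> j) * (v \<bullet> j))"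
      unfolding parallel_system_fst by (rule euclidean_inner)
    also have "\<dots> = (\<Sum>j\<in>Basis. \<Sum>i\<in>Basis. \<Sum>k\<in>Basis. (v \<bullet> j) * (w \<bullet> i) * christoffel_coord i j k x * (snd u \<bullet> k))"
      by (rule sum.cong[OF refl]) (simp add: parallel_system_snd sum_distrib_left sum_distrib_right mult_ac)
    finally show ?thesis .
  qed
  have "fst (parallel_system x v (parallel_system x w u)) = fst (parallel_system x w (parallel_system x v u))"
    unfolding f by (subst sum.swap) (simp add: christoffel_coord_def christoffel_sym[OF q] mult_ac)
  then show "fst (parallel_system' x w v u + parallel_system x v (parallel_system x w u)) = fst (parallel_system' x v w u + parallel_system x w (parallel_system x v u))"
    by (simp add: parallel_system'_fst)
  have s: "snd (parallel_system' x w v u + parallel_system x v (parallel_system x w u)) \<bullet> j = (\<Sum>i\<in>Basis. \<Sum>l\<in>Basis. \<Sum>m\<in>Basis.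
      (v \<bullet> i) * (w \<bullet> l) * (snd u \<bullet> m) * (pd l (christoffel i j m) ?q + (\<Sum>k\<in>Basis. christoffel i j k ?q * christoffel l k m ?q)))"
    if j: "j \<in> Basis" for v w j
  proof -
    have p: "pd w (christoffel i j m) ?q = (\<Sum>l\<in>Basis. (w \<bullet> l) * pd l (christoffel i j m) ?q)" for i m
      by (rule pd_basis) (use q P_V P_M smooth_nearI[OF christoffel_smooth] in auto)
    have 1: "snd (parallel_system' x w v u) \<bullet> j = (\<Sum>i\<in>Basis. \<Sum>l\<in>Basis. \<Sum>m\<in>Basis.
      (v \<bullet> i) * (w \<bullet> l) * (snd u \<bullet> m) * pd l (christoffel i j m) ?q)"
      unfolding parallel_system'_snd[OF j] p
      by (rule sum.cong[OF refl], subst sum.swap) (simp add: sum_distrib_left sum_distrib_right mult_ac)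
    have 2: "snd (parallel_system x v (parallel_system x w u)) \<bullet> j = (\<Sum>i\<in>Basis. \<Sum>l\<in>Basis. \<Sum>m\<in>Basis.
      (v \<bullet> i) * (w \<bullet> l) * (snd u \<bullet> m) * (\<Sum>k\<in>Basis. christoffel i j k ?q * christoffel l k m ?q))"
    proof -
      have "snd (parallel_system x v (parallel_system x w u)) \<bullet> j = (\<Sum>i\<in>Basis. \<Sum>k\<in>Basis. \<Sum>l\<in>Basis. \<Sum>m\<in>Basis.
          (v \<bullet> i) * (w \<bullet> l) * (snd u \<bullet> m) * (christoffel i j k ?q * christoffel l k m ?q))"
        unfolding parallel_system_snd[OF j] by (intro sum.cong refl) (simp add: parallel_system_snd christoffel_coord_def sum_distrib_left mult_ac)
      also have "\<dots> = (\<Sum>i\<in>Basis. \<Sum>l\<in>Basis. \<Sum>m\<in>Basis. \<Sum>k\<in>Basis.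
          (v \<bullet> i) * (w \<bullet> l) * (snd u \<bullet> m) * (christoffel i j k ?q * christoffel l k m ?q))"
        by (rule sum.cong[OF refl], subst sum.swap, rule sum.cong[OF refl], rule sum.swap)
      finally show ?thesis by (simp add: sum_distrib_left)
    qed
    show ?thesis unfolding snd_add inner_add_left 1 2 by (simp add: sum.distrib[symmetric] distrib_left)
  qed
  show "snd (parallel_system' x w v u + parallel_system x v (parallel_system x w u)) = snd (parallel_system' x v w u + parallel_system x w (parallel_system x v u))"
  proof (rule euclidean_eqI)
    fix j :: "real ^ 'n" assume j: "j \<in> Basis"
    show "snd (parallel_system' x w v u + parallel_system x v (parallel_system x w u)) \<bullet> j = snd (parallel_system' x v w u + parallel_system x w (parallel_system x v u)) \<bullet> j"
      unfolding s[OF j]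
      by (subst sum.swap) (intro sum.cong refl, simp add: curvature_identity[OF q] mult_ac)
  qed
qed

end

section \<open>Local potentials of a Hessian metric\<close>

context affine_chart
begin

definition jet :: "('a \<Rightarrow> real) \<Rightarrow> real ^ 'n \<Rightarrow> real \<times> (real ^ 'n)" where
  "jet f x = (f (\<psi> x), \<Sum>b\<in>Basis. pd b f (\<psi> x) *\<^sub>R b)"

lemma snd_jet: "b \<in> Basis \<Longrightarrow> snd (jet f x) \<bullet> b = pd b f (\<psi> x)"
  by (simp add: jet_def)

text \<open>The equation for a potential is inhomogeneous, but in a difference of two solutions the
  common right-hand side drops out, and the difference of the jets satisfies the homogeneous
  parallel system.\<close>

lemma jet_diff_derivative:
  assumes x: "x \<in> \<phi> ` P" and f: "smooth_near (\<psi> x) f" "smooth_near (\<psi> x) g"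
    and eq: "\<And>a b. a \<in> Basis \<Longrightarrow> b \<in> Basis \<Longrightarrow> nabla_d nabla f (coord_field a) (coord_field b) (\<psi> x) = nabla_d nabla g (coord_field a) (coord_field b) (\<psi> x)"
  shows "((\<lambda>x. jet f x - jet g x) has_derivative (\<lambda>v. parallel_system x v (jet f x - jet g x))) (at x)"
proof -
  let ?q = "\<psi> x"
  have q: "?q \<in> P" "?q \<in> V" using \<psi>_P[OF x] P_V by auto
  have d: "((\<lambda>x. k (\<psi> x)) has_derivative (\<lambda>v. pd v k ?q)) (at x)" if "smooth_near ?q k" for k
    using pd_has_derivative[OF that q(2)] by (simp add: \<phi>_\<psi>_P[OF x] o_def)
  have dj: "(jet k has_derivative (\<lambda>v. (pd v k ?q, \<Sum>b\<in>Basis. pd v (pd b k) ?q *\<^sub>R b))) (at x)"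
    if k: "smooth_near ?q k" for k
    unfolding jet_def[abs_def]
    by (intro has_derivative_Pair has_derivative_sum has_derivative_scaleR_left d k pd_smooth_near q)
  have "(pd v f ?q, \<Sum>b\<in>Basis. pd v (pd b f) ?q *\<^sub>R b) - (pd v g ?q, \<Sum>b\<in>Basis. pd v (pd b g) ?q *\<^sub>R b)
      = parallel_system x v (jet f x - jet g x)" (is "?l = ?r") for v
  proof (rule prod_eqI)
    have "fst ?r = (\<Sum>b\<in>Basis. (snd (jet f x - jet g x) \<bullet> b) * (v \<bullet> b))"
      unfolding parallel_system_fst by (rule euclidean_inner)
    also have "\<dots> = (\<Sum>b\<in>Basis. (v \<bullet> b) * pd b f ?q) - (\<Sum>b\<in>Basis. (v \<bullet> b) * pd b g ?q)"
      unfolding sum_subtractf[symmetric] by (rule sum.cong) (simp_all add: inner_diff_left snd_jet algebra_simps)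
    also have "\<dots> = fst ?l"
      using pd_basis[OF q(2) f(1), of v] pd_basis[OF q(2) f(2), of v] by simp
    finally show "fst ?l = fst ?r" by simp
    show "snd ?l = snd ?r"
    proof (rule euclidean_eqI)
      fix j :: "real ^ 'n" assume j: "j \<in> Basis"
      have "pd a (pd j f) ?q - pd a (pd j g) ?q = (\<Sum>k\<in>Basis. christoffel a j k ?q * (pd k f ?q - pd k g ?q))"
        if "a \<in> Basis" for a
        using eq[OF that j] unfolding nabla_d_coord_fields[OF q(1) f(1)] nabla_d_coord_fields[OF q(1) f(2)]
        by (simp add: right_diff_distrib sum_subtractf)
      then have "(\<Sum>a\<in>Basis. (v \<bullet> a) * (pd a (pd j f) ?q - pd a (pd j g) ?q))
          = (\<Sum>a\<in>Basis. \<Sum>k\<in>Basis. (v \<bullet> a) * christoffel a j k ?q * (pd k f ?q - pd k g ?q))"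
        by (simp add: sum_distrib_left mult.assoc)
      moreover have "snd ?l \<bullet> j = pd v (pd j f) ?q - pd v (pd j g) ?q"
        using j by (simp add: inner_diff_left)
      moreover have "\<dots> = (\<Sum>a\<in>Basis. (v \<bullet> a) * (pd a (pd j f) ?q - pd a (pd j g) ?q))"
        using pd_basis[OF q(2) pd_smooth_near[OF f(1) q(2)], of v j] pd_basis[OF q(2) pd_smooth_near[OF f(2) q(2)], of v j]
        by (simp add: right_diff_distrib sum_subtractf)
      moreover have "snd ?r \<bullet> j = (\<Sum>a\<in>Basis. \<Sum>k\<in>Basis. (v \<bullet> a) * christoffel a j k ?q * (pd k f ?q - pd k g ?q))"
        unfolding parallel_system_snd[OF j] by (intro sum.cong refl) (simp add: christoffel_coord_def inner_diff_left snd_jet)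
      ultimately show "snd ?l \<bullet> j = snd ?r \<bullet> j" by simp
    qed
  qed
  then have "(\<lambda>v. (pd v f ?q, \<Sum>b\<in>Basis. pd v (pd b f) ?q *\<^sub>R b) - (pd v g ?q, \<Sum>b\<in>Basis. pd v (pd b g) ?q *\<^sub>R b))
      = (\<lambda>v. parallel_system x v (jet f x - jet g x))" by (rule ext)
  with has_derivative_diff[OF dj[OF f(1)] dj[OF f(2)]] show ?thesis by (rule has_derivative_eq_rhs)
qed

lemma unique_continuation:
  assumes L: "linear_system parallel_system parallel_system' S C D C'" and SP: "S \<subseteq> \<phi> ` P" and x: "x0 \<in> S" "x \<in> S"
    and f: "\<And>x. x \<in> S \<Longrightarrow> smooth_near (\<psi> x) f" "\<And>x. x \<in> S \<Longrightarrow> smooth_near (\<psi> x) g"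
    and eq: "\<And>x a b. x \<in> S \<Longrightarrow> a \<in> Basis \<Longrightarrow> b \<in> Basis \<Longrightarrow>
      nabla_d nabla f (coord_field a) (coord_field b) (\<psi> x) = nabla_d nabla g (coord_field a) (coord_field b) (\<psi> x)"
    and jet: "jet f x0 = jet g x0"
  shows "f (\<psi> x) = g (\<psi> x)"
proof -
  interpret linear_system parallel_system parallel_system' S C D C' by fact
  have "jet f x - jet g x = 0"
  proof (rule unique[OF x])
    show "((\<lambda>x. jet f x - jet g x) has_derivative (\<lambda>w. parallel_system y w (jet f y - jet g y))) (at y)" if "y \<in> S" for y
      using SP by (intro jet_diff_derivative f[OF that] eq[OF that]) (use that in auto)
  qed (use jet in simp)
  then have "fst (jet f x) = fst (jet g x)" by simp
  then show ?thesis by (simp add: jet_def)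
qed

text \<open>The first component of a solution of the parallel system is the function sought. The
  second component is then its gradient, so the initial value \<open>c\<close> prescribes the 1-jet
  at \<open>x0\<close>.\<close>

lemma parallel_function_exists:
  assumes L: "linear_system parallel_system parallel_system' S C D C'" and SP: "S \<subseteq> \<phi> ` P" and x0: "x0 \<in> S"
  obtains k where "smooth_fun (V \<inter> \<phi> -` S) k" "jet k x0 = c"
    "\<And>q X Y. q \<in> V \<inter> \<phi> -` S \<Longrightarrow> X \<in> vector_fields \<Longrightarrow> Y \<in> vector_fields \<Longrightarrow> nabla_d nabla k X Y q = 0"
proof -
  interpret linear_system_at parallel_system parallel_system' S C D C' x0
    using L x0 by (simp add: linear_system_at_def linear_system_at_axioms_def)
  have int: "parallel_system' x w v f + parallel_system x v (parallel_system x w f) = parallel_system' x v w f + parallel_system x w (parallel_system x v f)" if "x \<in> S" for x v w f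
    by (rule parallel_system_integrable) (use that SP in blast)
  obtain u where u: "u x0 = c" "\<And>x. x \<in> S \<Longrightarrow> (u has_derivative (\<lambda>w. parallel_system x w (u x))) (at x)"
    by (rule existence[OF int, where c=c]) (assumption, rule that)
  let ?W = "V \<inter> \<phi> -` S"
  have oS: "open S" by (rule linear_system.S(2)[OF L])
  have SV: "S \<subseteq> \<phi> ` V" using SP P_V by blast
  have \<phi>W: "\<phi> ` ?W = S" using SV by auto
  have WP: "?W \<subseteq> P"
  proof
    fix q assume q: "q \<in> ?W"
    then obtain p where "p \<in> P" "\<phi> q = \<phi> p" using SP by blast
    then show "q \<in> P" using q P_V chart_inj[OF chart] by (metis IntD1 inj_onD subsetD)
  qed
  have oW: "openin (top_of_set M) ?W" by (rule chart_preimage_open[OF chart oS])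
  have dfst: "((\<lambda>x. fst (u x)) has_derivative (\<lambda>v. \<Sum>b\<in>Basis. (v \<bullet> b) * (snd (u x) \<bullet> b))) (at x)" if "x \<in> S" for x
  proof -
    have d: "((\<lambda>x. fst (u x)) has_derivative (\<lambda>v. snd (u x) \<bullet> v)) (at x)"
      using has_derivative_fst[OF u(2)[OF that]] by (simp add: parallel_system_fst)
    have "snd (u x) \<bullet> v = (\<Sum>b\<in>Basis. (v \<bullet> b) * (snd (u x) \<bullet> b))" for v
      by (subst euclidean_inner) (simp add: mult.commute)
    then have "(\<lambda>v. snd (u x) \<bullet> v) = (\<lambda>v. \<Sum>b\<in>Basis. (v \<bullet> b) * (snd (u x) \<bullet> b))" by (rule ext)
    with d show ?thesis by (rule has_derivative_eq_rhs)
  qed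
  have dsnd: "((\<lambda>x. snd (u x) \<bullet> j) has_derivative
      (\<lambda>v. \<Sum>i\<in>Basis. \<Sum>k\<in>Basis. (v \<bullet> i) * christoffel_coord i j k x * (snd (u x) \<bullet> k))) (at x)"
    if "x \<in> S" "j \<in> Basis" for x j
    using has_derivative_inner_left[OF has_derivative_snd[OF u(2)[OF that(1)]], of j] by (simp add: parallel_system_snd[OF that(2)])
  have G: "Ck_on n S (christoffel_coord i j k)" for n i j k
    using smooth_on_subset[OF christoffel_coord_smooth SP] by (simp add: smooth_on_def)
  \<comment> \<open>Bootstrapping: the system expresses the derivatives of \<open>u\<close> by its
    own components with smooth coefficients, so each order of differentiability gives the next. Both
    components are treated together because each derivative formula involves the second one.\<close>
  have Ck: "Ck_on n S (\<lambda>x. fst (u x)) \<and> (\<forall>j\<in>Basis. Ck_on n S (\<lambda>x. snd (u x) \<bullet> j))" for n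
  proof (induction n)
    case 0
    have "continuous_on S (\<lambda>x. fst (u x))" "\<forall>j\<in>Basis. continuous_on S (\<lambda>x. snd (u x) \<bullet> j)"
      using has_derivative_continuous[OF dfst] has_derivative_continuous[OF dsnd] 
      by (auto intro: continuous_at_imp_continuous_on)
    then show ?case by simp
  next
    case (Suc n)
    have "Ck_on (Suc n) S (\<lambda>x. fst (u x))"
    proof (rule Ck_on_SucI[OF oS dfst])
      show "Ck_on n S (\<lambda>x. \<Sum>b\<in>Basis. (v \<bullet> b) * (snd (u x) \<bullet> b))" for v
        using Suc by (intro Ck_on_sum[OF oS] Ck_on_mult[OF oS] Ck_on_const) auto
    qed
    moreover have "Ck_on (Suc n) S (\<lambda>x. snd (u x) \<bullet> j)" if j: "j \<in> Basis" for j
    proof (rule Ck_on_SucI[OF oS dsnd[OF _ j]])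
      show "Ck_on n S (\<lambda>x. \<Sum>i\<in>Basis. \<Sum>k\<in>Basis. (v \<bullet> i) * christoffel_coord i j k x * (snd (u x) \<bullet> k))" for v
        using Suc by (intro Ck_on_sum[OF oS] Ck_on_mult[OF oS] Ck_on_const G) auto
    qed
    ultimately show ?case by blast
  qed
  define k where "k q = fst (u (\<phi> q))" for q
  have k: "smooth_fun ?W k"
  proof (rule smooth_fun_chartI[OF chart oW])
    have "(k \<circ> \<psi>) x = fst (u x)" if "x \<in> S" for x using that SV \<phi>_\<psi> by (auto simp: k_def)
    then have "smooth_on S (k \<circ> \<psi>) \<longleftrightarrow> smooth_on S (\<lambda>x. fst (u x))" by (rule smooth_on_cong[OF oS])
    then show "smooth_on (\<phi> ` ?W) (k \<circ> \<psi>)" unfolding \<phi>W using Ck by (simp add: smooth_on_def)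
  qed auto
  have pdk: "pd b k q = snd (u (\<phi> q)) \<bullet> b" if q: "q \<in> ?W" and b: "b \<in> Basis" for q b
  proof -
    have "((\<lambda>x. fst (u x)) has_derivative (\<lambda>v. snd (u (\<phi> q)) \<bullet> v)) (at (\<phi> q))"
      using has_derivative_fst[OF u(2)] q by (simp add: parallel_system_fst)
    then have "((k \<circ> \<psi>) has_derivative (\<lambda>v. snd (u (\<phi> q)) \<bullet> v)) (at (\<phi> q))"
      by (rule has_derivative_transform_within_open[OF _ oS]) (use q SV \<phi>_\<psi> in \<open>auto simp: k_def\<close>)
    from pd_eqI[OF _ oW q _ this] show ?thesis using q by blast
  qed
  show thesis
  proof (rule that[OF k])
    have "\<psi> x0 \<in> ?W" "\<phi> (\<psi> x0) = x0" using x0 SV \<psi>_in \<phi>_\<psi> by auto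
    then have "jet k x0 = (fst c, \<Sum>b\<in>Basis. (snd c \<bullet> b) *\<^sub>R b)"
      unfolding jet_def by (simp add: pdk k_def u(1))
    then show "jet k x0 = c" by (simp add: euclidean_representation)
    fix q X Y assume q: "q \<in> ?W" and XY: "X \<in> vector_fields" "Y \<in> vector_fields"
    have qP: "q \<in> P" "q \<in> V" "\<phi> q \<in> S" using q WP by auto
    have kq: "smooth_near q k" using k q by (rule smooth_nearI)
    have "nabla_d nabla k (coord_field a) (coord_field b) q = 0" if b: "b \<in> Basis" and a: "a \<in> Basis" for a b
    proof -
      have "(((\<lambda>q. snd (u (\<phi> q)) \<bullet> b) \<circ> \<psi>) has_derivative
        (\<lambda>v. \<Sum>i\<in>Basis. \<Sum>m\<in>Basis. (v \<bullet> i) * christoffel_coord i b m (\<phi> q) * (snd (u (\<phi> q)) \<bullet> m))) (at (\<phi> q))"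
        by (rule has_derivative_transform_within_open[OF dsnd[OF qP(3) b] oS qP(3)]) (use SV \<phi>_\<psi> in auto)
      from pd_eqI[OF qP(2) oW q _ this, of "pd b k" a]
      have "pd a (pd b k) q = (\<Sum>i\<in>Basis. \<Sum>m\<in>Basis. (a \<bullet> i) * christoffel_coord i b m (\<phi> q) * (snd (u (\<phi> q)) \<bullet> m))"
        using pdk b by simp
      also have "\<dots> = (\<Sum>i\<in>Basis. if i = a then \<Sum>m\<in>Basis. christoffel i b m q * pd m k q else 0)"
        by (rule sum.cong[OF refl]) (use a q in \<open>auto simp: inner_Basis christoffel_coord_def \<psi>_\<phi> pdk intro!: sum.cong\<close>)
      finally show ?thesis unfolding nabla_d_coord_fields[OF qP(1) kq] using a by simp
    qed
    then show "nabla_d nabla k X Y q = 0"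
      unfolding nabla_d_left_expansion[OF qP(1) kq XY] nabla_d_right_expansion[OF qP(1) kq coord_field_vector_field XY(2)]
      by (simp add: sum.neutral)
  qed
qed

lemma jet_add:
  assumes "x \<in> \<phi> ` V" "smooth_near (\<psi> x) f" "smooth_near (\<psi> x) g"
  shows "jet (\<lambda>q. f q + g q) x = jet f x + jet g x"
  using pd_lincomb[OF \<psi>_in[OF assms(1)] assms(2,3), of _ 1 1]
  by (simp add: jet_def scaleR_add_left sum.distrib)

end

context affine_manifold
begin

lemma nabla_d_add:
  assumes X: "X \<in> vector_fields" "Y \<in> vector_fields" and q: "q \<in> M" and f: "smooth_near q f" "smooth_near q g"
  shows "nabla_d nabla (\<lambda>x. f x + g x) X Y q = nabla_d nabla f X Y q + nabla_d nabla g X Y q"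
proof -
  obtain U where U: "q \<in> U" "smooth_fun U f" "smooth_fun U g" using smooth_near_common[OF f] by blast
  have t: "X q \<in> tangent_space q" by (rule vector_field_tangent[OF X(1) q])
  have t': "nabla X Y q \<in> tangent_space q" by (rule vector_field_tangent[OF nabla_vector_field[OF X] q])
  have eq: "Y x (\<lambda>x. f x + g x) = Y x f + Y x g" if x: "x \<in> U" for x
    using x smooth_fun_subset_M[OF U(2)]
    by (intro tangent_add[OF vector_field_tangent[OF X(2)] smooth_nearI[OF U(2)] smooth_nearI[OF U(3)]]) auto
  have "X q (\<lambda>x. Y x (\<lambda>x. f x + g x)) = X q (\<lambda>x. Y x f + Y x g)"
    by (rule tangent_local[OF t U(1) vector_field_smooth[OF X(2) smooth_fun_add[OF U(2,3)]] eq])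
  also have "\<dots> = X q (\<lambda>x. Y x f) + X q (\<lambda>x. Y x g)"
    by (rule tangent_add[OF t vector_field_smooth_near[OF X(2) f(1)] vector_field_smooth_near[OF X(2) f(2)]])
  finally show ?thesis unfolding nabla_d_def using tangent_add[OF t' f] by simp
qed

lemma affine_chart_exists:
  assumes p: "p \<in> M"
  obtains V \<phi> \<rho> P K where "affine_chart M charts nabla V \<phi> \<rho> P K" "p \<in> P"
proof -
  obtain V \<phi> where c: "(V, \<phi>) \<in> charts" "p \<in> V" using p charts_cover by blast
  interpret manifold_chart M charts V \<phi> by unfold_locales (rule c(1))
  obtain e where e: "e > 0" "cball (\<phi> p) e \<subseteq> \<phi> ` V"
    using chart_image_open[OF chart] c(2) open_contains_cball by blast
  \<comment> \<open>The bump is 1 on the ball of radius \<open>r\<close> and vanishes off the closed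
    ball of radius \<open>2 * r = e\<close>, which still lies in the image of the chart.\<close>
  define r where "r = e / 2"
  have r: "r > 0" "cball (\<phi> p) (2 * r) \<subseteq> \<phi> ` V" using e by (auto simp: r_def)
  obtain b :: "real ^ 'n \<Rightarrow> real" where b: "smooth_on UNIV b" "\<And>x. x \<in> ball (\<phi> p) r \<Longrightarrow> b x = 1"
    "\<And>x. x \<notin> cball (\<phi> p) (2*r) \<Longrightarrow> b x = 0"
    using smooth_bump_exists[OF r(1), of "\<phi> p"] by blast
  define \<rho> where "\<rho> q = (if q \<in> V then b (\<phi> q) else 0)" for q
  define K where "K = \<psi> ` cball (\<phi> p) (2 * r)"
  have "continuous_on (\<phi> ` V) \<psi>" using chart_homeo[OF chart] by (simp add: homeomorphism_def)
  then have "compact K" unfolding K_def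
    by (intro compact_continuous_image) (use r(2) in \<open>auto intro: continuous_on_subset\<close>)
  have KV: "K \<subseteq> V" using r(2) \<psi>_in by (auto simp: K_def)
  \<comment> \<open>Compact sets are closed in the Hausdorff space \<open>M\<close>. In a
    non-Hausdorff space, extension by zero could fail to be smooth at limit points of
    \<open>K\<close> outside the chart.\<close>
  then have "compactin (top_of_set M) K"
    using \<open>compact K\<close> V_subset by (auto simp: compactin_subtopology)
  then have "closedin (top_of_set M) K" by (rule compactin_imp_closedin[OF Hausdorff])
  then have K_open: "openin (top_of_set M) (M - K)" by (simp add: closedin_def)
  have \<rho>K: "\<rho> q = 0" if "q \<in> M - K" for q
  proof (cases "q \<in> V")
    case True
    then have "\<phi> q \<notin> cball (\<phi> p) (2 * r)" using that by (force simp: K_def \<psi>_\<phi> image_iff)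
    then show ?thesis using b(3) by (simp add: \<rho>_def)
  qed (simp add: \<rho>_def)
  have "smooth_fun M \<rho>"
  proof (rule smooth_fun_local)
    fix q assume q: "q \<in> M"
    show "\<exists>W. q \<in> W \<and> smooth_fun W \<rho>"
    proof (cases "q \<in> V")
      case True
      have "smooth_fun V \<rho>"
      proof (rule smooth_fun_chartI[OF chart V_open order_refl])
        have "smooth_on (\<phi> ` V) b" using b(1) by (rule smooth_on_subset) simp
        then show "smooth_on (\<phi> ` V) (\<rho> \<circ> \<psi>)"
          by (rule smooth_on_cong[OF chart_image_open[OF chart], THEN iffD1, rotated]) (auto simp: \<rho>_def \<psi>_\<phi>)
      qed
      then show ?thesis using True by (intro exI[of _ V] conjI)
    next
      case False
      have "smooth_fun (M - K) \<rho>"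
        by (rule smooth_fun_cong[OF smooth_fun_const[OF K_open]]) (simp add: \<rho>K)
      then show ?thesis using False q KV by (intro exI[of _ "M - K"] conjI) auto
    qed
  qed simp
  then have "bump_chart M charts V \<phi> \<rho> (V \<inter> \<phi> -` ball (\<phi> p) r) K"
    by unfold_locales (use b KV K_open \<rho>K chart_preimage_open[OF chart open_ball] in \<open>auto simp: \<rho>_def\<close>)
  then have "affine_chart M charts nabla V \<phi> \<rho> (V \<inter> \<phi> -` ball (\<phi> p) r) K"
    by (rule affine_chart.intro[OF affine_manifold_axioms])
  then show thesis by (rule that) (use c r in auto)
qed

end

section \<open>Potentials form a locally constant sheaf without maxima\<close>

context hessian_manifold
begin

definition potential :: "'a set \<Rightarrow> ('a \<Rightarrow> real) \<Rightarrow> bool" where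
  "potential U f \<longleftrightarrow> smooth_fun U f \<and>
     (\<forall>q\<in>U. \<forall>X\<in>vector_fields. \<forall>Y\<in>vector_fields. h q (X q) (Y q) = nabla_d nabla f X Y q)"

lemma potential_smooth: "potential U f \<Longrightarrow> smooth_fun U f"
  by (simp add: potential_def)

lemma potential_nabla_d:
  "potential U f \<Longrightarrow> q \<in> U \<Longrightarrow> X \<in> vector_fields \<Longrightarrow> Y \<in> vector_fields \<Longrightarrow> nabla_d nabla f X Y q = h q (X q) (Y q)"
  by (simp add: potential_def)

lemma potential_subset:
  "potential U f \<Longrightarrow> openin (top_of_set M) W \<Longrightarrow> W \<subseteq> U \<Longrightarrow> potential W f"
  unfolding potential_def by (auto intro: smooth_fun_subset)

lemma potential_exists: "p \<in> M \<Longrightarrow> \<exists>U f. p \<in> U \<and> potential U f"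
  using hessian_metric unfolding hessian_metric_def potential_def by blast

lemma potential_continuous:
  assumes "potential U f"
  shows "continuous_on U f"
proof -
  note s = potential_smooth[OF assms]
  have "(f \<longlongrightarrow> f q) (at q within U)" if q: "q \<in> U" for q
  proof -
    obtain V \<phi> where c: "(V, \<phi>) \<in> charts" "q \<in> V"
      using q smooth_fun_subset_M[OF s] charts_cover by blast
    have f: "continuous_on (\<phi> ` (U \<inter> V)) (f \<circ> inv_into V \<phi>)"
      by (rule smooth_on_imp_continuous_on[OF smooth_funD[OF s c(1)]])
    have "continuous_on (U \<inter> V) \<phi>"
      using chart_homeo[OF c(1)] by (auto simp: homeomorphism_def intro: continuous_on_subset)
    then have "continuous_on (U \<inter> V) ((f \<circ> inv_into V \<phi>) \<circ> \<phi>)"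
      using f by (rule continuous_on_compose)
    then have "continuous_on (U \<inter> V) f"
      by (rule continuous_on_eq) (use chart_inj[OF c(1)] in auto)
    then have "(f \<longlongrightarrow> f q) (at q within U \<inter> V)" using q c(2) by (simp add: continuous_on_def)
    moreover obtain P where P: "open P" "V = M \<inter> P"
      using chart_domain_open[OF c(1)] unfolding openin_open by blast
    have "at q within U \<inter> V = at q within U"
      by (rule at_within_nhd[of q P]) (use P q c(2) smooth_fun_subset_M[OF s] in auto)
    ultimately show ?thesis by simp
  qed
  then show ?thesis by (simp add: continuous_on_def)
qed

lemma potential_no_maximum:
  assumes f: "potential U f" and q: "q \<in> U" and max: "\<And>y. y \<in> U \<Longrightarrow> f y \<le> f q"
  shows False
proof -
  note s = potential_smooth[OF f]
  have qM: "q \<in> M" using q smooth_fun_subset_M[OF s] by blast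
  obtain V \<phi> \<rho> P K where C: "affine_chart M charts nabla V \<phi> \<rho> P K" and qP: "q \<in> P"
    using affine_chart_exists[OF qM] by blast
  interpret C: affine_chart M charts nabla V \<phi> \<rho> P K by (rule C)
  have qV: "q \<in> V" using qP C.P_V by blast
  have near: "smooth_near y f" if "y \<in> U" for y using s that by (rule smooth_nearI)
  \<comment> \<open>The dimension is at least 1, so there is a direction in which positivity of
    \<open>h\<close> can be contradicted.\<close>
  obtain b :: "real ^ 'n" where b: "b \<in> Basis" using nonempty_Basis by blast
  let ?S = "\<phi> ` (U \<inter> P \<inter> V)"
  have S: "open ?S" "\<phi> q \<in> ?S"
    using chart_image_open_Int[OF C.chart openin_Int[OF smooth_fun_openin[OF s] C.P_open]] q qP qV by auto
  have d1: "((f \<circ> C.\<psi>) has_derivative (\<lambda>v. C.pd v f (C.\<psi> x))) (at x)" if x: "x \<in> ?S" for x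
    using x C.pd_has_derivative[OF near] by (auto simp: C.\<psi>_\<phi>)
  have d2: "((\<lambda>x. C.pd b f (C.\<psi> x)) has_derivative (\<lambda>v. C.pd v (C.pd b f) q)) (at (\<phi> q))"
    using C.pd_has_derivative[OF C.pd_smooth_near[OF near[OF q] qV] qV] by (simp add: o_def)
  have m: "(f \<circ> C.\<psi>) x \<le> (f \<circ> C.\<psi>) (\<phi> q)" if "x \<in> ?S" for x
    using that max qV by (auto simp: C.\<psi>_\<phi>)
  have "C.pd w f q = 0" for w
    using smooth_maximum_second_derivative(1)[OF S d1 d2 m] qV by (simp add: C.\<psi>_\<phi>)
  moreover have "C.pd b (C.pd b f) q \<le> 0"
    by (rule smooth_maximum_second_derivative(2)[OF S d1 d2 m])
  \<comment> \<open>The Christoffel terms are multiplied by first derivatives of \<open>f\<close>,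
    which vanish at the maximum; only the ordinary second derivative remains.\<close>
  ultimately have "nabla_d nabla f (C.coord_field b) (C.coord_field b) q \<le> 0"
    unfolding C.nabla_d_coord_fields[OF qP near[OF q]] by simp
  moreover have "h q (C.coord_field b q) (C.coord_field b q) > 0"
  proof -
    have "C.coord_field b q (C.coord b) \<noteq> 0" using C.coord_field_coord[OF qP] b by simp
    then have "C.coord_field b q \<noteq> (\<lambda>u. 0)" by auto
    moreover have "riemannian_metric h" using hessian_metric by (simp add: hessian_metric_def)
    ultimately show ?thesis using C.coord_field_tangent qM unfolding riemannian_metric_def by blast
  qed
  ultimately show False
    using potential_nabla_d[OF f q C.coord_field_vector_field C.coord_field_vector_field, of b b] by simp
qed

text \<open>Near \<open>p\<close> every potential is a fixed one, \<open>f0\<close>, plus a function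
  with vanishing Hessian, and \<open>W\<close> is a coordinate ball on which the parallel system
  satisfies the smallness condition. The ball is chosen before \<open>q\<close> and \<open>f\<close>
  are given.\<close>

lemma potential_neighbourhood:
  assumes Q: "openin (top_of_set M) Q" "p \<in> Q"
  shows "\<exists>W. openin (top_of_set M) W \<and> p \<in> W \<and> W \<subseteq> Q \<and> path_connected W \<and>
    (\<forall>q U f. q \<in> W \<and> q \<in> U \<and> potential U f \<longrightarrow> (\<exists>g. potential W g \<and> germ_eq M q f g)) \<and>
    (\<forall>q f g. q \<in> W \<and> potential W f \<and> potential W g \<and> germ_eq M q f g \<longrightarrow> (\<forall>x\<in>W. f x = g x))"
proof -
  have pM: "p \<in> M" using Q openin_imp_subset by blast
  obtain V \<phi> \<rho> P K where C: "affine_chart M charts nabla V \<phi> \<rho> P K" and pP: "p \<in> P"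
    using affine_chart_exists[OF pM] by blast
  interpret C: affine_chart M charts nabla V \<phi> \<rho> P K by (rule C)
  obtain U0 f0 where f0: "p \<in> U0" "potential U0 f0" using potential_exists[OF pM] by blast
  \<comment> \<open>Inside \<open>P\<close> the coordinate formulas hold, on \<open>U0\<close> the
    potential \<open>f0\<close> is available, and \<open>Q\<close> is the prescribed bound for
    \<open>W\<close>.\<close>
  let ?X = "\<phi> ` (P \<inter> U0 \<inter> Q \<inter> V)"
  have X: "open ?X" "\<phi> p \<in> ?X" "?X \<subseteq> \<phi> ` P"
    using chart_image_open_Int[OF C.chart openin_Int[OF openin_Int[OF C.P_open smooth_fun_openin[OF potential_smooth[OF f0(2)]]] Q(1)]]
      pP f0(1) Q(2) C.P_V by auto
  obtain r Ca D Cb where r: "r > 0" "ball (\<phi> p) r \<subseteq> ?X" and L: "linear_system C.parallel_system C.parallel_system' (ball (\<phi> p) r) Ca D Cb"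
    by (rule linear_system_exists[OF X(1,2) C.parallel_system_derivative continuous_on_subset[OF C.parallel_system'_continuous X(3)]])
      (use X(3) in blast)+
  let ?S = "ball (\<phi> p) r"
  define W where "W = V \<inter> \<phi> -` ?S"
  have SP: "?S \<subseteq> \<phi> ` P" using r(2) X(3) by blast
  have SV: "?S \<subseteq> \<phi> ` V" using SP C.P_V by blast
  have W: "openin (top_of_set M) W" unfolding W_def by (rule chart_preimage_open[OF C.chart open_ball])
  have W_sub: "W \<subseteq> P \<inter> U0 \<inter> Q"
  proof
    fix x assume "x \<in> W"
    then have "x \<in> V" "\<phi> x \<in> ?X" using r(2) by (auto simp: W_def)
    then show "x \<in> P \<inter> U0 \<inter> Q" using chart_inj[OF C.chart] by (auto dest: inj_onD)
  qed
  have WV: "W \<subseteq> V" by (auto simp: W_def)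
  have WM: "W \<subseteq> M" using openin_imp_subset[OF W] .
  have W\<psi>: "W = C.\<psi> ` ?S"
  proof
    show "W \<subseteq> C.\<psi> ` ?S"
    proof
      fix y assume "y \<in> W"
      then have "y = C.\<psi> (\<phi> y)" "\<phi> y \<in> ?S" by (auto simp: W_def C.\<psi>_\<phi>)
      then show "y \<in> C.\<psi> ` ?S" by blast
    qed
    show "C.\<psi> ` ?S \<subseteq> W"
    proof
      fix y assume "y \<in> C.\<psi> ` ?S"
      then obtain x where x: "x \<in> ?S" "y = C.\<psi> x" by blast
      then have "x \<in> \<phi> ` V" using SV by blast
      then show "y \<in> W" using x C.\<phi>_\<psi> C.\<psi>_in by (simp add: W_def)
    qed
  qed
  have \<psi>W: "C.\<psi> x \<in> W" if "x \<in> ?S" for x using that W\<psi> by blast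
  have pc: "path_connected W"
  proof -
    have "continuous_on (\<phi> ` V) C.\<psi>" using chart_homeo[OF C.chart] by (simp add: homeomorphism_def)
    then have "continuous_on ?S C.\<psi>" using SV by (rule continuous_on_subset)
    then show ?thesis unfolding W\<psi>
      by (rule path_connected_continuous_image) (simp add: convex_imp_path_connected)
  qed
  have f0W: "potential W f0" using potential_subset[OF f0(2) W] W_sub by blast
  have near: "smooth_near y f" if "potential U f" "y \<in> U" for U f y
    using smooth_nearI[OF potential_smooth[OF that(1)] that(2)] .
  have extend: "\<exists>g. potential W g \<and> germ_eq M q f g" if q: "q \<in> W" "q \<in> U" and f: "potential U f" for q U f
  proof -
    have qV: "q \<in> V" and \<phi>q: "\<phi> q \<in> ?S" using q by (auto simp: W_def)
    obtain k where k: "smooth_fun W k" "C.jet k (\<phi> q) = C.jet f (\<phi> q) - C.jet f0 (\<phi> q)"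
      "\<And>q X Y. q \<in> W \<Longrightarrow> X \<in> vector_fields \<Longrightarrow> Y \<in> vector_fields \<Longrightarrow> nabla_d nabla k X Y q = 0"
      using C.parallel_function_exists[OF L SP \<phi>q] unfolding W_def[symmetric] by blast
    \<comment> \<open>The jet of \<open>k\<close> was prescribed so that \<open>g\<close> has the
      same 1-jet at \<open>q\<close> as \<open>f\<close>; the Hessian of \<open>k\<close> vanishes,
      so \<open>g\<close> is again a potential.\<close>
    define g where "g x = f0 x + k x" for x
    have gd: "nabla_d nabla g X Y x = h x (X x) (Y x)" if "x \<in> W" "X \<in> vector_fields" "Y \<in> vector_fields" for x X Y
    proof -
      have "nabla_d nabla g X Y x = nabla_d nabla f0 X Y x + nabla_d nabla k X Y x"
        unfolding g_def[abs_def]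
        by (rule nabla_d_add[OF that(2,3) _ near[OF f0W that(1)] smooth_nearI[OF k(1) that(1)]]) (use WM that in blast)
      then show ?thesis using k(3)[OF that] potential_nabla_d[OF f0W that] by simp
    qed
    have g: "potential W g"
      unfolding potential_def using gd smooth_fun_add[OF potential_smooth[OF f0W] k(1)] by (simp add: g_def[abs_def])
    have "C.jet g (\<phi> q) = C.jet f0 (\<phi> q) + C.jet k (\<phi> q)"
      unfolding g_def[abs_def]
      by (rule C.jet_add) (use qV q near[OF f0W] smooth_nearI[OF k(1)] in \<open>auto simp: C.\<psi>_\<phi>\<close>)
    then have jet: "C.jet f (\<phi> q) = C.jet g (\<phi> q)" using k(2) by simp
    have "open (\<phi> ` (U \<inter> W \<inter> V))"
      by (rule chart_image_open_Int[OF C.chart openin_Int[OF smooth_fun_openin[OF potential_smooth[OF f]] W]])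
    moreover have "\<phi> q \<in> \<phi> ` (U \<inter> W \<inter> V)" using q qV by blast
    ultimately obtain e where e: "e > 0" "ball (\<phi> q) e \<subseteq> \<phi> ` (U \<inter> W \<inter> V)"
      using open_contains_ball by blast
    \<comment> \<open>\<open>f\<close> is a potential only on \<open>U\<close>, whose image in the
      chart need not be convex. Uniqueness is therefore applied on a small ball around
      \<open>\<phi> q\<close>, and agreement there suffices for equality of germs.\<close>
    let ?B = "ball (\<phi> q) e"
    have "\<phi> ` (U \<inter> W \<inter> V) \<subseteq> ?S" by (auto simp: W_def)
    then have BS: "?B \<subseteq> ?S" using e(2) by blast
    have LB: "linear_system C.parallel_system C.parallel_system' ?B Ca D Cb"
      by (rule linear_system_subset[OF L BS convex_ball open_ball])
    have B\<psi>: "C.\<psi> x \<in> U" "C.\<psi> x \<in> W" if "x \<in> ?B" for x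
    proof -
      have "x \<in> \<phi> ` (U \<inter> W \<inter> V)" using that e(2) by blast
      then show "C.\<psi> x \<in> U" "C.\<psi> x \<in> W" by (auto simp: C.\<psi>_\<phi>)
    qed
    have eq: "f (C.\<psi> x) = g (C.\<psi> x)" if x: "x \<in> ?B" for x
    proof (rule C.unique_continuation[OF LB _ _ x _ _ _ jet])
      show "?B \<subseteq> \<phi> ` P" using BS SP by blast
      show "\<phi> q \<in> ?B" using e(1) by simp
      show "smooth_near (C.\<psi> x) f" "smooth_near (C.\<psi> x) g" if "x \<in> ?B" for x
        using near[OF f] near[OF g] B\<psi>[OF that] by auto
      show "nabla_d nabla f (C.coord_field a) (C.coord_field b) (C.\<psi> x) = nabla_d nabla g (C.coord_field a) (C.coord_field b) (C.\<psi> x)" if "x \<in> ?B" for x a b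
        using potential_nabla_d[OF f B\<psi>(1)[OF that] C.coord_field_vector_field C.coord_field_vector_field] gd[OF B\<psi>(2)[OF that] C.coord_field_vector_field C.coord_field_vector_field]
        by simp
    qed
    have "germ_eq M q f g"
    proof (rule germ_eqI[OF chart_preimage_open[OF C.chart open_ball]])
      show "q \<in> V \<inter> \<phi> -` ?B" using qV e(1) by simp
      show "f x = g x" if "x \<in> V \<inter> \<phi> -` ?B" for x using eq[of "\<phi> x"] that by (simp add: C.\<psi>_\<phi>)
    qed
    with g show ?thesis by blast
  qed
  have unique: "f x = g x" if q: "q \<in> W" and f: "potential W f" and g: "potential W g" and e: "germ_eq M q f g" and x: "x \<in> W"
    for q f g x
  proof -
    have qV: "q \<in> V" and \<phi>q: "\<phi> q \<in> ?S" and xV: "x \<in> V" and \<phi>x: "\<phi> x \<in> ?S"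
      using q x by (auto simp: W_def)
    obtain O' where O': "openin (top_of_set M) O'" "q \<in> O'" "\<And>x. x \<in> O' \<Longrightarrow> f x = g x"
      using e unfolding germ_eq_def by blast
    \<comment> \<open>Equal germs have equal 1-jets, and on the whole ball a potential is determined
      by its jet at \<open>\<phi> q\<close>.\<close>
    have "C.pd b g q = C.pd b f q" for b by (rule C.pd_cong[OF qV near[OF f q] O'])
    then have jet: "C.jet f (\<phi> q) = C.jet g (\<phi> q)"
      using O' by (simp add: C.jet_def C.\<psi>_\<phi>[OF qV])
    have "f (C.\<psi> (\<phi> x)) = g (C.\<psi> (\<phi> x))"
      by (rule C.unique_continuation[OF L SP \<phi>q \<phi>x _ _ _ jet])
        (use near[OF f] near[OF g] \<psi>W potential_nabla_d[OF f _ C.coord_field_vector_field C.coord_field_vector_field]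
          potential_nabla_d[OF g _ C.coord_field_vector_field C.coord_field_vector_field] in simp_all)
    then show ?thesis by (simp add: C.\<psi>_\<phi>[OF xV])
  qed
  have "p \<in> W" using pP C.P_V r(1) by (auto simp: W_def)
  then show ?thesis using W W_sub pc extend unique by (intro exI[of _ W]) auto
qed

lemma locally_constant_potentials: "locally_constant_sheaf M potential"
proof
  show "openin (top_of_set M) U" if "potential U f" for U f
    using smooth_fun_openin[OF potential_smooth[OF that]] .
qed (fact potential_subset potential_continuous potential_exists potential_neighbourhood)+

end

theorem corollary2p6:
  fixes M :: "'a::topological_space set"
    and charts :: "('a set \<times> ('a \<Rightarrow> real ^ 'n)) set"
    and nabla :: "'a vfield \<Rightarrow> 'a vfield \<Rightarrow> 'a vfield"
    and h :: "'a \<Rightarrow> 'a tvec \<Rightarrow> 'a tvec \<Rightarrow> real"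
    and x\<^sub>0 :: 'a
  assumes "hessian_manifold M charts nabla h"
    and "compact M"
    and "x\<^sub>0 \<in> M"
  shows "infinite (carrier (fundamental_group M x\<^sub>0))"
proof
  interpret hessian_manifold M charts nabla h by fact
  interpret locally_constant_sheaf M potential by (rule locally_constant_potentials)
  assume "finite (carrier (fundamental_group M x\<^sub>0))"
  from local_maximum_if_finite_fundamental_group[OF connected assms(2,3) this]
  show False using potential_no_maximum by metis
qed

end
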